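(* Suppose that $(N\subset P,Q\subset M)$ is a quadruple of $II_1$ factors obtained as an iterated basic construction of a non-degenerate commuting cube of finite-dimensional algebras $(A_i,B_i^1,B_i^2,C_i)_{i=0,1}$. Consider the nonnegative operator $$S_0:=E^{A_0}_{B_0^2}E^{A_0}_{B_0^1}E^{A_0}_{B_0^2}-E^{A_0}_{C_0}$$ on $A_0$, and suppose that $S_0\ne0$ and $S_0^2=\alpha S_0$ for some $\alpha\in\mathbb R_+$. Then $(N\subset P,Q\subset M)$ is not a commuting square; moreover $\mathrm{Ang}_M(P,Q)$ is the singleton set $\{\arccos\sqrt\alpha\}$.
   Context: A quadruple $(\mathcal N\subset\mathcal P,\mathcal Q\subset\mathcal M)$ of finite von Neumann algebras with a fixed trace on $\mathcal M$ is a commuting square if the trace-preserving conditional expectations satisfy $E^{\mathcal M}_{\mathcal P}E^{\mathcal M}_{\mathcal Q}=E^{\mathcal M}_{\mathcal Q}E^{\mathcal M}_{\mathcal P}=E^{\mathcal M}_{\mathcal N}$; it is non-degenerate if $\overline{\mathcal P\mathcal Q}=\overline{\mathcal Q\mathcal P}=\mathcal M$ (SOT-closures of linear spans of products). Commuting cube. Let $A_0\subset A_1$ be finite von Neumann algebras with a faithful normal tracial state on $A_1$, and for $j=1,2$ let $B_0^j\subset B_1^j$ with $B_0^j\subset A_0$, $B_1^j\subset A_1$. Put $C_i=B_i^1\cap B_i^2$, $i=0,1$. The cube is a commuting cube if both adjacent faces $(B_0^j\subset A_0,B_1^j\subset A_1)$, $j=1,2$, are commuting squares; it is a non-degenerate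 commuting cube if both adjacent faces and the slice $(C_0\subset A_0,C_1\subset A_1)$ are non-degenerate commuting squares. Iterated basic construction of a non-degenerate commuting cube of finite-dimensional algebras: all elementary inclusions are connected and the trace is the Markov trace of $A_0\subset A_1$. For $k\ge1$, $A_{k+1}=\langle A_k,e_{k+1}\rangle$ is the Jones basic construction of $A_{k-1}\subset A_k$ with Jones projection $e_{k+1}$, and $B_{k+1}^j=\langle B_k^j,e_{k+1}\rangle$, $C_{k+1}=\langle C_k,e_{k+1}\rangle$ are the algebras generated inside $A_{k+1}$. Then $M=(\bigcup_kA_k)''$, $P=(\bigcup_kB^1_k)''$, $Q=(\bigcup_kB^2_k)''$, $N=(\bigcup_kC_k)''$ (in the GNS representation of the trace). Sano-Watatani angle. For projections $p,q$ on a Hilbert space $\mathcal H$, let $\mathcal H_0$ be the orthogonal complement of the sum of the ranges of $p\wedge q$, $p\wedge q^\perp$, $p^\perp\wedge q$, $p^\perp\wedge q^\perp$. The angle operator $\Theta(p,q)$ is the positive operator on $p\mathcal H_0$ with spectrum in $[0,\pi/2]$ determined by $\cos^2\Theta(p,q)=pqp|_{p\mathcal H_0}$. Set $\mathrm{Ang}(p,q)=\mathrm{sp}\,\Theta(p,q)$ if $pq\ne qp$, and $\{\pi/2\}$ otherwise. $\mathrm{Ang}_M(P,Q)=\mathrm{Ang}(e_P,e_Q)$, where $e_P,e_Q$ are the projections of $L^2(M)$ onto $L^2(P),L^2(Q)$. *)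

theory Defs
  imports "HOL-Analysis.Analysis"
begin

section \<open>Complex Hilbert spaces and bounded operators\<close>

(* The real structure (norm, topology, completeness) is the library's; cinner is linear in its
   first argument, and its real part is the real inner product. *)
class complex_hilbert = real_inner + banach +
  fixes scaleC :: "complex \<Rightarrow> 'a \<Rightarrow> 'a" (infixr \<open>*\<^sub>C\<close> 75)
    and cinner :: "'a \<Rightarrow> 'a \<Rightarrow> complex"
  assumes scaleC_add_right: "c *\<^sub>C (x + y) = c *\<^sub>C x + c *\<^sub>C y"
    and scaleC_add_left: "(c + d) *\<^sub>C x = c *\<^sub>C x + d *\<^sub>C x"
    and scaleC_scaleC: "c *\<^sub>C (d *\<^sub>C x) = (c * d) *\<^sub>C x"
    and scaleR_scaleC: "r *\<^sub>R x = complex_of_real r *\<^sub>C x"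
    and cinner_commute: "cinner x y = cnj (cinner y x)"
    and cinner_add_left: "cinner (x + y) z = cinner x z + cinner y z"
    and cinner_scaleC_left: "cinner (c *\<^sub>C x) y = c * cinner x y"
    and inner_eq_Re_cinner: "x \<bullet> y = Re (cinner x y)"

lemma norm_scaleC: "norm (c *\<^sub>C (x::'h::complex_hilbert)) = cmod c * norm x"
proof -
  have r: "cinner y (d *\<^sub>C z) = cnj d * cinner y z" for d and y z :: 'h
    by (metis cinner_commute cinner_scaleC_left complex_cnj_mult)
  have "Im (cinner x x) = 0"
    using cinner_commute[of x x] by (simp add: complex_eq_iff)
  then have "(c *\<^sub>C x) \<bullet> (c *\<^sub>C x) = (cmod c)\<^sup>2 * (x \<bullet> x)"
    unfolding cmod_power2
    by (simp add: inner_eq_Re_cinner cinner_scaleC_left r algebra_simps)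
      (simp add: power2_eq_square)
  then show ?thesis
    by (simp add: norm_eq_sqrt_inner real_sqrt_mult)
qed

lemma bounded_linear_scaleC: "bounded_linear (\<lambda>x::'h::complex_hilbert. c *\<^sub>C x)"
proof (rule bounded_linear_intro)
  show "c *\<^sub>C (r *\<^sub>R x) = r *\<^sub>R (c *\<^sub>C x)" for r and x :: 'h
    by (simp add: scaleR_scaleC scaleC_scaleC mult.commute)
  show "norm (c *\<^sub>C x) \<le> norm x * cmod c" for x :: 'h
    by (simp add: norm_scaleC mult.commute)
qed (rule scaleC_add_right)

(* The library's blinfun type contains all bounded real-linear maps; the elements of B(H) are
   those satisfying clinear_op. *)
type_synonym 'h op = "'h \<Rightarrow>\<^sub>L 'h"

definition clinear_op :: "'h::complex_hilbert op \<Rightarrow> bool" where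
  "clinear_op x \<longleftrightarrow> (\<forall>c v. x (c *\<^sub>C v) = c *\<^sub>C x v)"

lift_definition op_scale :: "complex \<Rightarrow> 'h::complex_hilbert op \<Rightarrow> 'h op" is
  "\<lambda>c x v. c *\<^sub>C x v"
  by (rule bounded_linear_compose[OF bounded_linear_scaleC])

definition adj :: "'h::complex_hilbert op \<Rightarrow> 'h op" where
  "adj x = (THE y::'h op. \<forall>u v. cinner (x u) v = cinner u (y v))"

definition is_projection :: "'h::complex_hilbert op \<Rightarrow> bool" where
  "is_projection p \<longleftrightarrow> clinear_op p \<and> p o\<^sub>L p = p \<and> adj p = p"

definition positive_op :: "'h::complex_hilbert op \<Rightarrow> bool" where
  "positive_op x \<longleftrightarrow> clinear_op x \<and> (\<forall>v. cinner (x v) v \<in> \<real>\<^sub>\<ge>\<^sub>0)"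

definition op_le :: "'h::complex_hilbert op \<Rightarrow> 'h op \<Rightarrow> bool" where
  "op_le x y \<longleftrightarrow> positive_op (y - x)"


section \<open>Von Neumann algebras and traces\<close>

definition scalars :: "'h::complex_hilbert op set" where
  "scalars = range (\<lambda>c. op_scale c id_blinfun)"

definition commutant :: "'h::complex_hilbert op set \<Rightarrow> 'h op set" where
  "commutant S = {y. clinear_op y \<and> (\<forall>x\<in>S. x o\<^sub>L y = y o\<^sub>L x)}"

definition von_neumann_algebra :: "'h::complex_hilbert op set \<Rightarrow> bool" where
  "von_neumann_algebra M \<longleftrightarrow> (\<forall>x\<in>M. adj x \<in> M) \<and> commutant (commutant M) = M"

definition star_subalgebra :: "'h::complex_hilbert op set \<Rightarrow> bool" where
  "star_subalgebra R \<longleftrightarrow>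
     (\<forall>x\<in>R. clinear_op x) \<and> id_blinfun \<in> R \<and>
     (\<forall>x\<in>R. \<forall>y\<in>R. x + y \<in> R) \<and> (\<forall>c. \<forall>x\<in>R. op_scale c x \<in> R) \<and>
     (\<forall>x\<in>R. \<forall>y\<in>R. x o\<^sub>L y \<in> R) \<and> (\<forall>x\<in>R. adj x \<in> R)"

definition center :: "'h::complex_hilbert op set \<Rightarrow> 'h op set" where
  "center M = M \<inter> commutant M"

(* Finite dimension over the reals is the same as over the complex numbers. *)
definition finite_dim :: "'h::complex_hilbert op set \<Rightarrow> bool" where
  "finite_dim M \<longleftrightarrow> (\<exists>F. finite F \<and> M \<subseteq> span F)"

(* An inclusion of finite-dimensional algebras is connected (its Bratteli diagram is a connected
   graph) when the two centers meet in the scalars only (Goodman-de la Harpe-Jones). *)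
definition connected_inclusion :: "'h::complex_hilbert op set \<Rightarrow> 'h op set \<Rightarrow> bool" where
  "connected_inclusion N M \<longleftrightarrow> N \<subseteq> M \<and> center N \<inter> center M = scalars"

definition tracial_state :: "'h::complex_hilbert op set \<Rightarrow> ('h op \<Rightarrow> complex) \<Rightarrow> bool" where
  "tracial_state M \<tau> \<longleftrightarrow>
     (\<forall>x\<in>M. \<forall>y\<in>M. \<tau> (x + y) = \<tau> x + \<tau> y) \<and> (\<forall>c. \<forall>x\<in>M. \<tau> (op_scale c x) = c * \<tau> x) \<and>
     \<tau> id_blinfun = 1 \<and> (\<forall>x\<in>M. \<tau> (adj x o\<^sub>L x) \<in> \<real>\<^sub>\<ge>\<^sub>0) \<and>
     (\<forall>x\<in>M. \<forall>y\<in>M. \<tau> (x o\<^sub>L y) = \<tau> (y o\<^sub>L x))"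

definition faithful_on :: "'h::complex_hilbert op set \<Rightarrow> ('h op \<Rightarrow> complex) \<Rightarrow> bool" where
  "faithful_on M \<tau> \<longleftrightarrow> (\<forall>x\<in>M. \<tau> (adj x o\<^sub>L x) = 0 \<longrightarrow> x = 0)"

(* tau preserves suprema of upward directed bounded sets of positive elements. *)
definition normal_on :: "'h::complex_hilbert op set \<Rightarrow> ('h op \<Rightarrow> complex) \<Rightarrow> bool" where
  "normal_on M \<tau> \<longleftrightarrow>
     (\<forall>D x. D \<noteq> {} \<longrightarrow> D \<subseteq> {y\<in>M. positive_op y} \<longrightarrow>
        (\<forall>y\<in>D. \<forall>z\<in>D. \<exists>w\<in>D. op_le y w \<and> op_le z w) \<longrightarrow>
        x \<in> M \<longrightarrow> (\<forall>y\<in>D. op_le y x) \<longrightarrow>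
        (\<forall>z\<in>M. (\<forall>y\<in>D. op_le y z) \<longrightarrow> op_le x z) \<longrightarrow>
        Re (\<tau> x) = (SUP y\<in>D. Re (\<tau> y)))"

definition faithful_normal_tracial_state ::
    "'h::complex_hilbert op set \<Rightarrow> ('h op \<Rightarrow> complex) \<Rightarrow> bool" where
  "faithful_normal_tracial_state M \<tau> \<longleftrightarrow> tracial_state M \<tau> \<and> faithful_on M \<tau> \<and> normal_on M \<tau>"

definition factor :: "'h::complex_hilbert op set \<Rightarrow> bool" where
  "factor M \<longleftrightarrow> von_neumann_algebra M \<and> center M = scalars"

definition II1_factor :: "'h::complex_hilbert op set \<Rightarrow> bool" where
  "II1_factor M \<longleftrightarrow>
     factor M \<and> \<not> finite_dim M \<and> (\<exists>\<tau>. faithful_normal_tracial_state M \<tau>)"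


section \<open>Conditional expectations and commuting squares\<close>

(* E is the tau-preserving conditional expectation of M onto N. It always exists, and its values
   on M are unique, when N is a von Neumann subalgebra of M and tau is a faithful normal tracial
   state on M. The values of E outside M are irrelevant. *)
definition trace_cond_exp ::
    "('h::complex_hilbert op \<Rightarrow> complex) \<Rightarrow> 'h op set \<Rightarrow> 'h op set \<Rightarrow> ('h op \<Rightarrow> 'h op) \<Rightarrow> bool" where
  "trace_cond_exp \<tau> M N E \<longleftrightarrow>
     (\<forall>x\<in>M. E x \<in> N) \<and> (\<forall>x\<in>N. E x = x) \<and>
     (\<forall>x\<in>M. \<forall>y\<in>M. E (x + y) = E x + E y) \<and> (\<forall>c. \<forall>x\<in>M. E (op_scale c x) = op_scale c (E x)) \<and>
     (\<forall>x\<in>M. positive_op x \<longrightarrow> positive_op (E x)) \<and>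
     (\<forall>x\<in>M. \<forall>a\<in>N. \<forall>b\<in>N. E (a o\<^sub>L x o\<^sub>L b) = a o\<^sub>L E x o\<^sub>L b) \<and>
     (\<forall>x\<in>M. \<tau> (E x) = \<tau> x)"

(* The quadruple (N \<subset> P, Q \<subset> M). *)
definition commuting_square ::
    "('h::complex_hilbert op \<Rightarrow> complex) \<Rightarrow> 'h op set \<Rightarrow> 'h op set \<Rightarrow> 'h op set \<Rightarrow> 'h op set \<Rightarrow> bool"
  where
  "commuting_square \<tau> N P Q M \<longleftrightarrow>
     (\<exists>E\<^sub>P E\<^sub>Q E\<^sub>N. trace_cond_exp \<tau> M P E\<^sub>P \<and> trace_cond_exp \<tau> M Q E\<^sub>Q \<and> trace_cond_exp \<tau> M N E\<^sub>N \<and>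
        (\<forall>x\<in>M. E\<^sub>P (E\<^sub>Q x) = E\<^sub>N x \<and> E\<^sub>Q (E\<^sub>P x) = E\<^sub>N x))"

(* P and Q are closed under complex scalars, so the real span of the products is already the
   complex one. *)
definition nondegenerate_commuting_square ::
    "('h::complex_hilbert op \<Rightarrow> complex) \<Rightarrow> 'h op set \<Rightarrow> 'h op set \<Rightarrow> 'h op set \<Rightarrow> 'h op set \<Rightarrow> bool"
  where
  "nondegenerate_commuting_square \<tau> N P Q M \<longleftrightarrow>
     commuting_square \<tau> N P Q M \<and>
     strong_operator_topology closure_of span {x o\<^sub>L y | x y. x \<in> P \<and> y \<in> Q} = M \<and>
     strong_operator_topology closure_of span {y o\<^sub>L x | x y. x \<in> P \<and> y \<in> Q} = M"


section \<open>Commuting cubes and the iterated basic construction\<close>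

(* B j i stands for B_i^j (j = 1, 2; i = 0, 1), and C_i is the intersection of B 1 i and B 2 i. *)
definition commuting_cube ::
    "('h::complex_hilbert op \<Rightarrow> complex) \<Rightarrow> (nat \<Rightarrow> 'h op set) \<Rightarrow> (nat \<Rightarrow> nat \<Rightarrow> 'h op set) \<Rightarrow> bool"
  where
  "commuting_cube \<tau> A B \<longleftrightarrow>
     von_neumann_algebra (A 0) \<and> von_neumann_algebra (A 1) \<and> A 0 \<subseteq> A 1 \<and>
     faithful_normal_tracial_state (A 1) \<tau> \<and>
     (\<forall>j\<in>{1,2}. von_neumann_algebra (B j 0) \<and> von_neumann_algebra (B j 1) \<and>
        B j 0 \<subseteq> B j 1 \<and> B j 0 \<subseteq> A 0 \<and> B j 1 \<subseteq> A 1 \<and>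
        commuting_square \<tau> (B j 0) (A 0) (B j 1) (A 1))"

definition nondegenerate_commuting_cube ::
    "('h::complex_hilbert op \<Rightarrow> complex) \<Rightarrow> (nat \<Rightarrow> 'h op set) \<Rightarrow> (nat \<Rightarrow> nat \<Rightarrow> 'h op set) \<Rightarrow> bool"
  where
  "nondegenerate_commuting_cube \<tau> A B \<longleftrightarrow>
     commuting_cube \<tau> A B \<and>
     (\<forall>j\<in>{1,2}. nondegenerate_commuting_square \<tau> (B j 0) (A 0) (B j 1) (A 1)) \<and>
     nondegenerate_commuting_square \<tau> (B 1 0 \<inter> B 2 0) (A 0) (B 1 1 \<inter> B 2 1) (A 1)"

(* R = <M, e> is the Jones basic construction of the finite-dimensional inclusion N \<subset> M with
   Jones projection e. In finite dimensions L^2(M, tau) is M itself with the inner product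
   tau(z* y), and the Jones projection is the conditional expectation E of M onto N. Thus phi
   identifies R, as a *-algebra, with the algebra of operators on L^2(M) generated by the left
   multiplications by M and by E. *)
definition basic_construction ::
    "('h::complex_hilbert op \<Rightarrow> complex) \<Rightarrow> 'h op set \<Rightarrow> 'h op set \<Rightarrow> 'h op \<Rightarrow> 'h op set \<Rightarrow> bool"
  where
  "basic_construction \<tau> N M e R \<longleftrightarrow>
     is_projection e \<and> R = star_subalgebra hull (insert e M) \<and>
     (\<exists>E \<phi>. trace_cond_exp \<tau> M N E \<and>
        (\<forall>x\<in>R. \<forall>y\<in>M. \<phi> x y \<in> M) \<and>
        (\<forall>x\<in>R. \<forall>y\<in>M. \<forall>z\<in>M. \<phi> x (y + z) = \<phi> x y + \<phi> x z) \<and>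
        (\<forall>x\<in>R. \<forall>c. \<forall>y\<in>M. \<phi> x (op_scale c y) = op_scale c (\<phi> x y)) \<and>
        (\<forall>x\<in>R. \<forall>x'\<in>R. \<forall>y\<in>M. \<phi> (x + x') y = \<phi> x y + \<phi> x' y) \<and>
        (\<forall>c. \<forall>x\<in>R. \<forall>y\<in>M. \<phi> (op_scale c x) y = op_scale c (\<phi> x y)) \<and>
        (\<forall>x\<in>R. \<forall>x'\<in>R. \<forall>y\<in>M. \<phi> (x o\<^sub>L x') y = \<phi> x (\<phi> x' y)) \<and>
        (\<forall>x\<in>R. \<forall>y\<in>M. \<forall>z\<in>M. \<tau> (adj z o\<^sub>L \<phi> x y) = \<tau> (adj (\<phi> (adj x) z) o\<^sub>L y)) \<and>
        (\<forall>x\<in>R. (\<forall>y\<in>M. \<phi> x y = 0) \<longrightarrow> x = 0) \<and>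
        (\<forall>a\<in>M. \<forall>y\<in>M. \<phi> a y = a o\<^sub>L y) \<and>
        (\<forall>y\<in>M. \<phi> e y = E y))"

(* The trace tau on R = <M, e> extends the trace of M with the Markov property of modulus beta. *)
definition markov_extension ::
    "real \<Rightarrow> ('h::complex_hilbert op \<Rightarrow> complex) \<Rightarrow> 'h op set \<Rightarrow> 'h op \<Rightarrow> 'h op set \<Rightarrow> bool" where
  "markov_extension \<beta> \<tau> M e R \<longleftrightarrow>
     faithful_normal_tracial_state R \<tau> \<and> (\<forall>x\<in>M. of_real \<beta> * \<tau> (x o\<^sub>L e) = \<tau> x)"

(* The whole tower lives in B(K) for one Hilbert space K, and tau is its trace. The Markov
   condition at k = 1 says that tau restricted to A_1 is the Markov trace of A_0 \<subset> A_1; at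
   k > 1 it fixes the trace on A_(k+1). The elementary inclusions are the twelve edges of the
   cube. *)
definition iterated_basic_construction ::
    "('h::complex_hilbert op \<Rightarrow> complex) \<Rightarrow> (nat \<Rightarrow> 'h op set) \<Rightarrow> (nat \<Rightarrow> nat \<Rightarrow> 'h op set) \<Rightarrow>
     (nat \<Rightarrow> 'h op set) \<Rightarrow> (nat \<Rightarrow> 'h op) \<Rightarrow> bool" where
  "iterated_basic_construction \<tau> A B C e \<longleftrightarrow>
     nondegenerate_commuting_cube \<tau> A B \<and> finite_dim (A 1) \<and>
     (\<forall>i\<in>{0,1}. C i = B 1 i \<inter> B 2 i) \<and>
     connected_inclusion (A 0) (A 1) \<and> connected_inclusion (C 0) (C 1) \<and>
     (\<forall>j\<in>{1,2}. connected_inclusion (B j 0) (B j 1) \<and>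
        (\<forall>i\<in>{0,1}. connected_inclusion (C i) (B j i) \<and> connected_inclusion (B j i) (A i))) \<and>
     (\<exists>\<beta>>0. \<forall>k\<ge>1. basic_construction \<tau> (A (k - 1)) (A k) (e (k + 1)) (A (k + 1)) \<and>
        markov_extension \<beta> \<tau> (A k) (e (k + 1)) (A (k + 1))) \<and>
     (\<forall>k\<ge>1. (\<forall>j\<in>{1,2}. B j (k + 1) = star_subalgebra hull (insert (e (k + 1)) (B j k))) \<and>
        C (k + 1) = star_subalgebra hull (insert (e (k + 1)) (C k)))"

(* pi is a *-representation of the *-algebra A, with cyclic vector w implementing tau. *)
definition gns_representation ::
    "'k::complex_hilbert op set \<Rightarrow> ('k op \<Rightarrow> complex) \<Rightarrow> ('k op \<Rightarrow> 'h::complex_hilbert op) \<Rightarrow> 'h \<Rightarrow> bool"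
  where
  "gns_representation A \<tau> \<pi> w \<longleftrightarrow>
     (\<forall>x\<in>A. clinear_op (\<pi> x)) \<and> \<pi> id_blinfun = id_blinfun \<and>
     (\<forall>x\<in>A. \<forall>y\<in>A. \<pi> (x + y) = \<pi> x + \<pi> y) \<and> (\<forall>c. \<forall>x\<in>A. \<pi> (op_scale c x) = op_scale c (\<pi> x)) \<and>
     (\<forall>x\<in>A. \<forall>y\<in>A. \<pi> (x o\<^sub>L y) = \<pi> x o\<^sub>L \<pi> y) \<and> (\<forall>x\<in>A. \<pi> (adj x) = adj (\<pi> x)) \<and>
     (\<forall>x\<in>A. cinner (\<pi> x w) w = \<tau> x) \<and> closure {\<pi> x w | x. x \<in> A} = UNIV"

definition vector_state :: "'h::complex_hilbert \<Rightarrow> 'h op \<Rightarrow> complex" where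
  "vector_state w x = cinner (x w) w"


section \<open>The Sano-Watatani angle\<close>

definition proj_onto :: "'h::complex_hilbert set \<Rightarrow> 'h op" where
  "proj_onto V = (THE p. is_projection p \<and> range (blinfun_apply p) = V)"

definition ortho_compl :: "'h::complex_hilbert set \<Rightarrow> 'h set" where
  "ortho_compl V = {u. \<forall>v\<in>V. cinner u v = 0}"

definition proj_compl :: "'h::complex_hilbert op \<Rightarrow> 'h op" where
  "proj_compl p = id_blinfun - p"

definition proj_meet :: "'h::complex_hilbert op \<Rightarrow> 'h op \<Rightarrow> 'h op" where
  "proj_meet p q = proj_onto (range (blinfun_apply p) \<inter> range (blinfun_apply q))"

definition generic_part :: "'h::complex_hilbert op \<Rightarrow> 'h op \<Rightarrow> 'h set" where
  "generic_part p q = ortho_compl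
     {proj_meet p q a + proj_meet p (proj_compl q) b +
      proj_meet (proj_compl p) q c + proj_meet (proj_compl p) (proj_compl q) d | a b c d. True}"

(* The spectrum of the operator that T induces on the closed T-invariant subspace K. Operators on
   K correspond to the operators on the whole space that map K to K, read on K only. *)
definition spectrum_on :: "'h::complex_hilbert set \<Rightarrow> 'h op \<Rightarrow> complex set" where
  "spectrum_on K T = {l. \<not> (\<exists>S. clinear_op S \<and> S ` K \<subseteq> K \<and>
     (\<forall>v\<in>K. S (T v - l *\<^sub>C v) = v \<and> T (S v) - l *\<^sub>C S v = v))}"

(* The cosine power series, convergent in operator norm. *)
definition op_cos :: "'h::complex_hilbert op \<Rightarrow> 'h op" where
  "op_cos T = (\<Sum>n. cos_coeff n *\<^sub>R (((o\<^sub>L) T ^^ n) id_blinfun))"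

(* Theta(p, q) as an operator on the whole space that vanishes on the orthogonal complement of
   p H_0; on p H_0 the cosine series of T is then the cosine of the restriction of T. *)
definition angle_op :: "'h::complex_hilbert op \<Rightarrow> 'h op \<Rightarrow> 'h op" where
  "angle_op p q = (let K = p ` generic_part p q in
     THE T. positive_op T \<and> T ` K \<subseteq> K \<and> (\<forall>v\<in>ortho_compl K. T v = 0) \<and>
       spectrum_on K T \<subseteq> complex_of_real ` {0..pi/2} \<and>
       (\<forall>v\<in>K. op_cos T (op_cos T v) = p (q (p v))))"

definition Ang :: "'h::complex_hilbert op \<Rightarrow> 'h op \<Rightarrow> complex set" where
  "Ang p q = (if p o\<^sub>L q \<noteq> q o\<^sub>L p then spectrum_on (p ` generic_part p q) (angle_op p q)
     else {complex_of_real (pi/2)})"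

(* For an algebra M acting with the cyclic trace vector w, the ambient Hilbert space is L^2(M), and
   L^2(P) is the closure of P w. *)
definition L2_proj :: "'h::complex_hilbert \<Rightarrow> 'h op set \<Rightarrow> 'h op" where
  "L2_proj w P = proj_onto (closure ((\<lambda>x. blinfun_apply x w) ` P))"

definition Ang_alg :: "'h::complex_hilbert \<Rightarrow> 'h op set \<Rightarrow> 'h op set \<Rightarrow> complex set" where
  "Ang_alg w P Q = Ang (L2_proj w P) (L2_proj w Q)"

end

theory Submission
  imports Defs
begin

text \<open>
  Let \<open>p\<close>, \<open>q\<close>, \<open>n\<close> be the projections of \<open>L\<^sup>2(M)\<close> onto \<open>L\<^sup>2(P)\<close>, \<open>L\<^sup>2(Q)\<close>, \<open>L\<^sup>2(N)\<close>.
  On \<open>A\<^sub>0\<close>, embedded by \<open>a \<mapsto> \<pi>(a)\<Omega>\<close>, they act as the three conditional expectations, so the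
  operator \<open>S = qpq - n\<close> extends \<open>S\<^sub>0\<close>. Everything rests on the fact that \<open>S\<close> is determined by \<open>S\<^sub>0\<close>:
  it satisfies \<open>S\<^sup>2 = \<alpha>S\<close>, and this quadratic relation leaves room for a single angle.

  For this determination two facts about the tower are needed
  (\<open>tower_of_commuting_squares\<close>). First, \<open>A\<^sub>k\<close> is the linear span of \<open>C\<^sub>k A\<^sub>0\<close>; this is
  nondegeneracy of the slice, carried up the tower by \<open>A\<^sub>k\<^sub>+\<^sub>1 = span A\<^sub>k e A\<^sub>k\<close> and by the fact that
  \<open>e\<close> commutes with \<open>A\<^sub>k\<^sub>-\<^sub>1\<close>. Second, the expectation of \<open>A\<^sub>k\<close> onto \<open>A\<^sub>0\<close> maps \<open>B\<^sup>j\<^sub>k\<close> into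
  \<open>B\<^sup>j\<^sub>0\<close> and \<open>C\<^sub>k\<close> into \<open>C\<^sub>0\<close>; this is the commuting square condition, carried up the tower by the
  Markov property \<open>\<tau>(x e y) = \<beta>\<^sup>-\<^sup>1 \<tau>(x y)\<close>. The second fact gives \<open>p \<pi>(a)\<Omega> = \<pi>(E a)\<Omega>\<close> for
  \<open>a \<in> A\<^sub>0\<close> and similarly for \<open>q\<close> and \<open>n\<close> (\<open>L2_proj_gns_cond_exp\<close>). The projections \<open>p\<close>, \<open>q\<close>,
  \<open>n\<close> commute with \<open>\<pi>(c)\<close> for \<open>c \<in> C\<^sub>k\<close> because \<open>C\<^sub>k\<close> is contained in both \<open>B\<^sup>j\<^sub>k\<close>. Hence
  \<open>S \<pi>(ca)\<Omega> = \<pi>(c) \<pi>(S\<^sub>0 a)\<Omega>\<close>, and \<open>S\<^sup>2 = \<alpha>S\<close> holds on a dense subspace.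

  Let \<open>\<eta>\<close> be the image of a nonzero value of \<open>S\<^sub>0\<close>. Then
  \<open>\<parallel>p\<eta>\<parallel>\<^sup>2 = \<alpha>\<parallel>\<eta>\<parallel>\<^sup>2\<close>. For \<open>\<alpha> \<ge> 1\<close> this forces \<open>\<eta>\<close> into the ranges of \<open>p\<close> and \<open>q\<close>, that is, it comes
  from \<open>B\<^sup>1\<^sub>0 \<inter> B\<^sup>2\<^sub>0 = C\<^sub>0\<close>, where \<open>S\<^sub>0\<close> vanishes, whereas \<open>S\<eta> = \<alpha>\<eta> \<noteq> 0\<close>; for \<open>\<alpha> = 0\<close>
  it contradicts self-adjointness of \<open>S\<close>.
  So \<open>0 < \<alpha> < 1\<close> (\<open>compressed_projection_eigenvalue_bounds\<close>).

  If \<open>p\<close> and \<open>q\<close> commuted, \<open>S\<close> would be a projection and \<open>\<alpha>\<close> would be \<open>1\<close>; so they do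
  not commute, and the quadruple is not a commuting square. On \<open>p H\<^sub>0\<close> the relation \<open>S\<^sup>2 = \<alpha>S\<close> turns into
  \<open>pqp = \<alpha>\<close> (\<open>Ang_singleton\<close>). The angle operator is then the scalar \<open>arccos \<surd>\<alpha>\<close>, since a positive
  operator \<open>T\<close> with spectrum in \<open>[0, \<pi>/2]\<close> and \<open>cos\<^sup>2 T = \<alpha>\<close> has only this number as a possible
  approximate eigenvalue (\<open>op_cos_squared_scalar_unique\<close>).
\<close>

section \<open>Orthogonality and adjoints in a Hilbert space\<close>

lemma scaleC_one [simp]: "1 *\<^sub>C (x::'h::complex_hilbert) = x"
  using scaleR_scaleC[of 1 x] by simp

lemma scaleC_diff_right: "c *\<^sub>C (x - y) = c *\<^sub>C x - c *\<^sub>C (y::'h::complex_hilbert)"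
  using bounded_linear_scaleC by (rule linear_diff[OF bounded_linear.linear])

lemma cinner_add_right: "cinner x (y + z) = cinner x y + cinner x (z::'h::complex_hilbert)"
  by (metis cinner_add_left cinner_commute complex_cnj_add)

lemma cinner_scaleC_right: "cinner x (c *\<^sub>C y) = cnj c * cinner x (y::'h::complex_hilbert)"
  by (metis cinner_commute cinner_scaleC_left complex_cnj_mult)

lemma cinner_scaleR_left: "cinner (r *\<^sub>R x) y = of_real r * cinner x (y::'h::complex_hilbert)"
  by (simp add: scaleR_scaleC cinner_scaleC_left)

lemma cinner_scaleR_right: "cinner x (r *\<^sub>R y) = of_real r * cinner x (y::'h::complex_hilbert)"
  by (simp add: scaleR_scaleC cinner_scaleC_right)

lemma cinner_zero [simp]:
  "cinner 0 (x::'h::complex_hilbert) = 0" "cinner x (0::'h::complex_hilbert) = 0"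
  using cinner_scaleR_left[of 0 x x] cinner_scaleR_right[of x 0 x] by simp_all

lemma cinner_minus_left: "cinner (- x) y = - cinner x (y::'h::complex_hilbert)"
  using cinner_scaleR_left[of "-1" x y] by simp

lemma cinner_minus_right: "cinner x (- y) = - cinner x (y::'h::complex_hilbert)"
  using cinner_scaleR_right[of x "-1" y] by simp

lemma cinner_diff_left: "cinner (x - y) z = cinner x z - cinner y (z::'h::complex_hilbert)"
  using cinner_add_left[of x "-y" z] by (simp add: cinner_minus_left)

lemma cinner_diff_right: "cinner x (y - z) = cinner x y - cinner x (z::'h::complex_hilbert)"
  using cinner_add_right[of x y "-z"] by (simp add: cinner_minus_right)

lemma cinner_eq_Complex: "cinner x y = Complex (x \<bullet> y) (x \<bullet> (\<i> *\<^sub>C (y::'h::complex_hilbert)))"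
  by (simp add: complex_eq_iff inner_eq_Re_cinner cinner_scaleC_right)

lemma cinner_self: "cinner x x = of_real ((norm (x::'h::complex_hilbert))\<^sup>2)"
proof -
  have "Im (cinner x x) = 0"
    using cinner_commute[of x x] by (simp add: complex_eq_iff)
  then show ?thesis
    by (simp add: complex_eq_iff inner_eq_Re_cinner[symmetric] power2_norm_eq_inner)
qed

lemma cinner_self_eq_0 [simp]: "cinner x x = 0 \<longleftrightarrow> (x::'h::complex_hilbert) = 0"
  by (simp add: cinner_self)

lemma cinner_eq_0_commute: "cinner x y = 0 \<longleftrightarrow> cinner y (x::'h::complex_hilbert) = 0"
  by (metis cinner_commute complex_cnj_zero)

lemma cinner_ext: "(\<And>w. cinner w u = cinner w v) \<Longrightarrow> u = (v::'h::complex_hilbert)"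
  by (metis cinner_diff_right cinner_self_eq_0 eq_iff_diff_eq_0)

definition closed_csubspace :: "'h::complex_hilbert set \<Rightarrow> bool" where
  "closed_csubspace V \<longleftrightarrow> subspace V \<and> closed V \<and> (\<forall>c. \<forall>v\<in>V. c *\<^sub>C v \<in> V)"

text \<open>
  The imaginary part of \<open>cinner u v\<close> is \<open>u \<bullet> (\<i> v)\<close>, so for a complex subspace real and complex
  orthogonality agree. This lets the geometry below be done with the real inner product.
\<close>

lemma orthogonal_complex_from_real:
  assumes "closed_csubspace V" "\<And>v. v \<in> V \<Longrightarrow> u \<bullet> v = 0" "v \<in> V"
  shows "cinner u v = 0"
  using assms by (auto simp: cinner_eq_Complex closed_csubspace_def complex_eq_iff)

text \<open>
  Nearest points: by the parallelogram law the points of \<open>V\<close> whose distance to \<open>x\<close> is almost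
  minimal form sets of small diameter, so completeness provides a point of minimal distance.
\<close>

lemma nearest_point_exists:
  fixes V :: "'a::{real_inner,banach} set"
  assumes V: "subspace V" "closed V"
  shows "\<exists>z\<in>V. \<forall>v\<in>V. norm (x - z) \<le> norm (x - v)"
proof -
  define d where "d = (INF v\<in>V. (norm (x - v))\<^sup>2)"
  have ne: "V \<noteq> {}"
    using V subspace_0 by auto
  have bdd: "bdd_below ((\<lambda>v. (norm (x - v))\<^sup>2) ` V)"
    by (rule bdd_belowI[of _ 0]) auto
  have dle: "d \<le> (norm (x - v))\<^sup>2" if "v \<in> V" for v
    unfolding d_def by (rule cINF_lower[OF bdd that])
  define S where "S n = {v\<in>V. (norm (x - v))\<^sup>2 \<le> d + 1 / Suc n}" for n :: nat
  have near: "dist u v \<le> sqrt (4 / Suc n)" if "u \<in> S n" "v \<in> S n" for u v n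
  proof -
    have mid: "(1/2) *\<^sub>R (u + v) \<in> V"
      using that V by (auto simp: S_def intro!: subspace_scale subspace_add)
    have "4 * (norm (x - (1/2) *\<^sub>R (u + v)))\<^sup>2 + (norm (u - v))\<^sup>2
        = 2 * (norm (x - u))\<^sup>2 + 2 * (norm (x - v))\<^sup>2"
      by (simp add: power2_norm_eq_inner algebra_simps inner_commute)
    then have "(norm (u - v))\<^sup>2 \<le> 4 / Suc n"
      using dle[OF mid] that by (simp add: S_def)
    then show ?thesis
      by (simp add: dist_norm real_le_rsqrt)
  qed
  have "\<exists>z. \<forall>n. z \<in> S n"
  proof (rule decreasing_closed_nest[of S])
    show "closed (S n)" for n
    proof -
      have "S n = V \<inter> {v. (norm (x - v))\<^sup>2 \<le> d + 1 / Suc n}"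
        by (auto simp: S_def)
      then show ?thesis
        using V by (auto intro!: closed_Int closed_Collect_le continuous_intros)
    qed
    show "S n \<noteq> {}" for n
    proof -
      have "d < d + 1 / Suc n"
        by simp
      then obtain v where "v \<in> V" "(norm (x - v))\<^sup>2 < d + 1 / Suc n"
        using cINF_less_iff[OF ne bdd, folded d_def] by blast
      then show ?thesis
        by (auto simp: S_def)
    qed
    show "S n \<subseteq> S m" if "m \<le> n" for m n
    proof -
      have "1 / real (Suc n) \<le> 1 / Suc m"
        using that by (simp add: frac_le)
      then show ?thesis
        by (auto simp: S_def)
    qed
    show "\<exists>n. \<forall>u\<in>S n. \<forall>v\<in>S n. dist u v < e" if "e > 0" for e
    proof -
      have "0 < e\<^sup>2 / 4"
        using that by simp
      then obtain n where n: "inverse (real (Suc n)) < e\<^sup>2 / 4"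
        using reals_Archimedean by blast
      then have "sqrt (4 / Suc n) < e"
        using that by (intro real_less_lsqrt) (auto simp: divide_simps mult.commute)
      then show ?thesis
        using near by (meson le_less_trans)
    qed
  qed blast
  then obtain z where z: "\<And>n. z \<in> S n"
    by blast
  have "(norm (x - z))\<^sup>2 \<le> d + 1 / Suc n" for n
    using z[of n] by (simp add: S_def)
  then have "(norm (x - z))\<^sup>2 \<le> d"
    by (meson field_le_epsilon less_imp_le add_left_mono nat_approx_posE order_trans)
  then have "norm (x - z) \<le> norm (x - v)" if "v \<in> V" for v
    using dle[OF that] by (meson norm_ge_zero order_trans power2_le_imp_le)
  then show ?thesis
    using z[of 0] by (auto simp: S_def)
qed

lemma orthogonal_projection_exists:
  fixes V :: "'a::{real_inner,banach} set"
  assumes V: "subspace V" "closed V"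
  shows "\<exists>z\<in>V. \<forall>v\<in>V. (x - z) \<bullet> v = 0"
proof -
  obtain z where z: "z \<in> V" "\<And>v. v \<in> V \<Longrightarrow> norm (x - z) \<le> norm (x - v)"
    using nearest_point_exists[OF V] by blast
  have "(x - z) \<bullet> v = 0" if v: "v \<in> V" for v
  proof (cases "v = 0")
    case False
    define t where "t = ((x - z) \<bullet> v) / (v \<bullet> v)"
    have "z + t *\<^sub>R v \<in> V"
      using z v V by (simp add: subspace_add subspace_scale)
    then have "(norm (x - z))\<^sup>2 \<le> (norm (x - (z + t *\<^sub>R v)))\<^sup>2"
      using z(2) by (simp add: power_mono)
    also have "\<dots> = (norm (x - z))\<^sup>2 - 2 * t * ((x - z) \<bullet> v) + t * t * (v \<bullet> v)"
      by (simp add: power2_norm_eq_inner algebra_simps inner_commute)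
    also have "\<dots> = (norm (x - z))\<^sup>2 - ((x - z) \<bullet> v)\<^sup>2 / (v \<bullet> v)"
      using False by (simp add: t_def power2_eq_square field_simps)
    finally have "((x - z) \<bullet> v)\<^sup>2 / (v \<bullet> v) \<le> 0"
      by simp
    moreover have "v \<bullet> v > 0"
      using False by simp
    ultimately show ?thesis
      by (simp add: divide_le_0_iff)
  qed simp
  with z show ?thesis
    by blast
qed

text \<open>
  A vector orthogonal to the kernel of \<open>f\<close> represents \<open>f\<close> up to a scalar.
\<close>

lemma Riesz_representation:
  fixes f :: "'a::{real_inner,banach} \<Rightarrow> real"
  assumes f: "bounded_linear f"
  shows "\<exists>w. \<forall>u. f u = u \<bullet> w"
proof (cases "\<forall>u. f u = 0")
  case True
  then show ?thesis
    by (intro exI[of _ 0]) simp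
next
  case False
  then obtain u0 where u0: "f u0 \<noteq> 0"
    by blast
  interpret bounded_linear f
    by fact
  have "subspace {u. f u = 0}"
    by (auto simp: subspace_def add scaleR zero)
  moreover have "closed {u. f u = 0}"
    by (intro closed_Collect_eq continuous_intros linear_continuous_on f)
  ultimately obtain z where z: "f z = 0" "\<And>v. f v = 0 \<Longrightarrow> (u0 - z) \<bullet> v = 0"
    using orthogonal_projection_exists[of "{u. f u = 0}" u0] by auto
  define n where "n = u0 - z"
  have fn: "f n \<noteq> 0"
    using u0 z by (simp add: n_def diff)
  then have nn: "n \<bullet> n \<noteq> 0"
    by (auto simp: zero)
  have "f u = u \<bullet> ((f n / (n \<bullet> n)) *\<^sub>R n)" for u
  proof -
    have "f (u - (f u / f n) *\<^sub>R n) = 0"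
      using fn by (simp add: diff scaleR)
    then have "n \<bullet> (u - (f u / f n) *\<^sub>R n) = 0"
      using z(2) by (simp add: n_def)
    then show ?thesis
      using fn nn by (simp add: algebra_simps inner_commute field_simps)
  qed
  then show ?thesis
    by blast
qed

lemma clinear_opD: "clinear_op x \<Longrightarrow> x (c *\<^sub>C v) = c *\<^sub>C x v"
  by (simp add: clinear_op_def)

text \<open>
  The adjoint is introduced by a definite description, so each use of it needs an operator that
  satisfies its characteristic equation; the Riesz theorem supplies one.
\<close>

lemma adjoint_exists:
  assumes x: "clinear_op (x :: 'h::complex_hilbert op)"
  shows "\<exists>y. \<forall>u v. cinner (x u) v = cinner u (blinfun_apply y v)"
proof -
  have "\<exists>w. \<forall>u. x u \<bullet> v = u \<bullet> w" for v
    by (rule Riesz_representation)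
       (intro bounded_linear_compose[OF bounded_linear_inner_left] blinfun.bounded_linear_right)
  then obtain g where g: "\<And>u v. x u \<bullet> v = u \<bullet> g v"
    by metis
  have eqI: "a = b" if "\<And>u. u \<bullet> a = u \<bullet> b" for a b :: 'h
    using that vector_eq_ldot[of a b] by blast
  have "bounded_linear g"
  proof (rule bounded_linear_intro)
    show "g (v + w) = g v + g w" for v w
      by (rule eqI) (simp add: g[symmetric] inner_add_right)
    show "g (r *\<^sub>R v) = r *\<^sub>R g v" for r v
      by (rule eqI) (simp add: g[symmetric])
    show "norm (g v) \<le> norm v * norm x" for v
    proof (cases "g v = 0")
      case False
      have "norm (g v) * norm (g v) = x (g v) \<bullet> v"
        by (simp add: g power2_norm_eq_inner[symmetric] power2_eq_square[symmetric])
      also have "\<dots> \<le> norm x * norm (g v) * norm v"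
        by (meson Cauchy_Schwarz_ineq2 abs_ge_self mult_right_mono norm_blinfun norm_ge_zero order_trans)
      finally show ?thesis
        using False by (simp add: mult.assoc mult.left_commute mult.commute)
    qed simp
  qed
  then have ap: "blinfun_apply (Blinfun g) = g"
    by (rule bounded_linear_Blinfun_apply)
  \<comment> \<open>\<open>Im (cinner a b)\<close> is \<open>- (\<i> a) \<bullet> b\<close>, and \<open>x\<close> commutes with \<open>\<i>\<close>.\<close>
  have "cinner (x u) v = cinner u (g v)" for u v
    using g[of u v] g[of "\<i> *\<^sub>C u" v] clinear_opD[OF x, of \<i> u]
    by (simp add: complex_eq_iff inner_eq_Re_cinner cinner_scaleC_left)
  then show ?thesis
    by (intro exI[of _ "Blinfun g"]) (simp add: ap)
qed

lemma adj_eqI: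
  assumes "\<And>u v. cinner (blinfun_apply x u) v = cinner u (blinfun_apply y v)"
  shows "adj x = y"
  unfolding adj_def
proof (rule the_equality)
  show "y' = y" if "\<forall>u v. cinner (x u) v = cinner u (blinfun_apply y' v)" for y'
    using that assms by (intro blinfun_eqI cinner_ext) metis
qed (use assms in blast)

lemma cinner_adj: "clinear_op x \<Longrightarrow> cinner (x u) v = cinner u (adj x v)"
  using adjoint_exists[of x] adj_eqI[of x] by metis

lemma cinner_adj': "clinear_op x \<Longrightarrow> cinner u (x v) = cinner (adj x u) v"
  by (metis cinner_adj cinner_commute)

lemma clinear_adj: "clinear_op x \<Longrightarrow> clinear_op (adj x)"
  unfolding clinear_op_def[of "adj x"]
  by (intro allI cinner_ext) (simp add: cinner_adj[symmetric] cinner_scaleC_right)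

lemma adj_adj: "clinear_op x \<Longrightarrow> adj (adj x) = x"
  by (rule adj_eqI) (simp add: cinner_adj')

lemma clinear_op_intros:
  "clinear_op id_blinfun" "clinear_op x \<Longrightarrow> clinear_op y \<Longrightarrow> clinear_op (x + y)"
  "clinear_op x \<Longrightarrow> clinear_op y \<Longrightarrow> clinear_op (x - y)"
  "clinear_op x \<Longrightarrow> clinear_op y \<Longrightarrow> clinear_op (x o\<^sub>L y)"
  "clinear_op x \<Longrightarrow> clinear_op (op_scale c x)"
  "clinear_op x \<Longrightarrow> clinear_op (r *\<^sub>R x)"
  by (auto simp: clinear_op_def blinfun.add_left blinfun.diff_left blinfun.scaleR_left
      op_scale.rep_eq scaleC_add_right scaleC_diff_right scaleC_scaleC scaleR_scaleC mult.commute)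

lemma adj_add: "clinear_op x \<Longrightarrow> clinear_op y \<Longrightarrow> adj (x + y) = adj x + adj y"
  by (rule adj_eqI) (simp add: blinfun.add_left cinner_add_left cinner_add_right cinner_adj)

lemma adj_compose: "clinear_op x \<Longrightarrow> clinear_op y \<Longrightarrow> adj (x o\<^sub>L y) = adj y o\<^sub>L adj x"
  by (rule adj_eqI) (simp add: cinner_adj)

lemma adj_scale: "clinear_op x \<Longrightarrow> adj (op_scale c x) = op_scale (cnj c) (adj x)"
  by (rule adj_eqI) (simp add: op_scale.rep_eq cinner_scaleC_left cinner_scaleC_right cinner_adj)

lemma op_scale_real: "op_scale (complex_of_real r) x = r *\<^sub>R x"
  by (rule blinfun_eqI) (simp add: op_scale.rep_eq blinfun.scaleR_left scaleR_scaleC)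

lemma op_scale_compose_left: "op_scale c x o\<^sub>L y = op_scale c (x o\<^sub>L y)"
  by (rule blinfun_eqI) (simp add: op_scale.rep_eq)

lemma op_scale_compose_right: "clinear_op x \<Longrightarrow> x o\<^sub>L op_scale c y = op_scale c (x o\<^sub>L y)"
  by (rule blinfun_eqI) (simp add: op_scale.rep_eq clinear_op_def)

lemma op_scale_add: "op_scale c (x + y) = op_scale c x + op_scale c y"
  by (rule blinfun_eqI) (simp add: op_scale.rep_eq blinfun.add_left scaleC_add_right)

lemma op_scale_scaleR: "op_scale c (r *\<^sub>R x) = r *\<^sub>R op_scale c x"
  by (rule blinfun_eqI)
     (simp add: op_scale.rep_eq blinfun.scaleR_left scaleR_scaleC scaleC_scaleC mult.commute)

lemma linear_op_scale: "linear (op_scale c)"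
  by (intro linearI op_scale_add op_scale_scaleR)


section \<open>Projections onto closed subspaces\<close>

lemma projection_apply:
  assumes "is_projection p"
  shows "p (p v) = p v" "cinner (p u) v = cinner u (p v)"
  using assms cinner_adj[of p] unfolding is_projection_def
  by (metis blinfun_apply_blinfun_compose)+

lemma projection_range:
  assumes "is_projection p"
  shows "v \<in> range p \<longleftrightarrow> p v = v"
  using projection_apply(1)[OF assms] by (metis rangeE rangeI)

lemma projection_closed_range:
  assumes "is_projection p"
  shows "closed_csubspace (range p)"
proof -
  have R: "range p = {v. p v = v}"
    using projection_range[OF assms] by blast
  have "closed {v. p v = v}"
    by (intro closed_Collect_eq continuous_intros linear_continuous_on
        blinfun.bounded_linear_right)
  moreover have "clinear_op p"
    using assms by (simp add: is_projection_def)
  ultimately show ?thesis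
    unfolding R closed_csubspace_def subspace_def
    by (simp add: blinfun.add_right blinfun.scaleR_right clinear_opD)
qed

text \<open>
  The standard way to compute a projection: exhibit the value and check that the difference is
  orthogonal to the range.
\<close>

lemma projection_eq:
  assumes p: "is_projection p" and z: "z \<in> range p" "\<And>v. v \<in> range p \<Longrightarrow> cinner (u - z) v = 0"
  shows "p u = z"
proof -
  have "cinner (p u - z) (p u - z) = cinner (u - z) (p (p u - z))"
    using projection_apply[OF p] z(1) projection_range[OF p]
    by (metis (no_types, opaque_lifting) blinfun.diff_right)
  also have "\<dots> = 0"
    using z(2) by blast
  finally show ?thesis
    by simp
qed

lemma projection_orthogonal:
  assumes p: "is_projection p" and "v \<in> range p"
  shows "cinner (u - p u) v = 0"
proof -
  have "cinner (p u) v = cinner u v"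
    using projection_apply(2)[OF p] assms projection_range[OF p] by metis
  then show ?thesis
    by (simp add: cinner_diff_left)
qed

lemma subprojection_absorbs:
  assumes "is_projection p" "is_projection n" "\<And>v. p (n v) = n v"
  shows "n (p v) = n v"
  by (rule cinner_ext) (metis projection_apply(2) assms)

text \<open>
  The map to the nearest point is single-valued because the difference of two candidates lies in \<open>V\<close> and is
  orthogonal to \<open>V\<close>; uniqueness also gives its linearity.
\<close>

lemma projection_exists:
  assumes V: "closed_csubspace V"
  shows "\<exists>p. is_projection p \<and> range (blinfun_apply p) = V"
proof -
  have sub: "subspace V" and scV: "\<And>c v. v \<in> V \<Longrightarrow> c *\<^sub>C v \<in> V"
    using V by (auto simp: closed_csubspace_def)
  have "\<exists>z. z \<in> V \<and> (\<forall>v\<in>V. cinner (x - z) v = 0)" for x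
    using orthogonal_projection_exists[of V x] orthogonal_complex_from_real[OF V] V
    by (metis closed_csubspace_def)
  then obtain f where f: "\<And>x. f x \<in> V" "\<And>x v. v \<in> V \<Longrightarrow> cinner (x - f x) v = 0"
    by metis
  have uniq: "f x = z" if "z \<in> V" "\<And>v. v \<in> V \<Longrightarrow> cinner (x - z) v = 0" for x z
  proof -
    have m: "f x - z \<in> V"
      using f(1) that(1) sub by (simp add: subspace_diff)
    have "cinner (f x - z) (f x - z) = cinner (x - z) (f x - z) - cinner (x - f x) (f x - z)"
      by (simp add: cinner_diff_left)
    then show ?thesis
      using f(2)[OF m] that(2)[OF m] by simp
  qed
  have sc: "f (c *\<^sub>C x) = c *\<^sub>C f x" for c x
  proof (rule uniq)
    show "cinner (c *\<^sub>C x - c *\<^sub>C f x) v = 0" if "v \<in> V" for v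
      using f(2)[OF that, of x] by (simp add: cinner_diff_left cinner_scaleC_left)
  qed (use scV f in auto)
  have "bounded_linear f"
  proof (rule bounded_linear_intro)
    show "f (x + y) = f x + f y" for x y
    proof (rule uniq)
      show "cinner (x + y - (f x + f y)) v = 0" if "v \<in> V" for v
        using f(2)[OF that, of x] f(2)[OF that, of y] by (simp add: cinner_diff_left cinner_add_left)
    qed (use sub f in \<open>auto simp: subspace_add\<close>)
    show "f (r *\<^sub>R x) = r *\<^sub>R f x" for r x
      by (simp add: scaleR_scaleC sc)
    show "norm (f x) \<le> norm x * 1" for x
    proof -
      have "(x - f x) \<bullet> f x = 0"
        using f(2)[OF f(1), of x x] by (simp add: inner_eq_Re_cinner)
      then have "(norm x)\<^sup>2 = (norm (f x))\<^sup>2 + (norm (x - f x))\<^sup>2"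
        by (simp add: power2_norm_eq_inner algebra_simps inner_commute)
      then have "(norm (f x))\<^sup>2 \<le> (norm x)\<^sup>2"
        by simp
      then show ?thesis
        using power2_le_imp_le by force
    qed
  qed
  then have ap: "blinfun_apply (Blinfun f) = f"
    by (rule bounded_linear_Blinfun_apply)
  have fid: "f v = v" if "v \<in> V" for v
    by (rule uniq) (use that in auto)
  have sym: "cinner (f u) v = cinner u (f v)" for u v
  proof -
    have "cinner (f u) v = cinner (f u) (f v)"
      using f(2)[OF f(1), of v u] cinner_eq_0_commute by (metis cinner_diff_right eq_iff_diff_eq_0)
    also have "\<dots> = cinner u (f v)"
      using f(2)[OF f(1), of u v] by (simp add: cinner_diff_left)
    finally show ?thesis .
  qed
  have "adj (Blinfun f) = Blinfun f"
    by (rule adj_eqI) (simp add: ap sym)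
  moreover have "Blinfun f o\<^sub>L Blinfun f = Blinfun f"
    by (rule blinfun_eqI) (simp add: ap fid f(1))
  moreover have "range f = V"
    using f(1) fid by (metis image_subsetI rangeI subsetI subset_antisym)
  ultimately show ?thesis
    by (intro exI[of _ "Blinfun f"]) (simp add: is_projection_def clinear_op_def ap sc)
qed

lemma proj_onto:
  assumes V: "closed_csubspace V"
  shows "is_projection (proj_onto V)" "range (proj_onto V) = V"
proof -
  obtain p where p: "is_projection p" "range (blinfun_apply p) = V"
    using projection_exists[OF V] by blast
  have "p' = p" if "is_projection p' \<and> range (blinfun_apply p') = V" for p'
  proof (rule blinfun_eqI)
    show "p' x = p x" for x
      by (rule projection_eq) (use that p projection_orthogonal in auto)
  qed
  then have "is_projection (proj_onto V) \<and> range (proj_onto V) = V"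
    unfolding proj_onto_def
    using theI[of "\<lambda>p. is_projection p \<and> range (blinfun_apply p) = V" p] p by blast
  then show "is_projection (proj_onto V)" "range (proj_onto V) = V"
    by auto
qed

lemma closed_csubspace_Int:
  "closed_csubspace V \<Longrightarrow> closed_csubspace W \<Longrightarrow> closed_csubspace (V \<inter> W)"
  by (auto simp: closed_csubspace_def subspace_inter)

lemma closed_csubspace_ortho_compl: "closed_csubspace (ortho_compl V)"
proof -
  have "ortho_compl V = (\<Inter>v\<in>V. {u. u \<bullet> v = 0 \<and> u \<bullet> (\<i> *\<^sub>C v) = 0})"
    by (auto simp: ortho_compl_def cinner_eq_Complex complex_eq_iff)
  moreover have "closed \<dots>"
    by (intro closed_INT ballI closed_Collect_conj closed_Collect_eq continuous_intros)
  ultimately have "closed (ortho_compl V)"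
    by simp
  then show ?thesis
    by (auto simp: closed_csubspace_def subspace_def ortho_compl_def cinner_add_left
        cinner_scaleC_left cinner_scaleR_left)
qed

lemma closed_csubspace_closure:
  assumes "subspace V" "\<And>c v. v \<in> V \<Longrightarrow> c *\<^sub>C v \<in> V"
  shows "closed_csubspace (closure V)"
  unfolding closed_csubspace_def
proof (intro conjI allI ballI)
  show "subspace (closure V)"
    unfolding subspace_def
  proof (intro conjI ballI allI)
    show "0 \<in> closure V"
      using assms(1) closure_subset subspace_0 by blast
    show "x + y \<in> closure V" if xy: "x \<in> closure V" "y \<in> closure V" for x y
    proof -
      obtain f g where "\<forall>n. f n \<in> V" "f \<longlonglongrightarrow> x" "\<forall>n. g n \<in> V" "g \<longlonglongrightarrow> y"
        using xy unfolding closure_sequential by metis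
      then show ?thesis
        unfolding closure_sequential using assms(1)
        by (intro exI[of _ "\<lambda>n. f n + g n"]) (auto intro: tendsto_add subspace_add)
    qed
    show "r *\<^sub>R x \<in> closure V" if xy: "x \<in> closure V" for r x
    proof -
      obtain f where "\<forall>n. f n \<in> V" "f \<longlonglongrightarrow> x"
        using xy unfolding closure_sequential by metis
      then show ?thesis
        unfolding closure_sequential using assms(1)
        by (intro exI[of _ "\<lambda>n. r *\<^sub>R f n"]) (auto intro: tendsto_intros subspace_scale)
    qed
  qed
  show "c *\<^sub>C v \<in> closure V" if "v \<in> closure V" for c v
  proof -
    have "(\<lambda>v. c *\<^sub>C v) ` closure V \<subseteq> closure ((\<lambda>v. c *\<^sub>C v) ` V)"
      by (rule closure_bounded_linear_image_subset[OF bounded_linear_scaleC])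
    also have "\<dots> \<subseteq> closure V"
      by (rule closure_mono) (use assms in auto)
    finally show ?thesis
      using that by auto
  qed
qed auto


section \<open>Self-adjoint operators with a prescribed cosine\<close>

text \<open>
  Polarization: \<open>cinner (T u) u\<close> is real at \<open>u = v + \<i> w\<close>.
\<close>

lemma positive_op_symmetric:
  assumes "positive_op T"
  shows "T v \<bullet> w = v \<bullet> T w"
proof -
  have lin: "clinear_op T" and re: "Im (cinner (T u) u) = 0" for u
    using assms by (simp_all add: positive_op_def complex_nonneg_Reals_iff)
  have "cinner (T (v + \<i> *\<^sub>C w)) (v + \<i> *\<^sub>C w)
      = cinner (T v) v + cinner (T w) w + \<i> * (cinner (T w) v - cinner (T v) w)"
    by (simp add: blinfun.add_right clinear_opD[OF lin] cinner_add_left cinner_add_right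
        cinner_scaleC_left cinner_scaleC_right algebra_simps)
  then have "Im (\<i> * (cinner (T w) v - cinner (T v) w)) = 0"
    using re[of v] re[of w] re[of "v + \<i> *\<^sub>C w"] by simp
  then show ?thesis
    by (simp add: inner_eq_Re_cinner[symmetric] inner_commute)
qed

text \<open>
  Let \<open>l\<close> be the supremum of the quadratic form of \<open>T\<close> on the unit sphere. The form of \<open>R = l - T\<close> is
  positive and takes arbitrarily small values on the sphere, and for a positive form \<open>\<parallel>R v\<parallel>\<^sup>2\<close> is at most a constant
  times \<open>R v \<bullet> v\<close>. Applied to \<open>T\<close> and \<open>- T\<close>, this replaces the spectral theorem below.
\<close>

lemma numerical_range_sup_approx_eigenvalue:
  fixes T :: "'a::real_inner \<Rightarrow>\<^sub>L 'a"
  assumes K: "subspace K" "\<And>v. v \<in> K \<Longrightarrow> T v \<in> K" and v0: "v0 \<in> K" "v0 \<noteq> 0"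
    and sym: "\<And>v w. v \<in> K \<Longrightarrow> w \<in> K \<Longrightarrow> T v \<bullet> w = v \<bullet> T w"
  shows "\<exists>l. (\<forall>v\<in>K. T v \<bullet> v \<le> l * (norm v)\<^sup>2) \<and>
             (\<forall>\<epsilon>>0. \<exists>v\<in>K. norm v = 1 \<and> norm (T v - l *\<^sub>R v) < \<epsilon>)"
proof -
  define U where "U = {v\<in>K. norm v = 1}"
  define l where "l = (SUP v\<in>U. T v \<bullet> v)"
  have ne: "U \<noteq> {}"
    using K v0 by (auto simp: U_def intro!: exI[of _ "v0 /\<^sub>R norm v0"] subspace_scale)
  have "T v \<bullet> v \<le> norm T" if "v \<in> U" for v
    using Cauchy_Schwarz_ineq2[of "T v" v] norm_blinfun[of T v] that by (simp add: U_def)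
  then have bdd: "bdd_above ((\<lambda>v. T v \<bullet> v) ` U)"
    by (intro bdd_aboveI2)
  have le: "T v \<bullet> v \<le> l * (norm v)\<^sup>2" if "v \<in> K" for v
  proof (cases "v = 0")
    case False
    then have "v /\<^sub>R norm v \<in> U"
      using that K by (auto simp: U_def intro: subspace_scale)
    from cSUP_upper[OF this bdd] False show ?thesis
      by (simp add: l_def[symmetric] blinfun.scaleR_right power2_eq_square field_simps)
  qed simp
  define R where "R v = l *\<^sub>R v - T v" for v
  define B where "B = norm T + \<bar>l\<bar> + 1"
  have B: "B > 0"
    by (simp add: B_def add_nonneg_pos)
  have Rb: "norm (R v) \<le> B * norm v" for v
  proof -
    have "norm (R v) \<le> \<bar>l\<bar> * norm v + norm T * norm v"
      unfolding R_def by (rule order_trans[OF norm_triangle_ineq4]) (simp add: norm_blinfun)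
    then show ?thesis
      by (simp add: B_def algebra_simps add.commute order_trans)
  qed
  have RK: "R v \<in> K" if "v \<in> K" for v
    using that K by (simp add: R_def subspace_diff subspace_scale)
  have Rpos: "0 \<le> R v \<bullet> v" if "v \<in> K" for v
    using le[OF that] by (simp add: R_def inner_diff_left power2_norm_eq_inner)
  have Rsym: "R v \<bullet> w = v \<bullet> R w" if "v \<in> K" "w \<in> K" for v w
    using sym[OF that] by (simp add: R_def inner_diff_left inner_diff_right)
  \<comment> \<open>A positive form is small on \<open>v\<close> only if \<open>R v\<close> is small: test it on \<open>v - R v / B\<close>.\<close>
  have key: "(norm (R v))\<^sup>2 \<le> B * (R v \<bullet> v)" if v: "v \<in> K" for v
  proof -
    define w where "w = v - (1 / B) *\<^sub>R R v"
    have wK: "w \<in> K"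
      using v RK K by (simp add: w_def subspace_diff subspace_scale)
    have Rw: "R w = R v - (1 / B) *\<^sub>R R (R v)"
      by (simp add: w_def R_def blinfun.diff_right blinfun.add_right blinfun.scaleR_right
          algebra_simps)
    have "R (R v) \<bullet> R v \<le> B * (norm (R v))\<^sup>2"
      using norm_cauchy_schwarz[of "R (R v)" "R v"] mult_right_mono[OF Rb[of "R v"], of "norm (R v)"]
      by (simp add: power2_eq_square)
    then have "(1 / B) * (1 / B) * (R (R v) \<bullet> R v) \<le> (1 / B) * (norm (R v))\<^sup>2"
      using B by (simp add: field_simps)
    moreover have "R w \<bullet> w = R v \<bullet> v - 2 * (1 / B) * (norm (R v))\<^sup>2 + (1 / B) * (1 / B) * (R (R v) \<bullet> R v)"
      using Rsym[OF RK[OF v] v]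
      by (simp only: Rw)
         (simp add: w_def inner_diff_left inner_diff_right power2_norm_eq_inner diff_divide_distrib)
    ultimately have "(1 / B) * (norm (R v))\<^sup>2 \<le> R v \<bullet> v"
      using Rpos[OF wK] by simp
    then show ?thesis
      using B by (simp add: field_simps)
  qed
  have "\<exists>v\<in>K. norm v = 1 \<and> norm (T v - l *\<^sub>R v) < \<epsilon>" if \<epsilon>: "\<epsilon> > 0" for \<epsilon>
  proof -
    have "l - \<epsilon>\<^sup>2 / B < l"
      using \<epsilon> B by simp
    then obtain v where v: "v \<in> U" "l - \<epsilon>\<^sup>2 / B < T v \<bullet> v"
      unfolding l_def using less_cSUP_iff[OF ne bdd] by blast
    then have vK: "v \<in> K" "norm v = 1"
      by (auto simp: U_def)
    then have "R v \<bullet> v = l - T v \<bullet> v"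
      by (simp add: R_def inner_diff_left power2_norm_eq_inner[symmetric])
    then have "R v \<bullet> v < \<epsilon>\<^sup>2 / B"
      using v(2) by linarith
    then have "B * (R v \<bullet> v) < \<epsilon>\<^sup>2"
      using B by (simp add: pos_less_divide_eq mult.commute)
    then have "(norm (R v))\<^sup>2 < \<epsilon>\<^sup>2"
      using key[OF vK(1)] by simp
    then have "norm (R v) < \<epsilon>"
      using \<epsilon> by (meson less_imp_le power2_less_imp_less)
    then show ?thesis
      using vK by (auto simp: R_def norm_minus_commute)
  qed
  with le show ?thesis
    by blast
qed

text \<open>
  A bounded inverse of \<open>T - l\<close> would bound \<open>\<parallel>(T - l) v\<parallel>\<close> from below on unit vectors.
\<close>

lemma approx_eigenvalue_in_spectrum:
  assumes "\<And>\<epsilon>. \<epsilon> > 0 \<Longrightarrow> \<exists>v\<in>K. norm v = 1 \<and> norm (blinfun_apply T v - l *\<^sub>R v) < \<epsilon>"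
  shows "complex_of_real l \<in> spectrum_on K T"
proof -
  have False if S: "\<forall>v\<in>K. blinfun_apply S (T v - complex_of_real l *\<^sub>C v) = v" for S
  proof -
    have "1 / (norm S + 1) > 0"
      by (simp add: add_nonneg_pos)
    then obtain v where v: "v \<in> K" "norm v = 1" "norm (T v - l *\<^sub>R v) < 1 / (norm S + 1)"
      using assms by blast
    have "1 = norm (S (T v - l *\<^sub>R v))"
      using S v by (simp add: scaleR_scaleC)
    also have "\<dots> \<le> norm S * norm (T v - l *\<^sub>R v)"
      by (rule norm_blinfun)
    also have "\<dots> \<le> norm S * (1 / (norm S + 1))"
      using v by (intro mult_left_mono) auto
    also have "\<dots> < 1"
      by (simp add: divide_less_eq add_nonneg_pos)
    finally show False
      by simp
  qed
  then show ?thesis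
    unfolding spectrum_on_def by blast
qed

lemma spectrum_on_scalar:
  assumes K: "closed_csubspace K" and v0: "v0 \<in> K" "v0 \<noteq> 0"
    and T: "\<And>w. w \<in> K \<Longrightarrow> blinfun_apply T w = \<theta> *\<^sub>R w"
  shows "spectrum_on K T = {complex_of_real \<theta>}"
proof (intro equalityI subsetI)
  fix l assume l: "l \<in> spectrum_on K T"
  have "l = complex_of_real \<theta>"
  proof (rule ccontr)
    assume ne: "l \<noteq> complex_of_real \<theta>"
    define c where "c = 1 / (complex_of_real \<theta> - l)"
    have c: "c * (complex_of_real \<theta> - l) = 1"
      using ne by (simp add: c_def)
    have Tl: "T w - l *\<^sub>C w = (complex_of_real \<theta> - l) *\<^sub>C w" if "w \<in> K" for w
      using scaleC_add_left[of "complex_of_real \<theta> - l" l w]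
      by (simp add: T[OF that] scaleR_scaleC)
    have cK: "c *\<^sub>C w \<in> K" if "w \<in> K" for w
      using K that by (simp add: closed_csubspace_def)
    have "T (c *\<^sub>C w) - (c * l) *\<^sub>C w = w" if "w \<in> K" for w
      using Tl[OF cK[OF that]] c by (simp add: scaleC_scaleC mult.commute)
    then have "\<exists>S. clinear_op S \<and> S ` K \<subseteq> K \<and>
        (\<forall>v\<in>K. S (T v - l *\<^sub>C v) = v \<and> T (S v) - l *\<^sub>C S v = v)"
      using c cK Tl
      by (intro exI[of _ "op_scale c id_blinfun"])
         (auto simp: clinear_op_intros op_scale.rep_eq scaleC_scaleC mult.commute)
    then show False
      using l unfolding spectrum_on_def by blast
  qed
  then show "l \<in> {complex_of_real \<theta>}"
    by simp
next
  fix l assume l: "l \<in> {complex_of_real \<theta>}"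
  have "\<exists>v\<in>K. norm v = 1 \<and> norm (T v - \<theta> *\<^sub>R v) < \<epsilon>" if "\<epsilon> > 0" for \<epsilon>
  proof (intro bexI conjI)
    show v1: "v0 /\<^sub>R norm v0 \<in> K"
      using K v0 by (simp add: closed_csubspace_def subspace_scale)
    show "norm (T (v0 /\<^sub>R norm v0) - \<theta> *\<^sub>R (v0 /\<^sub>R norm v0)) < \<epsilon>"
      using T[OF v1] that by simp
  qed (use v0 in simp)
  then show "l \<in> spectrum_on K T"
    using approx_eigenvalue_in_spectrum l by auto
qed

lemma blinfun_power_apply:
  fixes T :: "'a::real_normed_vector \<Rightarrow>\<^sub>L 'a"
  shows "(((o\<^sub>L) T ^^ n) id_blinfun) v = (blinfun_apply T ^^ n) v"
  by (induction n) auto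

lemma op_cos_sums:
  fixes T :: "'h::complex_hilbert op"
  shows "(\<lambda>n. cos_coeff n *\<^sub>R (blinfun_apply T ^^ n) v) sums (op_cos T v)"
proof -
  have le: "norm (((o\<^sub>L) T ^^ n) id_blinfun) \<le> norm T ^ n" for n
  proof (induction n)
    case 0
    then show ?case
      by (simp add: norm_blinfun_id_le)
  next
    case (Suc n)
    have "norm (T o\<^sub>L ((o\<^sub>L) T ^^ n) id_blinfun) \<le> norm T * norm (((o\<^sub>L) T ^^ n) id_blinfun)"
      by (rule norm_blinfun_compose)
    also have "\<dots> \<le> norm T * norm T ^ n"
      using Suc by (rule mult_left_mono) simp
    finally show ?case
      by simp
  qed
  have "summable (\<lambda>n. cos_coeff n *\<^sub>R ((o\<^sub>L) T ^^ n) id_blinfun)"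
  proof (rule summable_comparison_test')
    show "summable (\<lambda>n. norm (cos_coeff n *\<^sub>R norm T ^ n))"
      by (rule summable_norm_cos)
    show "norm (cos_coeff n *\<^sub>R ((o\<^sub>L) T ^^ n) id_blinfun) \<le> norm (cos_coeff n *\<^sub>R norm T ^ n)" for n
      using le[of n] by (simp add: abs_mult mult_left_mono)
  qed
  then have "(\<lambda>n. cos_coeff n *\<^sub>R ((o\<^sub>L) T ^^ n) id_blinfun) sums op_cos T"
    unfolding op_cos_def by (rule summable_sums)
  from bounded_linear.sums[OF blinfun.bounded_linear_left[of v] this] show ?thesis
    by (simp add: blinfun.scaleR_left blinfun_power_apply)
qed

text \<open>
  Approximate eigenvectors survive the cosine series: \<open>T\<^sup>n v - l\<^sup>n v\<close> is controlled by \<open>T v - l v\<close> with a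
  constant \<open>(2m)\<^sup>n\<close>, which the factorials absorb.
\<close>

lemma op_cos_approx:
  fixes T :: "'h::complex_hilbert op" and l :: real
  defines "m \<equiv> 1 + norm T + \<bar>l\<bar>"
  shows "norm (op_cos T v - cos l *\<^sub>R v) \<le> exp (2 * m) * norm (T v - l *\<^sub>R v)"
proof -
  define \<delta> where "\<delta> = norm (T v - l *\<^sub>R v)"
  have m: "1 \<le> m" "norm T \<le> m" "\<bar>l\<bar> \<le> m" "0 \<le> \<delta>"
    by (auto simp: m_def \<delta>_def)
  have pow: "norm ((blinfun_apply T ^^ n) v - l ^ n *\<^sub>R v) \<le> (2 * m) ^ n * \<delta>" for n
  proof (induction n)
    case (Suc n)
    have "(blinfun_apply T ^^ Suc n) v - l ^ Suc n *\<^sub>R v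
        = T ((blinfun_apply T ^^ n) v - l ^ n *\<^sub>R v) + l ^ n *\<^sub>R (T v - l *\<^sub>R v)"
      by (simp add: blinfun.diff_right blinfun.scaleR_right scaleR_diff_right mult.commute)
    then have "norm ((blinfun_apply T ^^ Suc n) v - l ^ Suc n *\<^sub>R v)
        \<le> norm (T ((blinfun_apply T ^^ n) v - l ^ n *\<^sub>R v)) + \<bar>l\<bar> ^ n * \<delta>"
      by (metis norm_triangle_ineq norm_scaleR power_abs \<delta>_def)
    also have "norm (T ((blinfun_apply T ^^ n) v - l ^ n *\<^sub>R v)) \<le> m * ((2 * m) ^ n * \<delta>)"
      by (rule order_trans[OF norm_blinfun]) (use Suc m in \<open>auto intro!: mult_mono\<close>)
    also have "\<bar>l\<bar> ^ n * \<delta> \<le> m * ((2 * m) ^ n * \<delta>)"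
    proof -
      have "\<bar>l\<bar> ^ n \<le> 1 * (2 * m) ^ n"
        unfolding mult_1 by (rule power_mono) (use m in auto)
      also have "\<dots> \<le> m * (2 * m) ^ n"
        using m by (intro mult_right_mono) auto
      finally show ?thesis
        using m(4) by (simp add: mult_right_mono mult.assoc[symmetric])
    qed
    finally show ?case
      by (simp add: algebra_simps)
  qed (use m in simp)
  have s: "(\<lambda>n. cos_coeff n *\<^sub>R ((blinfun_apply T ^^ n) v - l ^ n *\<^sub>R v)) sums (op_cos T v - cos l *\<^sub>R v)"
    using sums_diff[OF op_cos_sums[of T v] bounded_linear.sums[OF bounded_linear_scaleR_left cos_converges[of l], of v]]
    by (simp add: algebra_simps)
  have e: "(\<lambda>n. inverse (fact n) * (2 * m) ^ n * \<delta>) sums (exp (2 * m) * \<delta>)"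
    using sums_mult2[OF exp_converges[of "2 * m"], of \<delta>] by (simp add: scaleR_conv_of_real)
  have "norm (cos_coeff n *\<^sub>R ((blinfun_apply T ^^ n) v - l ^ n *\<^sub>R v)) \<le> inverse (fact n) * (2 * m) ^ n * \<delta>" for n
  proof -
    have "\<bar>cos_coeff n\<bar> \<le> inverse (fact n)"
      by (simp add: cos_coeff_def abs_mult divide_inverse)
    then have "\<bar>cos_coeff n\<bar> * norm ((blinfun_apply T ^^ n) v - l ^ n *\<^sub>R v) \<le> inverse (fact n) * ((2 * m) ^ n * \<delta>)"
      by (intro mult_mono pow) auto
    then show ?thesis
      by (simp add: mult.assoc)
  qed
  from norm_sums_le[OF s e this] show ?thesis
    by (simp add: \<delta>_def)
qed

lemma op_cos_eigenvector: "blinfun_apply T v = l *\<^sub>R v \<Longrightarrow> op_cos T v = cos l *\<^sub>R v"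
  using op_cos_approx[of T v l] by simp

text \<open>
  The supremum and the infimum of the numerical range of \<open>T\<close> are approximate eigenvalues, hence
  belong to the spectrum and lie in \<open>[0, \<pi>/2]\<close>. An approximate eigenvalue \<open>l\<close> of \<open>T\<close> makes \<open>cos\<^sup>2 l\<close> an
  approximate eigenvalue of the scalar \<open>\<alpha>\<close>, so \<open>cos l = \<surd>\<alpha>\<close>. Both bounds therefore coincide, and a
  symmetric operator whose form is that of a scalar is this scalar.
\<close>

lemma op_cos_squared_scalar_unique:
  fixes T :: "'h::complex_hilbert op"
  assumes K: "subspace K" "\<And>v. v \<in> K \<Longrightarrow> T v \<in> K" "v0 \<in> K" "v0 \<noteq> 0"
    and T: "positive_op T" "spectrum_on K T \<subseteq> complex_of_real ` {0..pi/2}"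
    and cos: "\<And>v. v \<in> K \<Longrightarrow> op_cos T (op_cos T v) = \<alpha> *\<^sub>R v" and \<alpha>: "0 \<le> \<alpha>"
    and v: "v \<in> K"
  shows "T v = arccos (sqrt \<alpha>) *\<^sub>R v"
proof -
  have sym: "T u \<bullet> w = u \<bullet> T w" for u w
    by (rule positive_op_symmetric) fact
  have eig: "l = arccos (sqrt \<alpha>)"
    if l: "\<And>\<epsilon>. \<epsilon> > 0 \<Longrightarrow> \<exists>v\<in>K. norm v = 1 \<and> norm (T v - l *\<^sub>R v) < \<epsilon>" for l
  proof -
    have lr: "0 \<le> l" "l \<le> pi / 2"
      using approx_eigenvalue_in_spectrum[OF l] T(2) by auto
    define c where "c = (norm (op_cos T) + 1) * exp (2 * (1 + norm T + \<bar>l\<bar>))"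
    have c: "c > 0"
      by (simp add: c_def add_nonneg_pos)
    have "\<bar>\<alpha> - (cos l)\<^sup>2\<bar> \<le> 0 + \<epsilon>" if "\<epsilon> > 0" for \<epsilon>
    proof -
      have "\<epsilon> / c > 0"
        using c that by simp
      from l[OF this] obtain v where v: "v \<in> K" "norm v = 1" "norm (T v - l *\<^sub>R v) < \<epsilon> / c"
        by blast
      define u where "u = op_cos T v - cos l *\<^sub>R v"
      have "(\<alpha> - (cos l)\<^sup>2) *\<^sub>R v = op_cos T u + cos l *\<^sub>R u"
        using cos[OF v(1)]
        by (simp add: u_def blinfun.diff_right blinfun.scaleR_right algebra_simps power2_eq_square)
      then have "\<bar>\<alpha> - (cos l)\<^sup>2\<bar> = norm (op_cos T u + cos l *\<^sub>R u)"
        using v by (metis norm_scaleR mult.right_neutral)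
      also have "\<dots> \<le> norm (op_cos T) * norm u + 1 * norm u"
        by (rule order_trans[OF norm_triangle_ineq])
           (auto intro!: add_mono norm_blinfun mult_left_le_one_le)
      also have "\<dots> \<le> c * norm (T v - l *\<^sub>R v)"
        using mult_left_mono[OF op_cos_approx[of T v l], of "norm (op_cos T) + 1"]
        by (simp add: u_def c_def algebra_simps)
      also have "\<dots> \<le> \<epsilon>"
        using v(3) c by (simp add: field_simps)
      finally show ?thesis
        by simp
    qed
    then have "\<bar>\<alpha> - (cos l)\<^sup>2\<bar> \<le> 0"
      by (rule field_le_epsilon)
    then have "sqrt \<alpha> = \<bar>cos l\<bar>"
      by simp
    also have "\<dots> = cos l"
      using lr cos_ge_zero[of l] by simp
    finally show ?thesis
      using lr by (simp add: arccos_cos)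
  qed
  obtain l where l: "\<And>v. v \<in> K \<Longrightarrow> T v \<bullet> v \<le> l * (norm v)\<^sup>2"
    "\<And>\<epsilon>. \<epsilon> > 0 \<Longrightarrow> \<exists>v\<in>K. norm v = 1 \<and> norm (T v - l *\<^sub>R v) < \<epsilon>"
    using numerical_range_sup_approx_eigenvalue[of K T v0] K sym by blast
  have "\<exists>k. (\<forall>v\<in>K. (- T) v \<bullet> v \<le> k * (norm v)\<^sup>2) \<and>
             (\<forall>\<epsilon>>0. \<exists>v\<in>K. norm v = 1 \<and> norm ((- T) v - k *\<^sub>R v) < \<epsilon>)"
    using K sym
    by (intro numerical_range_sup_approx_eigenvalue[of K "- T" v0])
       (auto simp: blinfun.minus_left subspace_neg)
  then obtain k where k: "\<And>v. v \<in> K \<Longrightarrow> (- T) v \<bullet> v \<le> k * (norm v)\<^sup>2"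
    "\<And>\<epsilon>. \<epsilon> > 0 \<Longrightarrow> \<exists>v\<in>K. norm v = 1 \<and> norm ((- T) v - k *\<^sub>R v) < \<epsilon>"
    by blast
  define \<theta> where "\<theta> = arccos (sqrt \<alpha>)"
  have l\<theta>: "l = \<theta>"
    unfolding \<theta>_def by (rule eig) (rule l(2))
  have "- k = \<theta>"
    unfolding \<theta>_def
  proof (rule eig)
    show "\<exists>v\<in>K. norm v = 1 \<and> norm (T v - (- k) *\<^sub>R v) < \<epsilon>" if "\<epsilon> > 0" for \<epsilon>
    proof -
      have "norm ((- T) v - k *\<^sub>R v) = norm (T v - (- k) *\<^sub>R v)" for v
        by (simp add: blinfun.minus_left) (metis add.commute minus_add_distrib norm_minus_cancel uminus_add_conv_diff)
      then show ?thesis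
        using k(2)[OF that] by metis
    qed
  qed
  then have form: "T w \<bullet> w = \<theta> * (w \<bullet> w)" if "w \<in> K" for w
    using l(1)[OF that] k(1)[OF that] l\<theta>
    by (auto simp: blinfun.minus_left power2_norm_eq_inner)
  define u where "u = T v - \<theta> *\<^sub>R v"
  have u: "u \<in> K" "v + u \<in> K"
    using K v by (auto simp: u_def intro: subspace_diff subspace_scale subspace_add)
  have "T v \<bullet> u = \<theta> * (v \<bullet> u)"
    using form[OF v] form[OF u(1)] form[OF u(2)] sym[of v u]
    by (simp add: blinfun.add_right inner_add_left inner_add_right inner_commute algebra_simps)
  then have "u \<bullet> u = 0"
    by (simp add: u_def inner_diff_left)
  then show ?thesis
    by (simp add: u_def \<theta>_def)
qed


section \<open>Two projections with a single angle\<close>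

lemma range_projection: "is_projection p \<Longrightarrow> range (blinfun_apply p) = {v. p v = v}"
  using projection_range by blast

lemma proj_compl:
  assumes "is_projection q"
  shows "is_projection (proj_compl q)" "range (proj_compl q) = {v. q v = 0}"
proof -
  have q: "clinear_op q" "q o\<^sub>L q = q"
    using assms by (auto simp: is_projection_def)
  have ap: "proj_compl q v = v - q v" for v
    by (simp add: proj_compl_def blinfun.diff_left)
  have "adj (proj_compl q) = proj_compl q"
    by (rule adj_eqI) (simp add: ap cinner_diff_left cinner_diff_right projection_apply[OF assms])
  moreover have "proj_compl q o\<^sub>L proj_compl q = proj_compl q"
    by (rule blinfun_eqI) (simp add: ap blinfun.diff_right projection_apply[OF assms])
  moreover have "clinear_op (proj_compl q)"
    unfolding proj_compl_def by (intro clinear_op_intros q)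
  ultimately show pr: "is_projection (proj_compl q)"
    by (simp add: is_projection_def)
  show "range (proj_compl q) = {v. q v = 0}"
    using projection_range[OF pr] by (auto simp: ap)
qed

lemma range_proj_meet:
  assumes "is_projection p" "is_projection q"
  shows "range (proj_meet p q) = range p \<inter> range q"
  unfolding proj_meet_def
  by (intro proj_onto closed_csubspace_Int projection_closed_range assms)

text \<open>
  Of the four summands removed from the whole space only \<open>p \<and> q\<close> and \<open>p \<and> q\<^sup>\<bottom>\<close> matter inside the range of
  \<open>p\<close>, because the other two are orthogonal to it.
\<close>

lemma proj_image_generic_part:
  assumes p: "is_projection p" and q: "is_projection q"
  shows "p ` generic_part p q = {v. p v = v \<and> (\<forall>w. p w = w \<longrightarrow> q w = w \<or> q w = 0 \<longrightarrow> cinner v w = 0)}"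
    (is "_ = ?K")
proof -
  note compl = proj_compl[OF p] proj_compl[OF q]
  have meets:
    "range (proj_meet p q) = {w. p w = w \<and> q w = w}"
    "range (proj_meet p (proj_compl q)) = {w. p w = w \<and> q w = 0}"
    "range (proj_meet (proj_compl p) q) = {w. p w = 0 \<and> q w = w}"
    "range (proj_meet (proj_compl p) (proj_compl q)) = {w. p w = 0 \<and> q w = 0}"
    by (simp_all add: range_proj_meet p q compl range_projection[OF p] range_projection[OF q] Collect_conj_eq)
  have gen: "u \<in> generic_part p q \<longleftrightarrow>
      (\<forall>w. (p w = w \<or> p w = 0) \<and> (q w = w \<or> q w = 0) \<longrightarrow> cinner u w = 0)" for u
  proof
    assume u: "u \<in> generic_part p q"
    have *: "cinner u (proj_meet p q a + proj_meet p (proj_compl q) b +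
        proj_meet (proj_compl p) q c + proj_meet (proj_compl p) (proj_compl q) d) = 0" for a b c d
      using u unfolding generic_part_def ortho_compl_def by blast
    have "cinner u (proj_meet p q a) = 0" "cinner u (proj_meet p (proj_compl q) a) = 0"
      "cinner u (proj_meet (proj_compl p) q a) = 0"
      "cinner u (proj_meet (proj_compl p) (proj_compl q) a) = 0" for a
      using *[of a 0 0 0] *[of 0 a 0 0] *[of 0 0 a 0] *[of 0 0 0 a] by simp_all
    then have "cinner u w = 0" if "w \<in> range (proj_meet p q) \<union> range (proj_meet p (proj_compl q)) \<union>
        range (proj_meet (proj_compl p) q) \<union> range (proj_meet (proj_compl p) (proj_compl q))" for w
      using that by blast
    then show "\<forall>w. (p w = w \<or> p w = 0) \<and> (q w = w \<or> q w = 0) \<longrightarrow> cinner u w = 0"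
      unfolding meets by blast
  next
    assume u: "\<forall>w. (p w = w \<or> p w = 0) \<and> (q w = w \<or> q w = 0) \<longrightarrow> cinner u w = 0"
    have "cinner u w = 0" if "w \<in> range (proj_meet p q) \<union> range (proj_meet p (proj_compl q)) \<union>
        range (proj_meet (proj_compl p) q) \<union> range (proj_meet (proj_compl p) (proj_compl q))" for w
      using u that unfolding meets by blast
    then show "u \<in> generic_part p q"
      unfolding generic_part_def ortho_compl_def by (auto simp: cinner_add_right)
  qed
  show ?thesis
  proof (intro equalityI subsetI)
    fix v assume "v \<in> p ` generic_part p q"
    then obtain u where u: "u \<in> generic_part p q" "v = p u"
      by blast
    have "cinner v w = 0" if "p w = w" "q w = w \<or> q w = 0" for w
      using u that gen[of u] projection_apply(2)[OF p, of u w] by simp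
    then show "v \<in> ?K"
      using u projection_apply(1)[OF p] by simp
  next
    fix v assume v: "v \<in> ?K"
    have "cinner v w = 0" if "p w = 0" for w
      using v that projection_apply(2)[OF p, of v w] by simp
    then have "v \<in> generic_part p q"
      using v gen[of v] by blast
    then show "v \<in> p ` generic_part p q"
      using v by (metis (mono_tags, lifting) imageI mem_Collect_eq)
  qed
qed

lemma proj_image_generic_part_closed:
  assumes p: "is_projection p" and q: "is_projection q"
  shows "closed_csubspace (p ` generic_part p q)"
proof -
  have "p ` generic_part p q = range p \<inter> ortho_compl {w. p w = w \<and> (q w = w \<or> q w = 0)}"
    unfolding proj_image_generic_part[OF p q] range_projection[OF p] ortho_compl_def by auto
  then show ?thesis
    using closed_csubspace_Int[OF projection_closed_range[OF p] closed_csubspace_ortho_compl] by simp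
qed

text \<open>
  The scalar \<open>arccos \<surd>\<alpha>\<close> on \<open>p H\<^sub>0\<close>, extended by \<open>0\<close>, has the defining properties of the angle operator.
  Any other candidate agrees with it on \<open>p H\<^sub>0\<close> because its cosine squares to \<open>\<alpha>\<close>, and on the orthogonal
  complement by definition.
\<close>

lemma angle_op_scalar:
  assumes p: "is_projection p" and q: "is_projection q"
    and pqp: "\<And>v. v \<in> p ` generic_part p q \<Longrightarrow> p (q (p v)) = \<alpha> *\<^sub>R v"
    and \<alpha>: "0 \<le> \<alpha>" "\<alpha> \<le> 1"
    and v0: "v0 \<in> p ` generic_part p q" "v0 \<noteq> 0"
    and v: "v \<in> p ` generic_part p q"
  shows "angle_op p q v = arccos (sqrt \<alpha>) *\<^sub>R v"
proof -
  define K where "K = p ` generic_part p q"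
  define \<theta> where "\<theta> = arccos (sqrt \<alpha>)"
  have \<theta>: "0 \<le> \<theta>" "\<theta> \<le> pi / 2" "cos \<theta> = sqrt \<alpha>"
  proof -
    have "0 \<le> sqrt \<alpha>" "sqrt \<alpha> \<le> 1"
      using \<alpha> by simp_all
    moreover from this have "- 1 \<le> sqrt \<alpha>"
      by linarith
    ultimately show "0 \<le> \<theta>" "\<theta> \<le> pi / 2" "cos \<theta> = sqrt \<alpha>"
      using arccos_le_pi2[of "sqrt \<alpha>"] arccos_lbound[of "sqrt \<alpha>"] cos_arccos[of "sqrt \<alpha>"]
      by (simp_all add: \<theta>_def)
  qed
  have K: "closed_csubspace K"
    unfolding K_def by (rule proj_image_generic_part_closed[OF p q])
  then have sub: "subspace K"
    by (simp add: closed_csubspace_def)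
  define r where "r = proj_onto K"
  have r: "is_projection r" "range r = K"
    unfolding r_def using proj_onto[OF K] by auto
  have rK: "r w = w" if "w \<in> K" for w
    using projection_range[OF r(1)] r(2) that by blast
  define T0 where "T0 = \<theta> *\<^sub>R r"
  have T0K: "T0 w = \<theta> *\<^sub>R w" if "w \<in> K" for w
    using rK[OF that] by (simp add: T0_def blinfun.scaleR_left)
  define Pr where "Pr T \<longleftrightarrow> positive_op T \<and> T ` K \<subseteq> K \<and> (\<forall>v\<in>ortho_compl K. T v = 0) \<and>
       spectrum_on K T \<subseteq> complex_of_real ` {0..pi/2} \<and>
       (\<forall>v\<in>K. op_cos T (op_cos T v) = p (q (p v)))" for T
  have rc: "clinear_op r"
    using r by (simp add: is_projection_def)
  have "Pr T0"
    unfolding Pr_def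
  proof (intro conjI ballI)
    have "cinner (T0 w) w = complex_of_real (\<theta> * (norm (r w))\<^sup>2)" for w
      using projection_apply[OF r(1)]
      by (simp add: T0_def blinfun.scaleR_left cinner_scaleR_left)
         (metis cinner_self of_real_power)
    then show "positive_op T0"
      unfolding positive_op_def using \<theta> rc by (simp add: T0_def clinear_op_intros)
    show "T0 ` K \<subseteq> K"
      using T0K sub by (auto intro: subspace_scale)
    show "T0 w = 0" if w: "w \<in> ortho_compl K" for w
    proof -
      have "cinner w (r w) = 0"
        using w r(2) by (auto simp: ortho_compl_def)
      then have "cinner (r w) (r w) = 0"
        using projection_apply[OF r(1)] by metis
      then show ?thesis
        by (simp add: T0_def blinfun.scaleR_left)
    qed
    show "spectrum_on K T0 \<subseteq> complex_of_real ` {0..pi/2}"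
      using spectrum_on_scalar[OF K _ _ T0K] v0 \<theta> by (auto simp: K_def)
    show "op_cos T0 (op_cos T0 w) = p (q (p w))" if w: "w \<in> K" for w
    proof -
      have "op_cos T0 (op_cos T0 w) = (cos \<theta> * cos \<theta>) *\<^sub>R w"
        using op_cos_eigenvector[of T0 w \<theta>] T0K[OF w] by (simp add: blinfun.scaleR_right)
      also have "\<dots> = p (q (p w))"
        using \<theta> \<alpha> w pqp by (simp add: K_def)
      finally show ?thesis .
    qed
  qed
  moreover have "T = T0" if "Pr T" for T
  proof (rule blinfun_eqI)
    fix w
    have "T u = \<theta> *\<^sub>R u" if u: "u \<in> K" for u
      unfolding \<theta>_def
    proof (rule op_cos_squared_scalar_unique[of K T v0])
      show "op_cos T (op_cos T v) = \<alpha> *\<^sub>R v" if "v \<in> K" for v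
        using \<open>Pr T\<close> pqp[folded K_def, OF that] that by (simp add: Pr_def)
    qed (use \<open>Pr T\<close> sub v0[folded K_def] u \<alpha> in \<open>auto simp: Pr_def\<close>)
    then have "T (r w) = T0 w"
      using r(2) by (auto simp: T0_def blinfun.scaleR_left)
    moreover have "T (w - r w) = 0"
    proof -
      have "w - r w \<in> ortho_compl K"
        using projection_orthogonal[OF r(1)] r(2) by (auto simp: ortho_compl_def)
      then show ?thesis
        using \<open>Pr T\<close> by (simp add: Pr_def)
    qed
    ultimately show "T w = T0 w"
      by (simp add: blinfun.diff_right)
  qed
  ultimately have "(THE T. Pr T) = T0"
    by (rule the_equality)
  then have "angle_op p q = T0"
    by (simp add: angle_op_def Let_def K_def[symmetric] Pr_def)
  then show ?thesis
    using T0K v by (simp add: K_def \<theta>_def)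
qed

text \<open>
  Since \<open>n\<close> is absorbed by \<open>p\<close> and \<open>q\<close>, the operator \<open>S\<close> has range inside that of \<open>q\<close> and is orthogonal to
  \<open>n\<close>. If \<open>p\<close> and \<open>q\<close> commute then \<open>S\<close> is idempotent, which \<open>S\<^sup>2 = \<alpha>S\<close> with \<open>\<alpha> \<noteq> 1\<close> excludes. On \<open>p H\<^sub>0\<close> the
  vector \<open>u = pqv - \<alpha>v\<close> satisfies \<open>pu = u\<close> and \<open>qu = 0\<close>; such vectors are orthogonal to \<open>v\<close>, which forces
  \<open>u = 0\<close>. Finally \<open>p H\<^sub>0\<close> is nonzero: it contains \<open>p y \<noteq> 0\<close> for every nonzero \<open>y\<close> in the
  range of \<open>S\<close>.
\<close>

lemma Ang_singleton:
  assumes p: "is_projection p" and q: "is_projection q"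
    and n: "is_projection n" "\<And>v. p (n v) = n v" "\<And>v. q (n v) = n v"
    and S: "\<And>v. S v = q (p (q v)) - n v" "\<And>v. S (S v) = \<alpha> *\<^sub>R S v" "S v1 \<noteq> 0"
    and \<alpha>: "0 < \<alpha>" "\<alpha> < 1"
  shows "p o\<^sub>L q \<noteq> q o\<^sub>L p" "Ang p q = {complex_of_real (arccos (sqrt \<alpha>))}"
proof -
  note pp = projection_apply[OF p] and qq = projection_apply[OF q] and nn = projection_apply[OF n(1)]
  note np = subprojection_absorbs[OF p n(1,2)] and nq = subprojection_absorbs[OF q n(1,3)]
  have nS: "n (S v) = 0" for v
    by (simp add: S(1) blinfun.diff_right np nq nn)
  have qS: "q (S v) = S v" for v
    by (simp add: S(1) blinfun.diff_right qq n)
  show ne: "p o\<^sub>L q \<noteq> q o\<^sub>L p"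
  proof
    assume "p o\<^sub>L q = q o\<^sub>L p"
    then have com: "p (q v) = q (p v)" for v
      by (metis blinfun_apply_blinfun_compose)
    have "S (S v1) = S v1"
      by (subst S(1)) (simp add: nS qS, simp add: S(1) blinfun.diff_right com pp qq n)
    then have "(\<alpha> - 1) *\<^sub>R S v1 = 0"
      using S(2)[of v1] by (simp add: scaleR_diff_left)
    then show False
      using S(3) \<alpha> by simp
  qed
  define K where "K = p ` generic_part p q"
  have Kiff: "v \<in> K \<longleftrightarrow> p v = v \<and> (\<forall>w. p w = w \<longrightarrow> q w = w \<or> q w = 0 \<longrightarrow> cinner v w = 0)" for v
    unfolding K_def proj_image_generic_part[OF p q] by simp
  have pqp: "p (q (p v)) = \<alpha> *\<^sub>R v" if v: "v \<in> K" for v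
  proof -
    have pv: "p v = v"
      using v Kiff by blast
    have nv: "n v = 0"
    proof -
      have "cinner v (n v) = 0"
        using v Kiff n by blast
      then show ?thesis
        using nn by (metis cinner_self_eq_0)
    qed
    define u where "u = p (q v) - \<alpha> *\<^sub>R v"
    have pu: "p u = u"
      by (simp add: u_def blinfun.diff_right blinfun.scaleR_right pp pv)
    have nu: "n u = 0"
      by (simp add: u_def blinfun.diff_right blinfun.scaleR_right np nq nv)
    \<comment> \<open>At \<open>v\<close> the relation \<open>S\<^sup>2 = \<alpha>S\<close> reads \<open>q p q u = 0\<close>, and \<open>q p q\<close> has the kernel of \<open>p q\<close>.\<close>
    have Sqv: "S v = q (p (q v))"
      by (simp add: S(1) nv)
    have "S (S v) = q (p (q (p (q v))))"
      using nS[of v] by (subst S(1)) (simp add: Sqv qq)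
    then have "q (p (q u)) = 0"
      using S(2)[of v] by (simp add: Sqv u_def blinfun.diff_right blinfun.scaleR_right)
    then have "cinner (p (q u)) (p (q u)) = 0"
      using pp qq by (metis cinner_zero(1))
    then have "p (q u) = 0"
      by simp
    then have "cinner (q u) (q u) = 0"
      using pp qq pu by (metis cinner_zero(1))
    then have qu: "q u = 0"
      by simp
    have "cinner v u = 0"
      using v Kiff pu qu by blast
    moreover have "cinner (p (q v)) u = 0"
      using pp qq pu qu by (metis cinner_zero(2))
    ultimately have "cinner u u = 0"
      by (subst u_def) (simp add: cinner_diff_left cinner_scaleR_left)
    then show ?thesis
      using pv by (simp add: u_def)
  qed
  define y where "y = S v1"
  have qpy: "q (p y) = \<alpha> *\<^sub>R y"
    using S(2)[of v1] qS[of v1] nS[of v1] by (simp add: y_def[symmetric] S(1)[of y])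
  define v0 where "v0 = p y"
  have v0: "v0 \<in> K" "v0 \<noteq> 0"
  proof -
    have "cinner v0 w = 0" if w: "p w = w" "q w = w \<or> q w = 0" for w
    proof -
      have 1: "cinner v0 w = cinner y (q w)"
        using w pp(2)[of y w] qq(2)[of y w] qS[of v1] by (simp add: v0_def y_def)
      show ?thesis
      proof (cases "q w = 0")
        case False
        then have "q w = w"
          using w by blast
        \<comment> \<open>A vector fixed by \<open>p\<close> and \<open>q\<close> is orthogonal to \<open>y\<close> because \<open>q p y = \<alpha> y\<close> and \<open>\<alpha> \<noteq> 1\<close>.\<close>
        then have "cinner (q (p y)) w = cinner y w"
          using w by (simp add: pp qq)
        then have "complex_of_real \<alpha> * cinner y w = cinner y w"
          by (simp add: qpy cinner_scaleR_left)
        then show ?thesis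
          using \<alpha> \<open>q w = w\<close> 1 by auto
      qed (use 1 in simp)
    qed
    then show "v0 \<in> K"
      using Kiff pp by (simp add: v0_def)
    show "v0 \<noteq> 0"
      using qpy \<alpha> S(3) by (auto simp: v0_def y_def)
  qed
  have ang: "angle_op p q v = arccos (sqrt \<alpha>) *\<^sub>R v" if "v \<in> K" for v
    using angle_op_scalar[OF p q, of \<alpha> v0 v] pqp v0 \<alpha> that by (simp add: K_def)
  have "spectrum_on K (angle_op p q) = {complex_of_real (arccos (sqrt \<alpha>))}"
    using proj_image_generic_part_closed[OF p q] v0 ang
    by (intro spectrum_on_scalar) (auto simp: K_def)
  then show "Ang p q = {complex_of_real (arccos (sqrt \<alpha>))}"
    using ne by (simp add: Ang_def K_def)
qed


section \<open>Finite-dimensional spaces of operators\<close>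

text \<open>
  A vector space of linear functionals that separates points also separates points from
  finite-dimensional subspaces. The induction removes one generator \<open>b\<close> at a time: a functional \<open>g\<close> with
  \<open>g b \<noteq> 0\<close> is used to correct a functional that separates \<open>x - (g x / g b) b\<close>. The lemma serves twice:
  with evaluation functionals for the strong operator topology, and with \<open>x \<mapsto> Re \<tau>(y x)\<close> to find the unit
  of an ideal.
\<close>

lemma functional_separates_from_finite_span:
  fixes W :: "'a::real_vector set" and L :: "('a \<Rightarrow> real) set"
  assumes W: "subspace W"
    and add: "\<And>f x y. f \<in> L \<Longrightarrow> x \<in> W \<Longrightarrow> y \<in> W \<Longrightarrow> f (x + y) = f x + f y"
    and scale: "\<And>f r x. f \<in> L \<Longrightarrow> x \<in> W \<Longrightarrow> f (r *\<^sub>R x) = r * f x"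
    and comb: "\<And>f g c. f \<in> L \<Longrightarrow> g \<in> L \<Longrightarrow> (\<lambda>x. f x - c * g x) \<in> L"
    and sep: "\<And>x. x \<in> W \<Longrightarrow> x \<noteq> 0 \<Longrightarrow> \<exists>f\<in>L. f x \<noteq> 0"
    and F: "finite F" "F \<subseteq> W" and x: "x \<in> W" "x \<notin> span F"
  shows "\<exists>f\<in>L. (\<forall>y\<in>span F. f y = 0) \<and> f x \<noteq> 0"
proof -
  have diff: "f (u - c *\<^sub>R v) = f u - c * f v" if "f \<in> L" "u \<in> W" "v \<in> W" for f u v c
    using add[of f u "(- c) *\<^sub>R v"] scale[of f v "- c"] that W by (simp add: subspace_neg subspace_scale)
  have vanish: "f y = 0" if f: "f \<in> L" "\<forall>y\<in>G. f y = 0" and G: "G \<subseteq> W" "y \<in> span G" for f G y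
  proof -
    have "f y = 0 \<and> y \<in> W"
      using G(2)
    proof (induction rule: span_induct_alt)
      case base
      show ?case
        using scale[OF f(1), of 0 0] W by (simp add: subspace_0)
    next
      case (step c y z)
      then have "y \<in> W" "c *\<^sub>R y \<in> W" "z \<in> W"
        using G(1) W by (auto intro: subspace_scale)
      then show ?case
        using step f add[OF f(1), of "c *\<^sub>R y" z] scale[OF f(1), of y c] W
        by (simp add: subspace_add)
    qed
    then show ?thesis
      by blast
  qed
  have "\<exists>f\<in>L. (\<forall>y\<in>F. f y = 0) \<and> f x \<noteq> 0"
    using F x
  proof (induction F arbitrary: x rule: finite_induct)
    case empty
    then show ?case
      using sep by auto
  next
    case (insert b F)
    show ?case
    proof (cases "b \<in> span F")
      case True
      then have sp: "span (insert b F) = span F"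
        by (rule span_redundant)
      obtain f where f: "f \<in> L" "\<forall>y\<in>F. f y = 0" "f x \<noteq> 0"
        using insert.IH[of x] insert.prems sp by auto
      have "f y = 0" if "y \<in> span F" for y
        using vanish[OF f(1,2) _ that] insert.prems by blast
      then show ?thesis
        using f True by blast
    next
      case False
      then obtain g where g: "g \<in> L" "\<forall>y\<in>F. g y = 0" "g b \<noteq> 0"
        using insert.IH[of b] insert.prems by auto
      define x' where "x' = x - (g x / g b) *\<^sub>R b"
      have "x' \<notin> span F"
      proof
        assume "x' \<in> span F"
        then have "x' + (g x / g b) *\<^sub>R b \<in> span (insert b F)"
          by (meson insertI1 span_add span_base span_mono span_scale subsetD subset_insertI)
        then show False
          using insert.prems by (simp add: x'_def)
      qed
      moreover have "x' \<in> W"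
        using insert.prems W by (simp add: x'_def subspace_diff subspace_scale)
      ultimately obtain f where f: "f \<in> L" "\<forall>y\<in>F. f y = 0" "f x' \<noteq> 0"
        using insert.IH[of x'] insert.prems by auto
      have "f x' = f x - f b / g b * g x"
        using diff[OF f(1), of x b "g x / g b"] insert.prems by (simp add: x'_def)
      then show ?thesis
        using f g comb[OF f(1) g(1), of "f b / g b"]
        by (intro bexI[of _ "\<lambda>x. f x - f b / g b * g x"]) auto
    qed
  qed
  then obtain f where f: "f \<in> L" "\<forall>y\<in>F. f y = 0" "f x \<noteq> 0"
    by blast
  have "f y = 0" if "y \<in> span F" for y
    using vanish[OF f(1,2) F(2) that] .
  then show ?thesis
    using f by blast
qed

text \<open>
  Functionals \<open>z \<mapsto> z u \<bullet> v\<close> are continuous for the strong operator topology and separate points. For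
  finite-dimensional algebras this turns nondegeneracy into an equality of linear spans.
\<close>

lemma finite_span_SOT_closed:
  fixes F :: "('a::real_normed_vector \<Rightarrow>\<^sub>L 'b::real_inner) set"
  assumes F: "finite F" and x: "x \<in> strong_operator_topology closure_of span F"
  shows "x \<in> span F"
proof (rule ccontr)
  assume nx: "x \<notin> span F"
  define L where "L = {f :: ('a \<Rightarrow>\<^sub>L 'b) \<Rightarrow> real. linear f \<and>
    continuous_map strong_operator_topology euclideanreal f}"
  have "\<exists>f\<in>L. (\<forall>y\<in>span F. f y = 0) \<and> f x \<noteq> 0"
  proof (rule functional_separates_from_finite_span[of UNIV])
    show "\<exists>f\<in>L. f y \<noteq> 0" if "y \<noteq> 0" for y
    proof -
      obtain u where u: "blinfun_apply y u \<noteq> 0"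
        using \<open>y \<noteq> 0\<close> by (metis blinfun_eqI blinfun.zero_left)
      have "continuous_map strong_operator_topology euclideanreal (\<lambda>z. blinfun_apply z u \<bullet> y u)"
      proof -
        have "continuous_map euclidean euclideanreal (\<lambda>v. v \<bullet> y u)"
          by (simp add: continuous_map_iff_continuous2 continuous_intros)
        from continuous_map_compose[OF strong_operator_topology_continuous_evaluation this, of u]
        show ?thesis
          by (simp add: o_def)
      qed
      moreover have "linear (\<lambda>z. blinfun_apply z u \<bullet> y u)"
        by (intro linearI) (simp_all add: blinfun.add_left blinfun.scaleR_left inner_add_left)
      ultimately show ?thesis
        using u by (intro bexI[of _ "\<lambda>z. blinfun_apply z u \<bullet> y u"]) (auto simp: L_def)
    qed
    show "(\<lambda>x. f x - c * g x) \<in> L" if "f \<in> L" "g \<in> L" for f g c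
    proof -
      have "linear (\<lambda>x. f x - c * g x)"
        using that by (auto simp: L_def linear_add linear_scale algebra_simps intro!: linearI)
      moreover have "continuous_map strong_operator_topology euclideanreal (\<lambda>x. f x - c * g x)"
        using that by (intro continuous_intros) (auto simp: L_def)
      ultimately show ?thesis
        by (simp add: L_def)
    qed
  qed (use F nx in \<open>auto simp: L_def linear_add linear_scale\<close>)
  then obtain f where f: "f \<in> L" "\<And>y. y \<in> span F \<Longrightarrow> f y = 0" "f x \<noteq> 0"
    by blast
  have "f x = 0"
    by (rule forall_in_closure_of_eq[OF x, where Y = euclideanreal])
       (use f in \<open>auto simp: L_def\<close>)
  with f show False
    by blast
qed

lemma finite_span_of_subset:
  fixes S :: "'a::real_vector set"
  assumes "S \<subseteq> span F" "finite F"
  obtains G where "finite G" "span S = span G"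
proof -
  obtain B where B: "B \<subseteq> S" "independent B" "S \<subseteq> span B"
    using maximal_independent_subset by blast
  have "finite B"
    using independent_span_bound[OF assms(2) B(2)] B(1) assms(1) by blast
  moreover have "span S = span B"
    using B by (meson span_mono span_minimal subspace_span subset_antisym)
  ultimately show ?thesis
    using that by blast
qed

lemma blinfun_compose_assoc: "(x o\<^sub>L y) o\<^sub>L z = x o\<^sub>L (y o\<^sub>L z)"
  by (rule blinfun_eqI) simp

lemmas compose_bilinear =
  bounded_bilinear.add_left[OF bounded_bilinear_blinfun_compose]
  bounded_bilinear.add_right[OF bounded_bilinear_blinfun_compose]
  bounded_bilinear.diff_left[OF bounded_bilinear_blinfun_compose]
  bounded_bilinear.diff_right[OF bounded_bilinear_blinfun_compose]
  bounded_bilinear.scaleR_left[OF bounded_bilinear_blinfun_compose]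
  bounded_bilinear.scaleR_right[OF bounded_bilinear_blinfun_compose]
  bounded_bilinear.zero_left[OF bounded_bilinear_blinfun_compose]
  bounded_bilinear.zero_right[OF bounded_bilinear_blinfun_compose]

lemma span_compose_in:
  assumes "\<And>s t. s \<in> S \<Longrightarrow> t \<in> T \<Longrightarrow> s o\<^sub>L t \<in> V" and V: "subspace V"
    and x: "x \<in> span S" and y: "y \<in> span T"
  shows "x o\<^sub>L y \<in> V"
proof -
  have 1: "s o\<^sub>L y \<in> V" if "s \<in> S" for s
    using y
  proof (induction rule: span_induct_alt)
    case (step c t u)
    then show ?case
      using assms(1)[OF that] V by (simp add: compose_bilinear subspace_add subspace_scale)
  qed (use V in \<open>simp add: compose_bilinear subspace_0\<close>)
  show ?thesis
    using x
  proof (induction rule: span_induct_alt)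
    case (step c t u)
    then show ?case
      using 1 V by (simp add: compose_bilinear subspace_add subspace_scale)
  qed (use V in \<open>simp add: compose_bilinear subspace_0\<close>)
qed

lemma linear_image_span_in:
  assumes "linear f" "\<And>s. s \<in> S \<Longrightarrow> f s \<in> V" "subspace V" "x \<in> span S"
  shows "f x \<in> V"
  using assms(4)
proof (induction rule: span_induct_alt)
  case (step c t u)
  then show ?case
    using assms(1-3) by (simp add: linear_add linear_scale subspace_add subspace_scale)
qed (use assms in \<open>simp add: linear_0 subspace_0\<close>)


section \<open>Star algebras, traces and conditional expectations\<close>

lemma star_subalgebraD:
  assumes "star_subalgebra R"
  shows "x \<in> R \<Longrightarrow> clinear_op x" "id_blinfun \<in> R" "x \<in> R \<Longrightarrow> y \<in> R \<Longrightarrow> x + y \<in> R"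
    "x \<in> R \<Longrightarrow> op_scale c x \<in> R" "x \<in> R \<Longrightarrow> y \<in> R \<Longrightarrow> x o\<^sub>L y \<in> R" "x \<in> R \<Longrightarrow> adj x \<in> R"
  using assms by (auto simp: star_subalgebra_def)

lemma star_subalgebra_subspace:
  assumes "star_subalgebra R"
  shows "subspace R"
proof -
  have "r *\<^sub>R x \<in> R" if "x \<in> R" for r x
    using star_subalgebraD(4)[OF assms that, of "complex_of_real r"] by (simp add: op_scale_real)
  moreover from this[OF star_subalgebraD(2)[OF assms], of 0] have "0 \<in> R"
    by simp
  ultimately show ?thesis
    using star_subalgebraD(3)[OF assms] by (auto simp: subspace_def)
qed

lemma star_subalgebra_Inter:
  "\<C> \<noteq> {} \<Longrightarrow> (\<And>R. R \<in> \<C> \<Longrightarrow> star_subalgebra R) \<Longrightarrow> star_subalgebra (\<Inter>\<C>)"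
  by (auto simp: star_subalgebra_def)

lemma star_subalgebra_Int: "star_subalgebra R \<Longrightarrow> star_subalgebra R' \<Longrightarrow> star_subalgebra (R \<inter> R')"
  by (auto simp: star_subalgebra_def)

text \<open>
  A member of the family whose intersection is the star algebra generated by a set of linear operators.
\<close>

lemma star_subalgebra_clinear_ops: "star_subalgebra {x. clinear_op x}"
  by (auto simp: star_subalgebra_def clinear_op_intros clinear_adj)

lemma star_subalgebra_hull:
  assumes "\<And>x. x \<in> S \<Longrightarrow> clinear_op x"
  shows "star_subalgebra (star_subalgebra hull S)"
  unfolding hull_def
proof (rule star_subalgebra_Inter)
  show "{t. star_subalgebra t \<and> S \<subseteq> t} \<noteq> {}"
    using star_subalgebra_clinear_ops assms by blast
qed blast

lemma commutant_mono: "S \<subseteq> T \<Longrightarrow> commutant T \<subseteq> commutant S"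
  by (auto simp: commutant_def)

lemma star_subalgebra_von_neumann_algebra:
  assumes "von_neumann_algebra M"
  shows "star_subalgebra M"
proof -
  have adj: "\<forall>x\<in>M. adj x \<in> M" and M: "commutant (commutant M) = M"
    using assms by (auto simp: von_neumann_algebra_def)
  have iff: "x \<in> M \<longleftrightarrow> clinear_op x \<and> (\<forall>y\<in>commutant M. y o\<^sub>L x = x o\<^sub>L y)" for x
    by (subst M[symmetric]) (simp add: commutant_def[of "commutant M"])
  have lin: "clinear_op y" if "y \<in> commutant M" for y
    using that by (simp add: commutant_def)
  show ?thesis
    unfolding star_subalgebra_def
  proof (intro conjI ballI allI)
    show "x o\<^sub>L y \<in> M" if "x \<in> M" "y \<in> M" for x y
      unfolding iff[of "x o\<^sub>L y"]
    proof (intro conjI ballI)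
      show "z o\<^sub>L (x o\<^sub>L y) = (x o\<^sub>L y) o\<^sub>L z" if "z \<in> commutant M" for z
        using \<open>x \<in> M\<close> \<open>y \<in> M\<close> that iff by (metis blinfun_compose_assoc)
    qed (use that iff in \<open>auto intro: clinear_op_intros\<close>)
    show "op_scale c x \<in> M" if "x \<in> M" for c x
      using that lin unfolding iff[of "op_scale c x"] iff[of x]
      by (auto simp: op_scale_compose_left op_scale_compose_right intro: clinear_op_intros)
    show "x + y \<in> M" if "x \<in> M" "y \<in> M" for x y
      using that unfolding iff[of "x + y"] iff[of x] iff[of y]
      by (auto simp: compose_bilinear intro: clinear_op_intros)
    show "id_blinfun \<in> M"
      unfolding iff[of id_blinfun] by (auto intro: clinear_op_intros blinfun_eqI)
  qed (use adj iff in auto)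
qed

lemma tracial_stateD:
  assumes "tracial_state M \<tau>"
  shows "x \<in> M \<Longrightarrow> y \<in> M \<Longrightarrow> \<tau> (x + y) = \<tau> x + \<tau> y"
    "x \<in> M \<Longrightarrow> \<tau> (op_scale c x) = c * \<tau> x"
    "\<tau> id_blinfun = 1" "x \<in> M \<Longrightarrow> \<tau> (adj x o\<^sub>L x) \<in> \<real>\<^sub>\<ge>\<^sub>0"
    "x \<in> M \<Longrightarrow> y \<in> M \<Longrightarrow> \<tau> (x o\<^sub>L y) = \<tau> (y o\<^sub>L x)"
    "x \<in> M \<Longrightarrow> \<tau> (r *\<^sub>R x) = of_real r * \<tau> x"
  using assms unfolding tracial_state_def op_scale_real[symmetric] by blast+

lemma trace_diff:
  assumes "star_subalgebra M" "tracial_state M \<tau>" "x \<in> M" "y \<in> M"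
  shows "\<tau> (x - y) = \<tau> x - \<tau> y"
  using tracial_stateD(1)[OF assms(2), of x "(-1) *\<^sub>R y"] tracial_stateD(6)[OF assms(2), of y "-1"]
    assms(3,4) subspace_neg[OF star_subalgebra_subspace[OF assms(1)]] by simp

lemma faithful_trace_zero:
  assumes "tracial_state M \<tau>" "faithful_on M \<tau>" "x \<in> M" "Re (\<tau> (adj x o\<^sub>L x)) = 0"
  shows "x = 0"
  using assms tracial_stateD(4)[OF assms(1,3)]
  by (simp add: faithful_on_def complex_nonneg_Reals_iff complex_eq_iff)

text \<open>
  Elements of an algebra with a faithful trace are determined by their pairings with the algebra:
  pair the difference with its own adjoint.
\<close>

lemma faithful_trace_nondegenerate:
  assumes M: "star_subalgebra M" "tracial_state M \<tau>" "faithful_on M \<tau>"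
    and x: "x \<in> M" and y: "y \<in> M" and eq: "\<And>a. a \<in> M \<Longrightarrow> \<tau> (x o\<^sub>L a) = \<tau> (y o\<^sub>L a)"
  shows "x = y"
proof -
  note M' = star_subalgebraD[OF M(1)]
  define z where "z = x - y"
  have z: "z \<in> M" "adj z \<in> M"
    using M' x y subspace_diff[OF star_subalgebra_subspace[OF M(1)]] by (auto simp: z_def)
  have "\<tau> (adj z o\<^sub>L z) = \<tau> (z o\<^sub>L adj z)"
    using tracial_stateD(5)[OF M(2)] z by simp
  also have "\<dots> = 0"
    using trace_diff[OF M(1,2), of "x o\<^sub>L adj z" "y o\<^sub>L adj z"] eq[OF z(2)] M' x y z(2)
    by (simp add: z_def compose_bilinear)
  finally have "z = 0"
    using M(3) z(1) unfolding faithful_on_def by blast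
  then show ?thesis
    by (simp add: z_def)
qed

lemma tracial_state_mono: "tracial_state M \<tau> \<Longrightarrow> N \<subseteq> M \<Longrightarrow> tracial_state N \<tau>"
  unfolding tracial_state_def by blast

lemma faithful_on_mono: "faithful_on M \<tau> \<Longrightarrow> N \<subseteq> M \<Longrightarrow> faithful_on N \<tau>"
  unfolding faithful_on_def by blast

lemma trace_cond_expD:
  assumes "trace_cond_exp \<tau> M N E"
  shows "x \<in> M \<Longrightarrow> E x \<in> N" "x \<in> N \<Longrightarrow> E x = x" "x \<in> M \<Longrightarrow> \<tau> (E x) = \<tau> x"
    "id_blinfun \<in> N \<Longrightarrow> x \<in> M \<Longrightarrow> a \<in> N \<Longrightarrow> E (a o\<^sub>L x) = a o\<^sub>L E x"
    "id_blinfun \<in> N \<Longrightarrow> x \<in> M \<Longrightarrow> a \<in> N \<Longrightarrow> E (x o\<^sub>L a) = E x o\<^sub>L a"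
proof -
  have 1: "\<And>x a b. x \<in> M \<Longrightarrow> a \<in> N \<Longrightarrow> b \<in> N \<Longrightarrow> E (a o\<^sub>L x o\<^sub>L b) = a o\<^sub>L E x o\<^sub>L b"
    using assms by (auto simp: trace_cond_exp_def)
  have id: "z o\<^sub>L id_blinfun = z" "id_blinfun o\<^sub>L z = z" for z :: "'a op"
    by (auto intro: blinfun_eqI)
  show "E (a o\<^sub>L x) = a o\<^sub>L E x" if "id_blinfun \<in> N" "x \<in> M" "a \<in> N"
    using 1[of x a id_blinfun] that by (simp add: id)
  show "E (x o\<^sub>L a) = E x o\<^sub>L a" if "id_blinfun \<in> N" "x \<in> M" "a \<in> N"
    using 1[of x id_blinfun a] that by (simp add: id)
qed (use assms in \<open>auto simp: trace_cond_exp_def\<close>)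

text \<open>
  The orthogonality relation behind the conditional expectation, in the form in which it is used: only
  pairings of \<open>x\<close> with \<open>N\<close> are seen by \<open>E x\<close>.
\<close>

lemma trace_cond_exp_trace:
  assumes "trace_cond_exp \<tau> M N E" "star_subalgebra N" "star_subalgebra M" "N \<subseteq> M" "x \<in> M" "a \<in> N"
  shows "\<tau> (a o\<^sub>L E x) = \<tau> (a o\<^sub>L x)" "\<tau> (E x o\<^sub>L a) = \<tau> (x o\<^sub>L a)"
proof -
  have "a o\<^sub>L x \<in> M" "x o\<^sub>L a \<in> M" "id_blinfun \<in> N"
    using assms(2-) by (auto intro: star_subalgebraD)
  then show "\<tau> (a o\<^sub>L E x) = \<tau> (a o\<^sub>L x)" "\<tau> (E x o\<^sub>L a) = \<tau> (x o\<^sub>L a)"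
    using trace_cond_expD[OF assms(1)] assms(5,6) by metis+
qed


section \<open>One step of the tower\<close>

lemma clinear_op_zero: "clinear_op (0 :: 'h::complex_hilbert op)"
  using clinear_op_intros(6)[OF clinear_op_intros(1), of 0] by simp

lemma adj_zero: "adj 0 = (0 :: 'h::complex_hilbert op)"
  by (rule adj_eqI) simp

lemma star_subalgebra_span:
  assumes S: "\<And>x. x \<in> S \<Longrightarrow> clinear_op x" "id_blinfun \<in> S"
    "\<And>c x. x \<in> S \<Longrightarrow> op_scale c x \<in> span S" "\<And>x. x \<in> S \<Longrightarrow> adj x \<in> span S"
    "\<And>x y. x \<in> S \<Longrightarrow> y \<in> S \<Longrightarrow> x o\<^sub>L y \<in> span S"
  shows "star_subalgebra (span S)"
proof -
  have clin: "clinear_op x \<and> adj x \<in> span S" if "x \<in> span S" for x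
    using that
  proof (induction rule: span_induct_alt)
    case base
    show ?case
      by (simp add: span_zero clinear_op_zero adj_zero)
  next
    case (step c x y)
    have "adj (c *\<^sub>R x) = c *\<^sub>R adj x"
      using adj_scale[OF S(1)[OF step(1)], of "complex_of_real c"] by (simp add: op_scale_real)
    then show ?case
      using step S by (simp add: clinear_op_intros adj_add span_add span_scale)
  qed
  show ?thesis
    unfolding star_subalgebra_def
  proof (intro conjI ballI allI)
    show "op_scale c x \<in> span S" if "x \<in> span S" for c x
      by (rule linear_image_span_in[OF linear_op_scale S(3) subspace_span that])
    show "x o\<^sub>L y \<in> span S" if "x \<in> span S" "y \<in> span S" for x y
      by (rule span_compose_in[OF S(5) subspace_span that])
  qed (use clin S in \<open>auto intro: span_add span_base\<close>)
qed

text \<open>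
  The relations of the basic construction are checked on \<open>L\<^sup>2(M)\<close>, where \<open>e\<close> acts as \<open>E\<close> and \<open>M\<close> by left
  multiplication, and pulled back through the faithful representation \<open>\<phi>\<close>. The last relation expresses
  that the unit is a cyclic vector: \<open>\<phi>(y x e)\<close> maps \<open>1\<close> to \<open>\<phi>(y) x\<close>.
\<close>

lemma basic_construction_relations:
  assumes bc: "basic_construction \<tau> N M e R"
    and N: "star_subalgebra N" and M: "star_subalgebra M" and NM: "N \<subseteq> M"
  obtains E where "star_subalgebra R" "M \<subseteq> R" "e \<in> R" "adj e = e" "e o\<^sub>L e = e"
    "trace_cond_exp \<tau> M N E"
    "\<And>a. a \<in> N \<Longrightarrow> e o\<^sub>L a = a o\<^sub>L e"
    "\<And>x. x \<in> M \<Longrightarrow> e o\<^sub>L x o\<^sub>L e = E x o\<^sub>L e"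
    "\<And>y. y \<in> R \<Longrightarrow> (\<And>x. x \<in> M \<Longrightarrow> y o\<^sub>L x o\<^sub>L e = 0) \<Longrightarrow> y = 0"
proof -
  have e: "clinear_op e" "adj e = e" "e o\<^sub>L e = e" and R: "R = star_subalgebra hull (insert e M)"
    using bc by (auto simp: basic_construction_def is_projection_def)
  from bc obtain E \<phi> where E: "trace_cond_exp \<tau> M N E" and \<phi>:
      "\<forall>x\<in>R. \<forall>x'\<in>R. \<forall>y\<in>M. \<phi> (x + x') y = \<phi> x y + \<phi> x' y"
      "\<forall>c. \<forall>x\<in>R. \<forall>y\<in>M. \<phi> (op_scale c x) y = op_scale c (\<phi> x y)"
      "\<forall>x\<in>R. \<forall>x'\<in>R. \<forall>y\<in>M. \<phi> (x o\<^sub>L x') y = \<phi> x (\<phi> x' y)"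
      "\<forall>x\<in>R. (\<forall>y\<in>M. \<phi> x y = 0) \<longrightarrow> x = 0"
      "\<forall>a\<in>M. \<forall>y\<in>M. \<phi> a y = a o\<^sub>L y" "\<forall>y\<in>M. \<phi> e y = E y"
    unfolding basic_construction_def by (elim conjE exE) (rule that; assumption)
  note \<phi>add = \<phi>(1)[rule_format] and \<phi>scale = \<phi>(2)[rule_format] and \<phi>mult = \<phi>(3)[rule_format]
    and \<phi>inj = \<phi>(4)[THEN bspec, THEN mp] and \<phi>M = \<phi>(5)[rule_format] and \<phi>e = \<phi>(6)[rule_format]
  have Rs: "star_subalgebra R"
    unfolding R by (rule star_subalgebra_hull) (use e M in \<open>auto intro: star_subalgebraD\<close>)
  note R' = star_subalgebraD[OF Rs] and M' = star_subalgebraD[OF M] and N' = star_subalgebraD[OF N]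
  have sub: "M \<subseteq> R" "e \<in> R"
    unfolding R using hull_subset[of "insert e M" star_subalgebra] by auto
  have eqI: "x = x'" if "x \<in> R" "x' \<in> R" "\<And>y. y \<in> M \<Longrightarrow> \<phi> x y = \<phi> x' y" for x x'
  proof -
    have m: "op_scale (-1) z = - z" for z :: "'a op"
      using op_scale_real[of "-1" z] by simp
    have "x + op_scale (-1) x' = 0"
    proof (rule \<phi>inj)
      show "\<forall>y\<in>M. \<phi> (x + op_scale (-1) x') y = 0"
        using that \<phi>add[of x "op_scale (-1) x'"] \<phi>scale[of x' _ "-1"] R'(4)[of x' "-1"]
        by (simp add: m)
    qed (use that R' in blast)
    then show ?thesis
      by (simp add: m)
  qed
  have EM: "E x \<in> M" "E x \<in> N" if "x \<in> M" for x
    using trace_cond_expD(1)[OF E that] NM by auto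
  have comm: "e o\<^sub>L a = a o\<^sub>L e" if a: "a \<in> N" for a
  proof (rule eqI)
    show "\<phi> (e o\<^sub>L a) y = \<phi> (a o\<^sub>L e) y" if y: "y \<in> M" for y
    proof -
      have "\<phi> (e o\<^sub>L a) y = E (a o\<^sub>L y)"
        using a y sub NM M'(5)[of a y] by (simp add: \<phi>mult \<phi>M \<phi>e subset_iff)
      also have "\<dots> = a o\<^sub>L E y"
        by (rule trace_cond_expD(4)[OF E]) (use N' a y in auto)
      also have "\<dots> = \<phi> (a o\<^sub>L e) y"
        using a y sub NM EM(1)[OF y] by (simp add: \<phi>mult \<phi>M \<phi>e subset_iff)
      finally show ?thesis .
    qed
  qed (use a sub NM R' in auto)
  have exe: "e o\<^sub>L x o\<^sub>L e = E x o\<^sub>L e" if x: "x \<in> M" for x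
  proof (rule eqI)
    have xR: "x \<in> R" "E x \<in> R" "e o\<^sub>L x \<in> R"
      using x sub EM R' by auto
    show "\<phi> (e o\<^sub>L x o\<^sub>L e) y = \<phi> (E x o\<^sub>L e) y" if y: "y \<in> M" for y
    proof -
      have "\<phi> (e o\<^sub>L x o\<^sub>L e) y = E (x o\<^sub>L E y)"
        using x y xR sub EM(1)[OF y] M'(5)[of x "E y"] by (simp add: \<phi>mult \<phi>M \<phi>e)
      also have "\<dots> = E x o\<^sub>L E y"
        by (rule trace_cond_expD(5)[OF E]) (use N' x y EM in auto)
      also have "\<dots> = \<phi> (E x o\<^sub>L e) y"
        using x y xR sub EM by (simp add: \<phi>mult \<phi>M \<phi>e)
      finally show ?thesis .
    qed
    show "e o\<^sub>L x o\<^sub>L e \<in> R" "E x o\<^sub>L e \<in> R"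
      using xR sub R' by auto
  qed
  have sep: "y = 0" if y: "y \<in> R" "\<And>x. x \<in> M \<Longrightarrow> y o\<^sub>L x o\<^sub>L e = 0" for y
  proof (rule \<phi>inj[OF y(1)], intro ballI)
    fix x assume x: "x \<in> M"
    have id: "id_blinfun \<in> M" "E id_blinfun = id_blinfun" "x o\<^sub>L id_blinfun = x"
      using M' N' trace_cond_expD(2)[OF E] by (auto intro: blinfun_eqI)
    have "\<phi> (y o\<^sub>L x o\<^sub>L e) id_blinfun = \<phi> y x"
      using y(1) x id sub R'(5)[of y x] by (simp add: \<phi>mult \<phi>M \<phi>e subset_iff)
    moreover have "\<phi> 0 id_blinfun = 0"
      using \<phi>add[of 0 0 id_blinfun] id subspace_0[OF star_subalgebra_subspace[OF Rs]] by simp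
    ultimately show "\<phi> y x = 0"
      using y(2)[OF x] by simp
  qed
  show ?thesis
    by (rule that[of E]) (use Rs sub e E comm exe sep in auto)
qed

text \<open>
  One step \<open>N \<subseteq> M \<subseteq> R = \<langle>M, e\<rangle>\<close> of the tower, reduced to the relations between the algebras, the
  Jones projection and the Markov trace, so that the representation \<open>\<phi>\<close> no longer appears.
\<close>

locale jones_step =
  fixes \<tau> :: "'k::complex_hilbert op \<Rightarrow> complex" and \<beta> :: real and N M R :: "'k op set" and e E
  assumes algebras: "star_subalgebra N" "star_subalgebra M" "star_subalgebra R" "N \<subseteq> M" "M \<subseteq> R"
    and R_eq: "R = star_subalgebra hull (insert e M)"
    and e: "e \<in> R" "adj e = e" "e o\<^sub>L e = e"
    and E: "trace_cond_exp \<tau> M N E"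
    and e_commutes: "\<And>a. a \<in> N \<Longrightarrow> e o\<^sub>L a = a o\<^sub>L e"
    and e_implements: "\<And>x. x \<in> M \<Longrightarrow> e o\<^sub>L x o\<^sub>L e = E x o\<^sub>L e"
    and e_separates: "\<And>y. y \<in> R \<Longrightarrow> (\<And>x. x \<in> M \<Longrightarrow> y o\<^sub>L x o\<^sub>L e = 0) \<Longrightarrow> y = 0"
    and trace: "tracial_state R \<tau>" "faithful_on R \<tau>"
    and markov: "\<beta> > 0" "\<And>x. x \<in> M \<Longrightarrow> of_real \<beta> * \<tau> (x o\<^sub>L e) = \<tau> x"
begin

lemmas N' = star_subalgebraD[OF algebras(1)]
  and M' = star_subalgebraD[OF algebras(2)]
  and R' = star_subalgebraD[OF algebras(3)]

lemma M_in_R: "x \<in> M \<Longrightarrow> x \<in> R"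
  using algebras(5) by blast

lemma id_compose [simp]: "id_blinfun o\<^sub>L x = x" "x o\<^sub>L id_blinfun = (x :: 'k op)"
  by (auto intro: blinfun_eqI)

definition e_span :: "'k op set \<Rightarrow> 'k op set" where
  "e_span D = span {x o\<^sub>L e o\<^sub>L y | x y. x \<in> D \<and> y \<in> D}"

lemma e_span_base: "x \<in> D \<Longrightarrow> y \<in> D \<Longrightarrow> x o\<^sub>L e o\<^sub>L y \<in> e_span D"
  unfolding e_span_def by (rule span_base) blast

lemma e_span_M_subset: "e_span M \<subseteq> R"
  unfolding e_span_def
  by (rule span_minimal)
     (auto simp: R'(5) e(1) M_in_R intro: star_subalgebra_subspace[OF algebras(3)])

lemma e_span_M_adj: "adj x \<in> e_span M" "op_scale c x \<in> e_span M" if "x \<in> e_span M" for x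
proof -
  have "adj x \<in> e_span M \<and> x \<in> R"
    using that unfolding e_span_def
  proof (induction rule: span_induct_alt)
    case base
    show ?case
      using subspace_0[OF star_subalgebra_subspace[OF algebras(3)]] by (simp add: span_zero adj_zero)
  next
    case (step r z u)
    then obtain x y where xy: "z = x o\<^sub>L e o\<^sub>L y" "x \<in> M" "y \<in> M"
      by blast
    then have mem: "x \<in> R" "y \<in> R" "x o\<^sub>L e \<in> R" "z \<in> R" "r *\<^sub>R z \<in> R"
      unfolding xy using xy(2,3)
      by (simp_all add: R'(5) e(1) M_in_R subspace_scale[OF star_subalgebra_subspace[OF algebras(3)]])
    have "adj z = adj y o\<^sub>L e o\<^sub>L adj x"
      using mem R'(1) e(1,2) by (simp add: xy adj_compose) (simp add: blinfun_compose_assoc)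
    then have "adj z \<in> e_span M"
      using xy M' by (simp add: e_span_base)
    moreover have "adj (r *\<^sub>R z + u) = r *\<^sub>R adj z + adj u"
      using mem R'(1) step adj_scale[of z "complex_of_real r"]
      by (simp add: adj_add op_scale_real)
    ultimately show ?case
      using step mem R' by (simp add: e_span_def span_add span_scale)
  qed
  then show "adj x \<in> e_span M"
    by blast
  show "op_scale c x \<in> e_span M"
    using linear_op_scale _ _ that[unfolded e_span_def]
  proof (rule linear_image_span_in)
    fix z assume "z \<in> {x o\<^sub>L e o\<^sub>L y |x y. x \<in> M \<and> y \<in> M}"
    then obtain x y where "z = x o\<^sub>L e o\<^sub>L y" "x \<in> M" "y \<in> M"
      by blast
    then show "op_scale c z \<in> e_span M"
      using e_span_base[of "op_scale c x" M y] M' by (simp add: op_scale_compose_left)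
  qed (simp add: e_span_def)
qed

text \<open>
  The elements that multiply the span of \<open>M e M\<close> into itself form a star algebra containing \<open>M\<close> and, by
  \<open>e x e = E(x) e\<close>, also \<open>e\<close>.
\<close>

lemma e_span_M_ideal:
  assumes "y \<in> R" "j \<in> e_span M"
  shows "y o\<^sub>L j \<in> e_span M" "j o\<^sub>L y \<in> e_span M"
proof -
  define X where "X = {y\<in>R. \<forall>j\<in>e_span M. y o\<^sub>L j \<in> e_span M \<and> j o\<^sub>L y \<in> e_span M}"
  have sub: "subspace (e_span M)"
    by (simp add: e_span_def)
  have X: "star_subalgebra X"
    unfolding star_subalgebra_def
  proof (intro conjI ballI allI)
    show "x + y \<in> X" if "x \<in> X" "y \<in> X" for x y
      using that R' sub by (auto simp: X_def compose_bilinear intro: subspace_add)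
    show "op_scale c x \<in> X" if "x \<in> X" for c x
    proof -
      have "clinear_op j" if "j \<in> e_span M" for j
        using that e_span_M_subset R' by blast
      then show ?thesis
        using that R' e_span_M_adj(2)
        by (auto simp: X_def op_scale_compose_left op_scale_compose_right)
    qed
    show "x o\<^sub>L y \<in> X" if "x \<in> X" "y \<in> X" for x y
      using that R' by (auto simp: X_def blinfun_compose_assoc)
         (metis blinfun_compose_assoc)
    show "adj x \<in> X" if x: "x \<in> X" for x
    proof -
      have "adj x o\<^sub>L j = adj (adj j o\<^sub>L x)" "j o\<^sub>L adj x = adj (x o\<^sub>L adj j)" if "j \<in> e_span M" for j
        using that x e_span_M_subset R'(1)
        by (auto simp: X_def adj_compose adj_adj clinear_adj subset_iff)
      then show ?thesis
        using x R' e_span_M_adj(1) by (auto simp: X_def)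
    qed
  qed (auto simp: X_def R')
  have gen: "y o\<^sub>L j \<in> e_span M \<and> j o\<^sub>L y \<in> e_span M"
    if y: "y \<in> insert e M" and j: "j \<in> e_span M" for y j
  proof -
    have l: "y o\<^sub>L z \<in> e_span M" and r: "z o\<^sub>L y \<in> e_span M"
      if "z \<in> {x o\<^sub>L e o\<^sub>L y | x y. x \<in> M \<and> y \<in> M}" for z
    proof -
      obtain a b where ab: "z = a o\<^sub>L e o\<^sub>L b" "a \<in> M" "b \<in> M"
        using \<open>z \<in> _\<close> by blast
      have EM: "E a \<in> M" "E b \<in> M"
        using ab trace_cond_expD(1)[OF E] algebras by auto
      have 1: "e o\<^sub>L z = E a o\<^sub>L e o\<^sub>L b" "z o\<^sub>L e = (a o\<^sub>L E b) o\<^sub>L e o\<^sub>L id_blinfun"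
        using e_implements ab by (simp_all add: blinfun_compose_assoc[symmetric])
           (simp add: blinfun_compose_assoc e_implements[symmetric])
      have 2: "m o\<^sub>L z = (m o\<^sub>L a) o\<^sub>L e o\<^sub>L b" "z o\<^sub>L m = a o\<^sub>L e o\<^sub>L (b o\<^sub>L m)" for m
        by (simp_all add: ab blinfun_compose_assoc)
      have "y o\<^sub>L z \<in> e_span M \<and> z o\<^sub>L y \<in> e_span M"
      proof (cases "y = e")
        case True
        then show ?thesis
          using e_span_base[OF EM(1) ab(3)] e_span_base[OF M'(5)[OF ab(2) EM(2)] M'(2)] 1 by metis
      next
        case False
        then have "y \<in> M"
          using y by blast
        then show ?thesis
          using e_span_base[OF M'(5)[OF _ ab(2)] ab(3)] e_span_base[OF ab(2) M'(5)[OF ab(3)]] 2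
          by metis
      qed
      then show "y o\<^sub>L z \<in> e_span M" "z o\<^sub>L y \<in> e_span M"
        by blast+
    qed
    show ?thesis
      using span_compose_in[of "{y}" "{x o\<^sub>L e o\<^sub>L y | x y. x \<in> M \<and> y \<in> M}", OF _ sub _ j[unfolded e_span_def]]
        span_compose_in[of "{x o\<^sub>L e o\<^sub>L y | x y. x \<in> M \<and> y \<in> M}" "{y}", OF _ sub j[unfolded e_span_def]]
        l r span_base[of y "{y}"] by blast
  qed
  have "insert e M \<subseteq> X"
    using gen algebras e by (auto simp: X_def)
  then have "R \<subseteq> X"
    unfolding R_eq by (rule hull_minimal) fact
  then show "y o\<^sub>L j \<in> e_span M" "j o\<^sub>L y \<in> e_span M"
    using assms by (auto simp: X_def)
qed

lemma e_span_M_finite: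
  assumes "finite F" "M = span F"
  shows "\<exists>G. finite G \<and> e_span M = span G"
proof -
  define G where "G = (\<lambda>(x, y). x o\<^sub>L e o\<^sub>L y) ` (F \<times> F)"
  have "x o\<^sub>L e o\<^sub>L y \<in> span G" if "x \<in> M" "y \<in> M" for x y
  proof (rule span_compose_in[OF _ subspace_span _ that(2)[unfolded assms(2)]])
    show "x o\<^sub>L e \<in> span ((\<lambda>x. x o\<^sub>L e) ` F)"
      using that(1) unfolding assms(2)
      by (rule linear_image_span_in[rotated -1])
         (auto intro!: linearI span_base simp: compose_bilinear)
  qed (auto simp: G_def intro!: span_base)
  then have "{x o\<^sub>L e o\<^sub>L y | x y. x \<in> M \<and> y \<in> M} \<subseteq> span G"
    by blast
  moreover have "finite G"
    using assms by (simp add: G_def)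
  ultimately obtain H where "finite H" "span {x o\<^sub>L e o\<^sub>L y | x y. x \<in> M \<and> y \<in> M} = span H"
    by (rule finite_span_of_subset)
  then show ?thesis
    unfolding e_span_def by blast
qed

text \<open>
  The span \<open>J\<close> of \<open>M e M\<close> is an ideal, so it suffices that it contains the unit. Otherwise some functional
  \<open>x \<mapsto> Re \<tau>(y x)\<close> vanishes on the finite-dimensional space \<open>J\<close> but not at \<open>1\<close>. For \<open>j \<in> J\<close> the element
  \<open>j (y j)\<^sup>*\<close> lies in \<open>J\<close>, hence \<open>\<tau>((y j)\<^sup>* (y j)) = \<tau>(y j (y j)\<^sup>*)\<close> vanishes and \<open>y j = 0\<close>. In particular
  \<open>y x e = 0\<close> for all \<open>x \<in> M\<close>, so \<open>y = 0\<close>, a contradiction.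
\<close>

lemma e_span_M_eq:
  assumes F: "finite F" "M = span F"
  shows "R = e_span M"
proof -
  obtain G where G: "finite G" "e_span M = span G"
    using e_span_M_finite[OF F] by blast
  have "id_blinfun \<in> e_span M"
  proof (rule ccontr)
    assume "id_blinfun \<notin> e_span M"
    define L where "L = {f. \<exists>y\<in>R. \<forall>x\<in>R. f x = Re (\<tau> (y o\<^sub>L x))}"
    note Rsub = star_subalgebra_subspace[OF algebras(3)]
    have "\<exists>f\<in>L. (\<forall>x\<in>span G. f x = 0) \<and> f id_blinfun \<noteq> 0"
    proof (rule functional_separates_from_finite_span[OF Rsub])
      show "f (x + y) = f x + f y" if "f \<in> L" "x \<in> R" "y \<in> R" for f x y
        using that R' tracial_stateD(1)[OF trace(1)] by (auto simp: L_def compose_bilinear)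
      show "f (r *\<^sub>R x) = r * f x" if "f \<in> L" "x \<in> R" for f r x
        using that R' tracial_stateD(6)[OF trace(1)] subspace_scale[OF Rsub]
        by (auto simp: L_def compose_bilinear)
      show "(\<lambda>x. f x - c * g x) \<in> L" if "f \<in> L" "g \<in> L" for f g c
      proof -
        obtain y z where yz: "y \<in> R" "z \<in> R" "\<forall>x\<in>R. f x = Re (\<tau> (y o\<^sub>L x))"
          "\<forall>x\<in>R. g x = Re (\<tau> (z o\<^sub>L x))"
          using \<open>f \<in> L\<close> \<open>g \<in> L\<close> by (auto simp: L_def)
        have "y - c *\<^sub>R z \<in> R"
          using yz Rsub by (simp add: subspace_diff subspace_scale)
        moreover have "f x - c * g x = Re (\<tau> ((y - c *\<^sub>R z) o\<^sub>L x))" if "x \<in> R" for x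
          using yz that R' trace_diff[OF algebras(3) trace(1), of "y o\<^sub>L x" "c *\<^sub>R (z o\<^sub>L x)"]
            tracial_stateD(6)[OF trace(1), of "z o\<^sub>L x" c] subspace_scale[OF Rsub]
          by (simp add: compose_bilinear)
        ultimately show ?thesis
          by (auto simp: L_def)
      qed
      show "\<exists>f\<in>L. f x \<noteq> 0" if x: "x \<in> R" "x \<noteq> 0" for x
      proof -
        have "Re (\<tau> (adj x o\<^sub>L x)) \<noteq> 0"
          using faithful_trace_zero[OF trace x(1)] x(2) by blast
        then show ?thesis
          using R'(6)[OF x(1)] by (intro bexI[of _ "\<lambda>z. Re (\<tau> (adj x o\<^sub>L z))"]) (auto simp: L_def)
      qed
      show "G \<subseteq> R"
        using G e_span_M_subset span_superset by blast
      show "id_blinfun \<notin> span G"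
        using \<open>id_blinfun \<notin> e_span M\<close> G by simp
    qed (use G R' in auto)
    then obtain f y where y: "y \<in> R" "\<And>x. x \<in> R \<Longrightarrow> f x = Re (\<tau> (y o\<^sub>L x))"
      and f: "\<And>x. x \<in> e_span M \<Longrightarrow> f x = 0" "f id_blinfun \<noteq> 0"
      unfolding G(2) L_def by blast
    have "y o\<^sub>L j = 0" if j: "j \<in> e_span M" for j
    proof (rule faithful_trace_zero[OF trace])
      have jR: "j \<in> R" "adj j \<in> R" "y o\<^sub>L j \<in> R" "adj (y o\<^sub>L j) \<in> R"
        using j e_span_M_subset R' y by auto
      show "y o\<^sub>L j \<in> R"
        by fact
      have "\<tau> (adj (y o\<^sub>L j) o\<^sub>L (y o\<^sub>L j)) = \<tau> (y o\<^sub>L (j o\<^sub>L adj (y o\<^sub>L j)))"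
        using tracial_stateD(5)[OF trace(1) jR(4,3)] by (simp add: blinfun_compose_assoc)
      moreover have "j o\<^sub>L adj (y o\<^sub>L j) \<in> e_span M"
        using e_span_M_ideal(2)[OF jR(4) j] .
      ultimately show "Re (\<tau> (adj (y o\<^sub>L j) o\<^sub>L (y o\<^sub>L j))) = 0"
        using f(1) y(2) e_span_M_subset by (metis subsetD)
    qed
    then have "y o\<^sub>L x o\<^sub>L e = 0" if "x \<in> M" for x
      using e_span_base[OF that M'(2)] by (simp add: blinfun_compose_assoc)
    then have "y = 0"
      using e_separates y by blast
    then have "f id_blinfun = f 0"
      using y R'(2) subspace_0[OF star_subalgebra_subspace[OF algebras(3)]] by (simp add: compose_bilinear)
    also have "\<dots> = 0"
      by (rule f(1)) (simp add: e_span_def span_zero)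
    finally show False
      using f by simp
  qed
  then have "x \<in> e_span M" if "x \<in> R" for x
    using e_span_M_ideal(1)[OF that, of id_blinfun] by simp
  then show ?thesis
    using e_span_M_subset by blast
qed

end


text \<open>
  A nondegenerate commuting square \<open>(L \<subseteq> N, D \<subseteq> M)\<close> below a step of the tower. The commuting square
  condition appears as a statement about the trace alone: the element \<open>d'\<close> is the expectation of \<open>d\<close> onto
  \<open>N\<close>, and it has to lie in \<open>L\<close>. In this form it composes along the tower without expectations onto the
  smaller algebras. The aim is the square \<open>(D \<subseteq> M, R\<^sub>D \<subseteq> R)\<close>.
\<close>

locale jones_step_square = jones_step +
  fixes L D R\<^sub>D :: "'a op set"
  assumes sub: "star_subalgebra L" "star_subalgebra D" "L \<subseteq> D" "L \<subseteq> N" "D \<subseteq> M"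
    and R\<^sub>D: "R\<^sub>D = star_subalgebra hull (insert e D)"
    and commuting: "\<And>d. d \<in> D \<Longrightarrow> \<exists>d'\<in>L. \<forall>a\<in>N. \<tau> (d o\<^sub>L a) = \<tau> (d' o\<^sub>L a)"
    and nondegenerate: "M = span {d o\<^sub>L a | d a. d \<in> D \<and> a \<in> N}"
begin

lemma star_subalgebra_R\<^sub>D: "star_subalgebra R\<^sub>D"
  unfolding R\<^sub>D by (rule star_subalgebra_hull) (use sub e R' in \<open>auto intro: star_subalgebraD\<close>)

lemma R\<^sub>D_subset: "insert e D \<subseteq> R\<^sub>D" "R\<^sub>D \<subseteq> R"
proof -
  show "insert e D \<subseteq> R\<^sub>D"
    unfolding R\<^sub>D by (rule hull_subset)
  show "R\<^sub>D \<subseteq> R"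
    unfolding R\<^sub>D by (rule hull_minimal) (use sub algebras e in auto)
qed

lemma E_maps_D: "d \<in> D \<Longrightarrow> E d \<in> L"
proof -
  assume d: "d \<in> D"
  obtain d' where d': "d' \<in> L" "\<And>a. a \<in> N \<Longrightarrow> \<tau> (d o\<^sub>L a) = \<tau> (d' o\<^sub>L a)"
    using commuting[OF d] by blast
  have "E d = d'"
  proof (rule faithful_trace_nondegenerate[of N])
    show "tracial_state N \<tau>" "faithful_on N \<tau>"
      using trace algebras tracial_state_mono faithful_on_mono by blast+
    show "E d \<in> N"
      using trace_cond_expD(1)[OF E] d sub by blast
    show "\<tau> (E d o\<^sub>L a) = \<tau> (d' o\<^sub>L a)" if "a \<in> N" for a
      using trace_cond_exp_trace(2)[OF E algebras(1,2,4) _ that] d'(2)[OF that] d sub by (metis subsetD)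
  qed (use d' sub algebras in auto)
  then show ?thesis
    using d' by simp
qed

text \<open>
  Since \<open>E\<close> maps \<open>D\<close> into \<open>L \<subseteq> D\<close>, a product \<open>(x e y)(z e w) = x E(y z) e w\<close> of two generators is again of the
  form \<open>x e y\<close> with entries in \<open>D\<close>.
\<close>

lemma R\<^sub>D_span: "R\<^sub>D \<subseteq> span (D \<union> {x o\<^sub>L e o\<^sub>L y | x y. x \<in> D \<and> y \<in> D})"
  unfolding R\<^sub>D
proof (rule hull_minimal)
  let ?G = "D \<union> {x o\<^sub>L e o\<^sub>L y | x y. x \<in> D \<and> y \<in> D}"
  note D' = star_subalgebraD[OF sub(2)]
  have mem: "x o\<^sub>L e o\<^sub>L y \<in> span ?G" if "x \<in> D" "y \<in> D" for x y
    using that by (intro span_base) blast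
  have lin: "clinear_op x" if "x \<in> D" for x
    using that D' by blast
  have elin: "clinear_op e"
    using e R' by blast
  show "star_subalgebra (span ?G)"
  proof (rule star_subalgebra_span)
    show "clinear_op x" if "x \<in> ?G" for x
      using that lin elin by (auto intro: clinear_op_intros)
    show "op_scale c x \<in> span ?G" if "x \<in> ?G" for c x
    proof (cases "x \<in> D")
      case False
      then obtain a b where ab: "x = a o\<^sub>L e o\<^sub>L b" "a \<in> D" "b \<in> D"
        using \<open>x \<in> ?G\<close> by blast
      then have "op_scale c x = op_scale c a o\<^sub>L e o\<^sub>L b"
        by (simp add: op_scale_compose_left)
      then show ?thesis
        using mem[OF D'(4)[OF ab(2)] ab(3)] by simp
    qed (use D' in \<open>auto intro: span_base\<close>)
    show "adj x \<in> span ?G" if "x \<in> ?G" for x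
    proof (cases "x \<in> D")
      case False
      then obtain a b where ab: "x = a o\<^sub>L e o\<^sub>L b" "a \<in> D" "b \<in> D"
        using \<open>x \<in> ?G\<close> by blast
      then have "adj x = adj b o\<^sub>L e o\<^sub>L adj a"
        using lin elin e by (simp add: adj_compose clinear_op_intros blinfun_compose_assoc)
      then show ?thesis
        using mem[OF D'(6)[OF ab(3)] D'(6)[OF ab(2)]] by simp
    qed (use D' in \<open>auto intro: span_base\<close>)
    show "x o\<^sub>L y \<in> span ?G" if x: "x \<in> ?G" and y: "y \<in> ?G" for x y
    proof -
      have eD: "\<exists>a\<in>D. \<exists>b\<in>D. z = a o\<^sub>L e o\<^sub>L b" if "z \<in> ?G" "z \<notin> D" for z
        using that by blast
      show ?thesis
      proof (cases "x \<in> D"; cases "y \<in> D")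
        assume xy: "x \<in> D" "y \<notin> D"
        then obtain c d where cd: "c \<in> D" "d \<in> D" "y = c o\<^sub>L e o\<^sub>L d"
          using eD[OF y] by blast
        have "x o\<^sub>L y = (x o\<^sub>L c) o\<^sub>L e o\<^sub>L d"
          by (simp add: cd blinfun_compose_assoc)
        then show ?thesis
          using mem[OF D'(5)[OF xy(1) cd(1)] cd(2)] by simp
      next
        assume xy: "x \<notin> D" "y \<in> D"
        then obtain a b where ab: "a \<in> D" "b \<in> D" "x = a o\<^sub>L e o\<^sub>L b"
          using eD[OF x] by blast
        have "x o\<^sub>L y = a o\<^sub>L e o\<^sub>L (b o\<^sub>L y)"
          by (simp add: ab blinfun_compose_assoc)
        then show ?thesis
          using mem[OF ab(1) D'(5)[OF ab(2) xy(2)]] by simp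
      next
        assume xy: "x \<notin> D" "y \<notin> D"
        obtain a b where ab: "a \<in> D" "b \<in> D" "x = a o\<^sub>L e o\<^sub>L b"
          using eD[OF x xy(1)] by blast
        obtain c d where cd: "c \<in> D" "d \<in> D" "y = c o\<^sub>L e o\<^sub>L d"
          using eD[OF y xy(2)] by blast
        have bc: "b o\<^sub>L c \<in> D" "b o\<^sub>L c \<in> M"
          using ab cd D' sub by auto
        have "x o\<^sub>L y = a o\<^sub>L (e o\<^sub>L (b o\<^sub>L c) o\<^sub>L e) o\<^sub>L d"
          by (simp add: ab cd blinfun_compose_assoc)
        also have "\<dots> = (a o\<^sub>L E (b o\<^sub>L c)) o\<^sub>L e o\<^sub>L d"
          by (simp only: e_implements[OF bc(2)]) (simp add: blinfun_compose_assoc)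
        finally show ?thesis
          using mem[OF D'(5)[OF ab(1) subsetD[OF sub(3) E_maps_D[OF bc(1)]]] cd(2)] by simp
      qed (use D' in \<open>auto intro: span_base\<close>)
    qed
  qed (use D' in auto)
  have "e \<in> span ?G"
    using mem[OF D'(2) D'(2)] by simp
  then show "insert e D \<subseteq> span ?G"
    by (auto intro: span_base)
qed

text \<open>
  By the Markov property the expectation of \<open>x e y\<close> onto \<open>M\<close> is \<open>\<beta>\<^sup>-\<^sup>1 x y\<close>, which lies in \<open>D\<close> together
  with \<open>x\<close> and \<open>y\<close>.
\<close>

lemma next_commuting:
  assumes "d \<in> R\<^sub>D"
  shows "\<exists>d'\<in>D. \<forall>a\<in>M. \<tau> (d o\<^sub>L a) = \<tau> (d' o\<^sub>L a)"
proof -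
  note D' = star_subalgebraD[OF sub(2)] and Dsub = star_subalgebra_subspace[OF sub(2)]
    and Rsub = star_subalgebra_subspace[OF algebras(3)]
  have gen: "\<exists>d'\<in>D. \<forall>a\<in>M. \<tau> (d o\<^sub>L a) = \<tau> (d' o\<^sub>L a)"
    if "d \<in> D \<union> {x o\<^sub>L e o\<^sub>L y | x y. x \<in> D \<and> y \<in> D}" for d
  proof (cases "d \<in> D")
    case False
    then obtain x y where xy: "x \<in> D" "y \<in> D" "d = x o\<^sub>L e o\<^sub>L y"
      using \<open>d \<in> _\<close> by blast
    show ?thesis
    proof (intro bexI ballI)
      show xyD: "(1 / \<beta>) *\<^sub>R (x o\<^sub>L y) \<in> D"
        using xy D' Dsub by (auto intro: subspace_scale)
      fix a assume a: "a \<in> M"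
      have mem: "x \<in> M" "y \<in> M" "x \<in> R" "y \<in> R" "a \<in> R" "y o\<^sub>L a \<in> M" "y o\<^sub>L a \<in> R"
        "y o\<^sub>L a o\<^sub>L x \<in> M" "x o\<^sub>L (y o\<^sub>L a) \<in> R" "x o\<^sub>L e \<in> R"
        using xy(1,2) a
        by (simp_all add: R'(5) M'(5) e(1) M_in_R subsetD[OF sub(5)])
      have "\<tau> (d o\<^sub>L a) = \<tau> ((x o\<^sub>L e) o\<^sub>L (y o\<^sub>L a))"
        by (simp add: xy blinfun_compose_assoc)
      also have "\<dots> = \<tau> ((y o\<^sub>L a o\<^sub>L x) o\<^sub>L e)"
        using tracial_stateD(5)[OF trace(1) mem(10,7)] by (simp add: blinfun_compose_assoc)
      also have "\<dots> = \<tau> (y o\<^sub>L a o\<^sub>L x) / \<beta>"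
        using markov(1) markov(2)[OF mem(8)] by (simp add: field_simps)
      also have "\<tau> (y o\<^sub>L a o\<^sub>L x) = \<tau> (x o\<^sub>L (y o\<^sub>L a))"
        using tracial_stateD(5)[OF trace(1) mem(7,3)] .
      also have "\<tau> (x o\<^sub>L (y o\<^sub>L a)) / \<beta> = \<tau> ((1 / \<beta>) *\<^sub>R (x o\<^sub>L (y o\<^sub>L a)))"
        using tracial_stateD(6)[OF trace(1) mem(9)] by simp
      finally show "\<tau> (d o\<^sub>L a) = \<tau> ((1 / \<beta>) *\<^sub>R (x o\<^sub>L y) o\<^sub>L a)"
        by (simp add: compose_bilinear blinfun_compose_assoc)
    qed
  qed blast
  have genR: "d \<in> R" if "d \<in> D \<union> {x o\<^sub>L e o\<^sub>L y | x y. x \<in> D \<and> y \<in> D}" for d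
    using that by (auto simp: R'(5) e(1) M_in_R subsetD[OF sub(5)])
  have "d \<in> R \<and> (\<exists>d'\<in>D. \<forall>a\<in>M. \<tau> (d o\<^sub>L a) = \<tau> (d' o\<^sub>L a))"
    using subsetD[OF R\<^sub>D_span assms]
  proof (induction rule: span_induct_alt)
    case base
    show ?case
      using Rsub Dsub by (auto simp: subspace_0 compose_bilinear intro: bexI[of _ 0])
  next
    case (step c x y)
    note x = step(1) and y = step(2)
    obtain x' y' where x': "x' \<in> D" "\<And>a. a \<in> M \<Longrightarrow> \<tau> (x o\<^sub>L a) = \<tau> (x' o\<^sub>L a)"
      and y': "y' \<in> D" "\<And>a. a \<in> M \<Longrightarrow> \<tau> (y o\<^sub>L a) = \<tau> (y' o\<^sub>L a)"
      using gen[OF x] y by blast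
    have lin: "\<tau> ((c *\<^sub>R u + v) o\<^sub>L a) = of_real c * \<tau> (u o\<^sub>L a) + \<tau> (v o\<^sub>L a)"
      if "u \<in> R" "v \<in> R" "a \<in> M" for u v a
    proof -
      have "u o\<^sub>L a \<in> R" "v o\<^sub>L a \<in> R"
        using that algebras R' by auto
      then show ?thesis
        using tracial_stateD(1)[OF trace(1), of "c *\<^sub>R (u o\<^sub>L a)" "v o\<^sub>L a"]
          tracial_stateD(6)[OF trace(1), of "u o\<^sub>L a" c] Rsub
        by (simp add: compose_bilinear subspace_scale)
    qed
    have mem: "x \<in> R" "y \<in> R" "x' \<in> R" "y' \<in> R"
      using genR[OF x] y x' y' sub algebras by auto
    show ?case
    proof (intro conjI bexI[of _ "c *\<^sub>R x' + y'"] ballI)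
      show "c *\<^sub>R x + y \<in> R" "c *\<^sub>R x' + y' \<in> D"
        using mem x' y' Rsub Dsub by (auto intro: subspace_add subspace_scale)
      show "\<tau> ((c *\<^sub>R x + y) o\<^sub>L a) = \<tau> ((c *\<^sub>R x' + y') o\<^sub>L a)" if "a \<in> M" for a
        using lin mem x' y' that by simp
    qed
  qed
  then show ?thesis
    by blast
qed

text \<open>
  Write the left factor of \<open>x e y\<close> as a sum of products \<open>d a\<close> with \<open>d \<in> D\<close> and \<open>a \<in> N\<close>; as \<open>e\<close> commutes
  with \<open>a\<close>, the product \<open>d a e y\<close> equals \<open>(d e)(a y)\<close>.
\<close>

lemma next_nondegenerate:
  assumes F: "finite F" "M = span F"
  shows "R = span {d o\<^sub>L a | d a. d \<in> R\<^sub>D \<and> a \<in> M}"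
proof
  note RD' = star_subalgebraD[OF star_subalgebra_R\<^sub>D]
  let ?V = "span {d o\<^sub>L a | d a. d \<in> R\<^sub>D \<and> a \<in> M}"
  have "x o\<^sub>L e o\<^sub>L y \<in> ?V" if x: "x \<in> M" and y: "y \<in> M" for x y
  proof -
    have "x o\<^sub>L (e o\<^sub>L y) \<in> ?V"
    proof (rule span_compose_in[of "{d o\<^sub>L a | d a. d \<in> D \<and> a \<in> N}" "{e o\<^sub>L y}"])
      fix s t assume "s \<in> {d o\<^sub>L a | d a. d \<in> D \<and> a \<in> N}" "t \<in> {e o\<^sub>L y}"
      then obtain d a where da: "s = d o\<^sub>L a" "t = e o\<^sub>L y" "d \<in> D" "a \<in> N"
        by blast
      have "s o\<^sub>L t = d o\<^sub>L (a o\<^sub>L e) o\<^sub>L y"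
        by (simp add: da blinfun_compose_assoc)
      also have "\<dots> = (d o\<^sub>L e) o\<^sub>L (a o\<^sub>L y)"
        by (simp only: e_commutes[OF da(4), symmetric]) (simp add: blinfun_compose_assoc)
      finally have "s o\<^sub>L t = (d o\<^sub>L e) o\<^sub>L (a o\<^sub>L y)" .
      moreover have "d o\<^sub>L e \<in> R\<^sub>D" "a o\<^sub>L y \<in> M"
        using da y R\<^sub>D_subset(1) algebras(4) by (auto intro!: RD'(5) M'(5))
      ultimately show "s o\<^sub>L t \<in> ?V"
        by (intro span_base) blast
    qed (use x nondegenerate in \<open>auto intro: span_base\<close>)
    then show ?thesis
      by (simp add: blinfun_compose_assoc)
  qed
  then show "R \<subseteq> ?V"
    unfolding e_span_M_eq[OF F] e_span_def by (intro span_minimal) auto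
  show "?V \<subseteq> R"
    by (rule span_minimal)
       (auto simp: R'(5) M_in_R subsetD[OF R\<^sub>D_subset(2)] intro: star_subalgebra_subspace[OF algebras(3)])
qed

end


section \<open>The tower of commuting squares\<close>

text \<open>
  For \<open>d \<in> D\<close> the expectation onto \<open>N\<close> agrees with the expectation onto \<open>L\<close>.
\<close>

lemma commuting_square_trace:
  assumes sq: "commuting_square \<tau> L N D M"
    and alg: "star_subalgebra N" "star_subalgebra M" "N \<subseteq> M" "D \<subseteq> M" and d: "d \<in> D"
  shows "\<exists>d'\<in>L. \<forall>a\<in>N. \<tau> (d o\<^sub>L a) = \<tau> (d' o\<^sub>L a)"
proof -
  obtain E\<^sub>N E\<^sub>D E\<^sub>L where E: "trace_cond_exp \<tau> M N E\<^sub>N" "trace_cond_exp \<tau> M D E\<^sub>D" "trace_cond_exp \<tau> M L E\<^sub>L"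
    and eq: "\<And>x. x \<in> M \<Longrightarrow> E\<^sub>N (E\<^sub>D x) = E\<^sub>L x"
    using sq unfolding commuting_square_def by blast
  have dM: "d \<in> M"
    using d alg by blast
  have "E\<^sub>N d = E\<^sub>L d"
    using eq[OF dM] trace_cond_expD(2)[OF E(2) d] by simp
  moreover have "E\<^sub>L d \<in> L"
    using trace_cond_expD(1)[OF E(3) dM] .
  ultimately show ?thesis
    using trace_cond_exp_trace(2)[OF E(1) alg(1,2,3) dM] by metis
qed

lemma nondegenerate_finite_span:
  assumes sq: "nondegenerate_commuting_square \<tau> L N D M"
    and alg: "star_subalgebra M" "N \<subseteq> M" "D \<subseteq> M" and F: "finite F" "M \<subseteq> span F"
  shows "M = span {d o\<^sub>L a | d a. d \<in> D \<and> a \<in> N}"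
proof -
  let ?S = "{d o\<^sub>L a | a d. a \<in> N \<and> d \<in> D}"
  have cl: "strong_operator_topology closure_of span ?S = M"
    using sq by (simp add: nondegenerate_commuting_square_def)
  have SM: "?S \<subseteq> M"
    using alg star_subalgebraD(5)[OF alg(1)] by blast
  obtain G where G: "finite G" "span ?S = span G"
    using finite_span_of_subset[of ?S F] SM F by blast
  have "M \<subseteq> span ?S"
    using finite_span_SOT_closed[OF G(1)] cl unfolding G(2) by blast
  moreover have "span ?S \<subseteq> M"
    by (rule span_minimal[OF SM star_subalgebra_subspace[OF alg(1)]])
  moreover have "?S = {d o\<^sub>L a | d a. d \<in> D \<and> a \<in> N}"
    by blast
  ultimately show ?thesis
    by simp
qed

lemma span_compose_absorb:
  assumes "M \<subseteq> span {d o\<^sub>L a | d a. d \<in> D \<and> a \<in> A0}"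
    and "R = span {d o\<^sub>L a | d a. d \<in> D' \<and> a \<in> M}" and "star_subalgebra D'" "D \<subseteq> D'"
  shows "R \<subseteq> span {d o\<^sub>L a | d a. d \<in> D' \<and> a \<in> A0}" (is "_ \<subseteq> ?V")
  unfolding assms(2)
proof (rule span_minimal)
  show "{d o\<^sub>L a | d a. d \<in> D' \<and> a \<in> M} \<subseteq> ?V"
  proof clarify
    fix d a assume d: "d \<in> D'" and a: "a \<in> M"
    show "d o\<^sub>L a \<in> ?V"
    proof (rule span_compose_in[of "{d}" "{d o\<^sub>L a | d a. d \<in> D \<and> a \<in> A0}"])
      fix s t assume "s \<in> {d}" "t \<in> {d o\<^sub>L a | d a. d \<in> D \<and> a \<in> A0}"
      then obtain d' a' where "s = d" "t = d' o\<^sub>L a'" "d' \<in> D" "a' \<in> A0"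
        by blast
      moreover from this have "d o\<^sub>L d' \<in> D'"
        using d assms(3,4) star_subalgebraD(5) by blast
      moreover have "s o\<^sub>L t = (d o\<^sub>L d') o\<^sub>L a'"
        using calculation by (simp add: blinfun_compose_assoc)
      ultimately show "s o\<^sub>L t \<in> ?V"
        by (intro span_base) blast
    qed (use a assms(1) in \<open>auto intro: span_base\<close>)
  qed
qed simp

text \<open>
  Induction on the level. The invariant contains the square between two consecutive levels, which is
  what the next step consumes, and the square between level \<open>0\<close> and level \<open>k\<close>, which is what the
  theorem needs. The generating sets are kept finite so that \<open>A\<^sub>k\<^sub>+\<^sub>1 = span A\<^sub>k e A\<^sub>k\<close> is available.
\<close>

lemma tower_of_commuting_squares:
  fixes \<tau> :: "'k::complex_hilbert op \<Rightarrow> complex" and A D :: "nat \<Rightarrow> 'k op set"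
  assumes A: "star_subalgebra (A 0)" "star_subalgebra (A 1)" "A 0 \<subseteq> A 1" "finite_dim (A 1)"
      "tracial_state (A 1) \<tau>" "faithful_on (A 1) \<tau>"
    and \<beta>: "\<beta> > 0"
    and bc: "\<forall>k\<ge>1. basic_construction \<tau> (A (k - 1)) (A k) (e (k + 1)) (A (k + 1))"
    and mk: "\<forall>k\<ge>1. markov_extension \<beta> \<tau> (A k) (e (k + 1)) (A (k + 1))"
    and D: "star_subalgebra (D 0)" "star_subalgebra (D 1)" "D 0 \<subseteq> D 1" "D 0 \<subseteq> A 0" "D 1 \<subseteq> A 1"
    and sq: "nondegenerate_commuting_square \<tau> (D 0) (A 0) (D 1) (A 1)"
    and Dk: "\<forall>k\<ge>1. D (k + 1) = star_subalgebra hull (insert (e (k + 1)) (D k))"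
  shows "star_subalgebra (A k)" "star_subalgebra (D k)" "D k \<subseteq> A k"
    "A k \<subseteq> A (Suc k)" "D k \<subseteq> D (Suc k)" "tracial_state (A k) \<tau>" "faithful_on (A k) \<tau>"
    "A k \<subseteq> span {d o\<^sub>L a | d a. d \<in> D k \<and> a \<in> A 0}"
    "d \<in> D k \<Longrightarrow> \<exists>d'\<in>D 0. \<forall>a\<in>A 0. \<tau> (d o\<^sub>L a) = \<tau> (d' o\<^sub>L a)"
proof -
  define I where "I k \<longleftrightarrow> star_subalgebra (A k) \<and> star_subalgebra (D k) \<and> D k \<subseteq> A k \<and>
      star_subalgebra (A (Suc k)) \<and> star_subalgebra (D (Suc k)) \<and> D (Suc k) \<subseteq> A (Suc k) \<and>
      A k \<subseteq> A (Suc k) \<and> D k \<subseteq> D (Suc k) \<and> tracial_state (A (Suc k)) \<tau> \<and> faithful_on (A (Suc k)) \<tau> \<and>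
      (\<exists>F. finite F \<and> A (Suc k) = span F) \<and>
      A (Suc k) = span {d o\<^sub>L a | d a. d \<in> D (Suc k) \<and> a \<in> A k} \<and>
      (\<forall>d\<in>D (Suc k). \<exists>d'\<in>D k. \<forall>a\<in>A k. \<tau> (d o\<^sub>L a) = \<tau> (d' o\<^sub>L a)) \<and>
      A k \<subseteq> span {d o\<^sub>L a | d a. d \<in> D k \<and> a \<in> A 0} \<and>
      (\<forall>d\<in>D k. \<exists>d'\<in>D 0. \<forall>a\<in>A 0. \<tau> (d o\<^sub>L a) = \<tau> (d' o\<^sub>L a)) \<and> A 0 \<subseteq> A k" for k
  have "I k" for k
  proof (induction k)
    case 0
    obtain F where F: "finite F" "A 1 \<subseteq> span F"
      using A(4) by (auto simp: finite_dim_def)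
    obtain G where G: "finite G" "span (A 1) = span G"
      using finite_span_of_subset[OF F(2,1)] .
    have "span (A 1) = A 1"
      using star_subalgebra_subspace[OF A(2)] span_eq_iff by blast
    then have "\<exists>F. finite F \<and> A 1 = span F"
      using G by metis
    moreover have "A 1 = span {d o\<^sub>L a | d a. d \<in> D 1 \<and> a \<in> A 0}"
      by (rule nondegenerate_finite_span[OF sq A(2,3) D(5) F])
    moreover have "\<exists>d'\<in>D 0. \<forall>a\<in>A 0. \<tau> (d o\<^sub>L a) = \<tau> (d' o\<^sub>L a)" if "d \<in> D 1" for d
      using sq commuting_square_trace[OF _ A(1,2,3) D(5) that]
      by (simp add: nondegenerate_commuting_square_def)
    moreover have "A 0 \<subseteq> span {d o\<^sub>L a | d a. d \<in> D 0 \<and> a \<in> A 0}"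
    proof
      fix a assume "a \<in> A 0"
      moreover have "a = id_blinfun o\<^sub>L a"
        by (rule blinfun_eqI) simp
      ultimately show "a \<in> span {d o\<^sub>L a | d a. d \<in> D 0 \<and> a \<in> A 0}"
        using star_subalgebraD(2)[OF D(1)] by (intro span_base) blast
    qed
    ultimately show ?case
      unfolding I_def using A D by (auto simp del: span_superset)
  next
    case (Suc k)
    note I = Suc[unfolded I_def]
    have bck: "basic_construction \<tau> (A k) (A (Suc k)) (e (Suc (Suc k))) (A (Suc (Suc k)))"
      using bc[rule_format, of "Suc k"] by simp
    have mkk: "markov_extension \<beta> \<tau> (A (Suc k)) (e (Suc (Suc k))) (A (Suc (Suc k)))"
      using mk[rule_format, of "Suc k"] by simp
    have alg: "star_subalgebra (A k)" "star_subalgebra (A (Suc k))" "A k \<subseteq> A (Suc k)"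
      using I by blast+
    have "\<exists>E. jones_step \<tau> \<beta> (A k) (A (Suc k)) (A (Suc (Suc k))) (e (Suc (Suc k))) E"
    proof (rule basic_construction_relations[OF bck alg])
      fix E
      assume *: "star_subalgebra (A (Suc (Suc k)))" "A (Suc k) \<subseteq> A (Suc (Suc k))"
        "e (Suc (Suc k)) \<in> A (Suc (Suc k))" "adj (e (Suc (Suc k))) = e (Suc (Suc k))"
        "e (Suc (Suc k)) o\<^sub>L e (Suc (Suc k)) = e (Suc (Suc k))"
        "trace_cond_exp \<tau> (A (Suc k)) (A k) E"
        "\<And>a. a \<in> A k \<Longrightarrow> e (Suc (Suc k)) o\<^sub>L a = a o\<^sub>L e (Suc (Suc k))"
        "\<And>x. x \<in> A (Suc k) \<Longrightarrow> e (Suc (Suc k)) o\<^sub>L x o\<^sub>L e (Suc (Suc k)) = E x o\<^sub>L e (Suc (Suc k))"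
        "\<And>y. y \<in> A (Suc (Suc k)) \<Longrightarrow> (\<And>x. x \<in> A (Suc k) \<Longrightarrow> y o\<^sub>L x o\<^sub>L e (Suc (Suc k)) = 0) \<Longrightarrow> y = 0"
      have "jones_step \<tau> \<beta> (A k) (A (Suc k)) (A (Suc (Suc k))) (e (Suc (Suc k))) E"
      proof
        show "A (Suc (Suc k)) = star_subalgebra hull (insert (e (Suc (Suc k))) (A (Suc k)))"
          using bck by (simp add: basic_construction_def)
        show "tracial_state (A (Suc (Suc k))) \<tau>" "faithful_on (A (Suc (Suc k))) \<tau>"
          using mkk by (auto simp: markov_extension_def faithful_normal_tracial_state_def)
        show "complex_of_real \<beta> * \<tau> (x o\<^sub>L e (Suc (Suc k))) = \<tau> x" if "x \<in> A (Suc k)" for x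
          using mkk that by (auto simp: markov_extension_def)
      qed (use * I \<beta> in blast)+
      then show "\<exists>E. jones_step \<tau> \<beta> (A k) (A (Suc k)) (A (Suc (Suc k))) (e (Suc (Suc k))) E"
        by blast
    qed
    then obtain E where E: "jones_step \<tau> \<beta> (A k) (A (Suc k)) (A (Suc (Suc k))) (e (Suc (Suc k))) E"
      by blast
    interpret jones_step_square \<tau> \<beta> "A k" "A (Suc k)" "A (Suc (Suc k))" "e (Suc (Suc k))" E
      "D k" "D (Suc k)" "D (Suc (Suc k))"
    proof (rule jones_step_square.intro[OF E], unfold_locales)
      show "D (Suc (Suc k)) = star_subalgebra hull (insert (e (Suc (Suc k))) (D (Suc k)))"
        using Dk[rule_format, of "Suc k"] by simp
    qed (use I in blast)+
    obtain F where F: "finite F" "A (Suc k) = span F"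
      using I by blast
    have parts: "A k \<subseteq> span {d o\<^sub>L a | d a. d \<in> D k \<and> a \<in> A 0}"
      "A (Suc k) = span {d o\<^sub>L a | d a. d \<in> D (Suc k) \<and> a \<in> A k}"
      "star_subalgebra (D (Suc k))" "D k \<subseteq> D (Suc k)"
      "\<forall>d\<in>D (Suc k). \<exists>d'\<in>D k. \<forall>a\<in>A k. \<tau> (d o\<^sub>L a) = \<tau> (d' o\<^sub>L a)"
      "\<forall>d\<in>D k. \<exists>d'\<in>D 0. \<forall>a\<in>A 0. \<tau> (d o\<^sub>L a) = \<tau> (d' o\<^sub>L a)" "A 0 \<subseteq> A k"
      using I by - (elim conjE, assumption)+
    have fin: "\<exists>F. finite F \<and> A (Suc (Suc k)) = span F"
      using e_span_M_finite[OF F] e_span_M_eq[OF F] by simp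
    have comm: "\<forall>d\<in>D (Suc k). \<exists>d'\<in>D 0. \<forall>a\<in>A 0. \<tau> (d o\<^sub>L a) = \<tau> (d' o\<^sub>L a)"
    proof
      fix d assume "d \<in> D (Suc k)"
      then obtain d1 where d1: "d1 \<in> D k" "\<forall>a\<in>A k. \<tau> (d o\<^sub>L a) = \<tau> (d1 o\<^sub>L a)"
        using parts(5) by blast
      then obtain d0 where "d0 \<in> D 0" "\<forall>a\<in>A 0. \<tau> (d1 o\<^sub>L a) = \<tau> (d0 o\<^sub>L a)"
        using parts(6) by blast
      then show "\<exists>d'\<in>D 0. \<forall>a\<in>A 0. \<tau> (d o\<^sub>L a) = \<tau> (d' o\<^sub>L a)"
        using d1(2) parts(7) by (intro bexI[of _ d0]) auto
    qed
    have next_comm: "\<forall>d\<in>D (Suc (Suc k)). \<exists>d'\<in>D (Suc k). \<forall>a\<in>A (Suc k). \<tau> (d o\<^sub>L a) = \<tau> (d' o\<^sub>L a)"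
      using next_commuting by (rule ballI)
    have subs: "A 0 \<subseteq> A (Suc k)" "D (Suc k) \<subseteq> D (Suc (Suc k))"
      using parts(7) algebras(4) R\<^sub>D_subset(1) by auto
    show ?case
      unfolding I_def
      by (intro conjI)
         (rule algebras sub star_subalgebra_R\<^sub>D R\<^sub>D_subset(2) trace fin comm next_comm subs
           next_nondegenerate[OF F] span_compose_absorb[OF parts(1-4)])+
  qed
  note I = this[unfolded I_def]
  have "A k \<subseteq> A (Suc k)" "tracial_state (A (Suc k)) \<tau>" "faithful_on (A (Suc k)) \<tau>"
    using I[of k] by blast+
  then show "tracial_state (A k) \<tau>" "faithful_on (A k) \<tau>"
    using tracial_state_mono faithful_on_mono by blast+
  show "star_subalgebra (A k)" "star_subalgebra (D k)" "D k \<subseteq> A k"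
    "A k \<subseteq> A (Suc k)" "D k \<subseteq> D (Suc k)"
    "A k \<subseteq> span {d o\<^sub>L a | d a. d \<in> D k \<and> a \<in> A 0}"
    using I[of k] by blast+
  show "d \<in> D k \<Longrightarrow> \<exists>d'\<in>D 0. \<forall>a\<in>A 0. \<tau> (d o\<^sub>L a) = \<tau> (d' o\<^sub>L a)"
    using I[of k] by blast
qed


section \<open>Projections onto the closed orbits of star algebras\<close>

lemma commutant_commutant_superset:
  "(\<And>x. x \<in> S \<Longrightarrow> clinear_op x) \<Longrightarrow> S \<subseteq> commutant (commutant S)"
  by (auto simp: commutant_def)

lemma star_subalgebra_UN_chain:
  fixes A :: "nat \<Rightarrow> 'h::complex_hilbert op set"
  assumes "\<And>k. star_subalgebra (A k)" "\<And>k. A k \<subseteq> A (Suc k)"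
  shows "star_subalgebra (\<Union>k. A k)"
proof -
  note A' = star_subalgebraD[OF assms(1)]
  have pair: "\<exists>k. x \<in> A k \<and> y \<in> A k" if xy: "x \<in> (\<Union>k. A k)" "y \<in> (\<Union>k. A k)" for x y
  proof -
    obtain i j where ij: "x \<in> A i" "y \<in> A j"
      using xy by blast
    have "A i \<subseteq> A (max i j)" "A j \<subseteq> A (max i j)"
      using lift_Suc_mono_le[of A, OF assms(2)] by auto
    then show ?thesis
      using ij by blast
  qed
  have add: "x + y \<in> (\<Union>k. A k)" and mult: "x o\<^sub>L y \<in> (\<Union>k. A k)"
    if xy: "x \<in> (\<Union>k. A k)" "y \<in> (\<Union>k. A k)" for x y
  proof -
    obtain k where "x \<in> A k" "y \<in> A k"
      using pair[OF xy] by blast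
    then have "x + y \<in> A k" "x o\<^sub>L y \<in> A k"
      by (auto intro: A')
    then show "x + y \<in> (\<Union>k. A k)" "x o\<^sub>L y \<in> (\<Union>k. A k)"
      by blast+
  qed
  show ?thesis
    unfolding star_subalgebra_def
  proof (intro conjI ballI allI)
    show "id_blinfun \<in> (\<Union>k. A k)"
      using A'(2)[of 0] by blast
    show "clinear_op x" "op_scale c x \<in> (\<Union>k. A k)" "adj x \<in> (\<Union>k. A k)"
      if x: "x \<in> (\<Union>k. A k)" for c x
    proof -
      obtain k where k: "x \<in> A k"
        using x by blast
      show "clinear_op x" "op_scale c x \<in> (\<Union>k. A k)" "adj x \<in> (\<Union>k. A k)"
        using A'(1)[OF k] A'(4)[OF k, of c] A'(6)[OF k] by blast+
    qed
  qed (use add mult in auto)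
qed

text \<open>
  The closed orbit of \<open>w\<close> plays the role of \<open>L\<^sup>2(R)\<close>. It reduces \<open>R\<close>, so its projection commutes with \<open>R\<close>.
\<close>

context
  fixes R :: "'h::complex_hilbert op set" and w :: 'h
  assumes R: "star_subalgebra R"
begin

abbreviation orbit_closure :: "'h set" where
  "orbit_closure \<equiv> closure ((\<lambda>x. blinfun_apply x w) ` R)"

lemma orbit_closure_base: "x \<in> R \<Longrightarrow> x w \<in> orbit_closure"
  by (rule subsetD[OF closure_subset]) blast

lemma closed_csubspace_orbit_closure: "closed_csubspace orbit_closure"
proof (rule closed_csubspace_closure)
  let ?O = "(\<lambda>x. blinfun_apply x w) ` R"
  show "subspace ?O"
    using subspace_0[OF star_subalgebra_subspace[OF R]] subspace_add[OF star_subalgebra_subspace[OF R]]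
      subspace_scale[OF star_subalgebra_subspace[OF R]]
    unfolding subspace_def
    by (auto simp: blinfun.add_left[symmetric] blinfun.scaleR_left[symmetric] intro!: image_eqI[of _ _ 0])
  show "c *\<^sub>C v \<in> ?O" if v: "v \<in> ?O" for c v
  proof -
    obtain x where x: "x \<in> R" "v = x w"
      using v by blast
    then have "c *\<^sub>C v = op_scale c x w"
      by (simp add: op_scale.rep_eq)
    then show ?thesis
      using star_subalgebraD(4)[OF R x(1)] by blast
  qed
qed

lemma L2_proj: "is_projection (L2_proj w R)" "range (L2_proj w R) = orbit_closure"
  unfolding L2_proj_def using proj_onto[OF closed_csubspace_orbit_closure] by auto

lemma L2_proj_eqI:
  assumes "\<eta> \<in> orbit_closure" "\<And>y. y \<in> R \<Longrightarrow> cinner (\<xi> - \<eta>) (y w) = 0"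
  shows "L2_proj w R \<xi> = \<eta>"
proof (rule projection_eq[OF L2_proj(1)])
  have "orbit_closure \<subseteq> ortho_compl {\<xi> - \<eta>}"
  proof (rule closure_minimal)
    show "(\<lambda>x. blinfun_apply x w) ` R \<subseteq> ortho_compl {\<xi> - \<eta>}"
      using assms(2) cinner_eq_0_commute by (auto simp: ortho_compl_def)
    show "closed (ortho_compl {\<xi> - \<eta>})"
      using closed_csubspace_ortho_compl[of "{\<xi> - \<eta>}"] by (simp add: closed_csubspace_def)
  qed
  then show "cinner (\<xi> - \<eta>) v = 0" if "v \<in> range (L2_proj w R)" for v
    using that cinner_eq_0_commute unfolding L2_proj(2) by (auto simp: ortho_compl_def)
qed (use assms L2_proj in auto)

lemma L2_proj_commutes:
  assumes x: "x \<in> R"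
  shows "L2_proj w R (x v) = x (L2_proj w R v)"
proof -
  have inv: "y u \<in> orbit_closure" if y: "y \<in> R" and u: "u \<in> orbit_closure" for y u
  proof -
    have "blinfun_apply y ` orbit_closure \<subseteq> closure (blinfun_apply y ` (\<lambda>x. blinfun_apply x w) ` R)"
      by (rule closure_bounded_linear_image_subset[OF blinfun.bounded_linear_right])
    also have "\<dots> \<subseteq> orbit_closure"
    proof (rule closure_mono, clarify)
      fix z assume "z \<in> R"
      then show "y (z w) \<in> (\<lambda>x. blinfun_apply x w) ` R"
        using star_subalgebraD(5)[OF R y] by (intro image_eqI[of _ _ "y o\<^sub>L z"]) auto
    qed
    finally show ?thesis
      using u by blast
  qed
  note R' = star_subalgebraD[OF R]
  have range: "L2_proj w R v \<in> orbit_closure"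
    using L2_proj(2) by blast
  show ?thesis
  proof (rule L2_proj_eqI)
    show "x (L2_proj w R v) \<in> orbit_closure"
      by (rule inv[OF x range])
    show "cinner (x v - x (L2_proj w R v)) (y w) = 0" if "y \<in> R" for y
    proof -
      have "cinner (x v - x (L2_proj w R v)) (y w) = cinner (v - L2_proj w R v) (adj x (y w))"
        using cinner_adj[OF R'(1)[OF x]] by (simp add: blinfun.diff_right[symmetric])
      also have "\<dots> = 0"
        by (rule projection_orthogonal[OF L2_proj(1)])
           (simp add: L2_proj(2) inv[OF R'(6)[OF x] orbit_closure_base[OF that]])
      finally show ?thesis .
    qed
  qed
qed

text \<open>
  Passing to the generated von Neumann algebra does not enlarge the closed orbit: the projection onto
  it commutes with \<open>R\<close>, hence with the bicommutant, and fixes \<open>w\<close>.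
\<close>

lemma L2_proj_commutant_commutant: "L2_proj w (commutant (commutant R)) = L2_proj w R"
proof -
  let ?p = "L2_proj w R"
  note R' = star_subalgebraD[OF R]
  have "?p \<in> commutant R"
    using L2_proj(1) L2_proj_commutes
    by (auto simp: commutant_def is_projection_def intro!: blinfun_eqI)
  have "x w \<in> orbit_closure" if x: "x \<in> commutant (commutant R)" for x
  proof -
    have "w \<in> orbit_closure"
      using orbit_closure_base[OF R'(2)] by simp
    then have pw: "?p w = w"
      using projection_range[OF L2_proj(1)] L2_proj(2) by blast
    have "?p o\<^sub>L x = x o\<^sub>L ?p"
      using x \<open>?p \<in> commutant R\<close> unfolding commutant_def[of "commutant R"] by blast
    then have "?p (x w) = x w"
      using pw by (metis blinfun_apply_blinfun_compose)
    then show ?thesis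
      using L2_proj(2) by (metis rangeI)
  qed
  then have "closure ((\<lambda>x. blinfun_apply x w) ` commutant (commutant R)) \<subseteq> orbit_closure"
    by (intro closure_minimal) auto
  moreover have "orbit_closure \<subseteq> closure ((\<lambda>x. blinfun_apply x w) ` commutant (commutant R))"
    by (intro closure_mono image_mono commutant_commutant_superset R'(1))
  ultimately show ?thesis
    by (simp add: L2_proj_def)
qed

end

lemma L2_proj_absorb:
  assumes "star_subalgebra R" "star_subalgebra R'" "R \<subseteq> R'"
  shows "L2_proj w R' (L2_proj w R v) = L2_proj w R v"
proof -
  have "L2_proj w R v \<in> closure ((\<lambda>x. blinfun_apply x w) ` R')"
    using L2_proj(2)[OF assms(1)] closure_mono[OF image_mono[OF assms(3)]] by blast
  then show ?thesis
    using projection_range[OF L2_proj(1)[OF assms(2)]] L2_proj(2)[OF assms(2)] by blast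
qed

text \<open>
  The difference \<open>x w - E x w\<close> is orthogonal to \<open>P w\<close>, since \<open>E\<close> preserves the trace and is \<open>P\<close>-linear.
\<close>

lemma L2_proj_cond_exp:
  assumes E: "trace_cond_exp (vector_state w) M P E"
    and P: "star_subalgebra P" and M: "star_subalgebra M" and PM: "P \<subseteq> M" and x: "x \<in> M"
  shows "L2_proj w P (x w) = E x w"
proof (rule L2_proj_eqI[OF P])
  note P' = star_subalgebraD[OF P]
  show "E x w \<in> closure ((\<lambda>x. blinfun_apply x w) ` P)"
    by (rule orbit_closure_base[OF P]) (rule trace_cond_expD(1)[OF E x])
  show "cinner (x w - E x w) (y w) = 0" if y: "y \<in> P" for y
    using trace_cond_exp_trace(1)[OF E P M PM x P'(6)[OF y]] cinner_adj'[OF P'(1)[OF y]]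
    by (simp add: vector_state_def cinner_diff_left blinfun.diff_right)
qed

lemma blinfun_eq_on_dense:
  assumes "closure S = UNIV" "\<And>v. v \<in> S \<Longrightarrow> blinfun_apply x v = blinfun_apply y v"
  shows "x = y"
proof (rule blinfun_eqI)
  fix v
  have "closed {v. blinfun_apply x v = blinfun_apply y v}"
    by (intro closed_Collect_eq linear_continuous_on blinfun.bounded_linear_right)
  then have "closure S \<subseteq> {v. blinfun_apply x v = blinfun_apply y v}"
    using assms(2) by (intro closure_minimal) auto
  then show "x v = y v"
    using assms(1) by blast
qed


section \<open>The cyclic representation of the tower\<close>

lemma gns_representationD:
  assumes "gns_representation U \<tau> \<pi> w"
  shows "x \<in> U \<Longrightarrow> clinear_op (\<pi> x)" "\<pi> id_blinfun = id_blinfun"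
    "x \<in> U \<Longrightarrow> y \<in> U \<Longrightarrow> \<pi> (x + y) = \<pi> x + \<pi> y" "x \<in> U \<Longrightarrow> \<pi> (op_scale c x) = op_scale c (\<pi> x)"
    "x \<in> U \<Longrightarrow> y \<in> U \<Longrightarrow> \<pi> (x o\<^sub>L y) = \<pi> x o\<^sub>L \<pi> y" "x \<in> U \<Longrightarrow> \<pi> (adj x) = adj (\<pi> x)"
    "x \<in> U \<Longrightarrow> cinner (\<pi> x w) w = \<tau> x" "closure {\<pi> x w | x. x \<in> U} = UNIV"
    "x \<in> U \<Longrightarrow> \<pi> (r *\<^sub>R x) = r *\<^sub>R \<pi> x"
  using assms unfolding gns_representation_def op_scale_real[symmetric] by blast+

lemma gns_diff:
  assumes "gns_representation U \<tau> \<pi> w" "star_subalgebra U" "x \<in> U" "y \<in> U"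
  shows "\<pi> (x - y) = \<pi> x - \<pi> y"
  using gns_representationD(3)[OF assms(1), of x "(-1) *\<^sub>R y"] gns_representationD(9)[OF assms(1), of y "-1"]
    assms(3,4) subspace_neg[OF star_subalgebra_subspace[OF assms(2)]] by simp

lemma gns_cinner:
  assumes g: "gns_representation U \<tau> \<pi> w" and U: "star_subalgebra U" and xy: "x \<in> U" "y \<in> U"
  shows "cinner (\<pi> x w) (\<pi> y w) = \<tau> (adj y o\<^sub>L x)"
proof -
  note g' = gns_representationD[OF g] and U' = star_subalgebraD[OF U]
  have "cinner (\<pi> x w) (\<pi> y w) = cinner (\<pi> (adj y o\<^sub>L x) w) w"
    using cinner_adj'[OF g'(1)[OF xy(2)]] xy U' by (simp add: g')
  then show ?thesis
    using g'(7) xy U' by simp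
qed

lemma star_subalgebra_gns_image:
  assumes g: "gns_representation U \<tau> \<pi> w" and D: "star_subalgebra D" and DU: "D \<subseteq> U"
  shows "star_subalgebra (\<pi> ` D)"
proof -
  note g' = gns_representationD[OF g] and D' = star_subalgebraD[OF D]
  show ?thesis
    unfolding star_subalgebra_def
  proof (intro conjI ballI allI)
    show "id_blinfun \<in> \<pi> ` D"
      using g'(2) D'(2) by (metis imageI)
    show "clinear_op u" if "u \<in> \<pi> ` D" for u
      using that g'(1) DU by blast
    show "adj u \<in> \<pi> ` D" if u: "u \<in> \<pi> ` D" for u
    proof -
      obtain x where x: "x \<in> D" "u = \<pi> x"
        using u by blast
      then have "adj u = \<pi> (adj x)"
        using g'(6) DU by (simp add: subset_iff)
      then show ?thesis
        using D'(6)[OF x(1)] by blast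
    qed
    show "op_scale c u \<in> \<pi> ` D" if u: "u \<in> \<pi> ` D" for c u
    proof -
      obtain x where x: "x \<in> D" "u = \<pi> x"
        using u by blast
      then have "op_scale c u = \<pi> (op_scale c x)"
        using g'(4) DU by (simp add: subset_iff)
      then show ?thesis
        using D'(4)[OF x(1)] by blast
    qed
    show "u + v \<in> \<pi> ` D" "u o\<^sub>L v \<in> \<pi> ` D" if uv: "u \<in> \<pi> ` D" "v \<in> \<pi> ` D" for u v
    proof -
      obtain x y where xy: "x \<in> D" "u = \<pi> x" "y \<in> D" "v = \<pi> y"
        using uv by blast
      then have "u + v = \<pi> (x + y)" "u o\<^sub>L v = \<pi> (x o\<^sub>L y)"
        using g'(3,5) DU by (simp_all add: subset_iff)
      then show "u + v \<in> \<pi> ` D" "u o\<^sub>L v \<in> \<pi> ` D"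
        using D'(3,5)[OF xy(1,3)] by blast+
    qed
  qed
qed

text \<open>
  The algebra \<open>D\<close> is the union of a tower, while the expectation only concerns its bottom level \<open>D0\<close>. The
  hypothesis on the trace says that an element of \<open>D\<close> pairs with \<open>A0\<close> like an element of \<open>D0\<close>, so
  \<open>a - E a\<close> is orthogonal to the whole tower and not just to \<open>D0\<close>.
\<close>

lemma L2_proj_gns_cond_exp:
  assumes g: "gns_representation U \<tau> \<pi> w" and U: "star_subalgebra U"
    and D: "star_subalgebra D" "D \<subseteq> U" and D0: "star_subalgebra D0" "D0 \<subseteq> D"
    and A0: "star_subalgebra A0" "A0 \<subseteq> U" "D0 \<subseteq> A0"
    and comm: "\<And>d. d \<in> D \<Longrightarrow> \<exists>d'\<in>D0. \<forall>a\<in>A0. \<tau> (d o\<^sub>L a) = \<tau> (d' o\<^sub>L a)"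
    and E: "trace_cond_exp \<tau> A0 D0 E" and tr: "tracial_state A0 \<tau>" and a: "a \<in> A0"
  shows "L2_proj w (\<pi> ` D) (\<pi> a w) = \<pi> (E a) w"
proof (rule L2_proj_eqI[OF star_subalgebra_gns_image[OF g D]])
  note im = star_subalgebra_gns_image[OF g D]
  have Ea: "E a \<in> D0" "E a \<in> A0" "E a \<in> D" "E a \<in> U"
    using trace_cond_expD(1)[OF E a] D0 A0 by auto
  show "\<pi> (E a) w \<in> closure ((\<lambda>x. blinfun_apply x w) ` \<pi> ` D)"
    by (rule orbit_closure_base[OF im]) (use Ea in blast)
  show "cinner (\<pi> a w - \<pi> (E a) w) (y w) = 0" if y: "y \<in> \<pi> ` D" for y
  proof -
    obtain d where d: "d \<in> D" "y = \<pi> d"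
      using y by blast
    obtain d' where d': "d' \<in> D0" "\<And>a. a \<in> A0 \<Longrightarrow> \<tau> (adj d o\<^sub>L a) = \<tau> (d' o\<^sub>L a)"
      using comm[OF star_subalgebraD(6)[OF D(1) d(1)]] by blast
    have "\<tau> (adj d o\<^sub>L a) = \<tau> (adj d o\<^sub>L E a)"
      using d'(2)[OF a] d'(2)[OF Ea(2)] trace_cond_exp_trace(1)[OF E D0(1) A0(1,3) a d'(1)] by simp
    then show ?thesis
      using gns_cinner[OF g U, of a d] gns_cinner[OF g U, of "E a" d] a A0 d D Ea
      by (simp add: cinner_diff_left subset_iff)
  qed
qed

text \<open>
  Here \<open>\<eta>\<close> is an eigenvector of \<open>qpq - n\<close> in its range, so \<open>q \<eta> = \<eta>\<close>, \<open>n \<eta> = 0\<close> and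
  \<open>\<parallel>p \<eta>\<parallel>\<^sup>2 = p \<eta> \<bullet> \<eta> = \<alpha>\<parallel>\<eta>\<parallel>\<^sup>2\<close>. If \<open>\<alpha> \<ge> 1\<close> then \<open>p \<eta> = \<eta>\<close>, and the hypothesis on the meet gives
  \<open>n \<eta> = \<eta>\<close>. If \<open>\<alpha> = 0\<close> then \<open>p \<eta> = 0\<close>, and \<open>\<eta> \<bullet> \<eta> = p \<eta> \<bullet> q \<xi> - n \<eta> \<bullet> \<xi>\<close> vanishes.
\<close>

lemma compressed_projection_eigenvalue_bounds:
  assumes p: "is_projection p" and q: "is_projection q" and n: "is_projection n"
    and np: "\<And>v. p (n v) = n v" and nq: "\<And>v. q (n v) = n v"
    and \<eta>: "\<eta> = q (p (q \<xi>)) - n \<xi>" "\<eta> \<noteq> 0" "q (p (q \<eta>)) - n \<eta> = \<alpha> *\<^sub>R \<eta>"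
    and meet: "p \<eta> = \<eta> \<Longrightarrow> q \<eta> = \<eta> \<Longrightarrow> n \<eta> = \<eta>" and \<alpha>: "0 \<le> \<alpha>"
  shows "0 < \<alpha>" "\<alpha> < 1"
proof -
  note pp = projection_apply[OF p] and qq = projection_apply[OF q] and nn = projection_apply[OF n]
  note npv = subprojection_absorbs[OF p n np] and nqv = subprojection_absorbs[OF q n nq]
  have n\<eta>: "n \<eta> = 0"
    by (simp add: \<eta>(1) blinfun.diff_right npv nqv nn)
  have q\<eta>: "q \<eta> = \<eta>"
    by (simp add: \<eta>(1) blinfun.diff_right qq nq)
  have qp\<eta>: "q (p \<eta>) = \<alpha> *\<^sub>R \<eta>"
    using \<eta>(3) n\<eta> q\<eta> by simp
  have "p \<eta> \<bullet> p \<eta> = p \<eta> \<bullet> \<eta>"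
    using pp by (metis inner_eq_Re_cinner)
  also have "\<dots> = q (p \<eta>) \<bullet> \<eta>"
    using qq q\<eta> by (metis inner_eq_Re_cinner)
  finally have np\<eta>: "p \<eta> \<bullet> p \<eta> = \<alpha> * (\<eta> \<bullet> \<eta>)" "p \<eta> \<bullet> \<eta> = \<alpha> * (\<eta> \<bullet> \<eta>)"
    using qp\<eta> \<open>p \<eta> \<bullet> p \<eta> = p \<eta> \<bullet> \<eta>\<close> by auto
  have pos: "\<eta> \<bullet> \<eta> > 0"
    using \<eta>(2) by simp
  show "0 < \<alpha>"
  proof (rule ccontr)
    assume "\<not> 0 < \<alpha>"
    then have "p \<eta> = 0"
      using \<alpha> np\<eta> by simp
    have "\<eta> \<bullet> \<eta> = \<eta> \<bullet> q (p (q \<xi>)) - \<eta> \<bullet> n \<xi>"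
      by (metis \<eta>(1) inner_diff_right)
    also have "\<eta> \<bullet> q (p (q \<xi>)) = p \<eta> \<bullet> q \<xi>"
      using pp qq q\<eta> by (metis inner_eq_Re_cinner)
    also have "\<eta> \<bullet> n \<xi> = n \<eta> \<bullet> \<xi>"
      using nn by (metis inner_eq_Re_cinner)
    finally show False
      using pos \<open>p \<eta> = 0\<close> n\<eta> by simp
  qed
  show "\<alpha> < 1"
  proof (rule ccontr)
    assume "\<not> \<alpha> < 1"
    have "(\<eta> - p \<eta>) \<bullet> (\<eta> - p \<eta>) = (1 - \<alpha>) * (\<eta> \<bullet> \<eta>)"
      using np\<eta> by (simp add: inner_diff_left inner_diff_right inner_commute algebra_simps)
    also have "\<dots> \<le> 0"
      using \<open>\<not> \<alpha> < 1\<close> pos by (simp add: mult_le_0_iff)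
    finally have "(\<eta> - p \<eta>) \<bullet> (\<eta> - p \<eta>) = 0"
      by (meson inner_ge_zero order_antisym)
    then have "p \<eta> = \<eta>"
      by simp
    then show False
      using meet q\<eta> n\<eta> \<eta>(2) by simp
  qed
qed

theorem theorem3p8:
  fixes \<tau> :: "'k::complex_hilbert op \<Rightarrow> complex"
    and A C :: "nat \<Rightarrow> 'k op set"
    and B :: "nat \<Rightarrow> nat \<Rightarrow> 'k op set"
    and e :: "nat \<Rightarrow> 'k op"
    and \<pi> :: "'k op \<Rightarrow> 'h::complex_hilbert op"
    and \<Omega> :: 'h
    and N P Q M :: "'h op set"
    and EB1 EB2 EC S0 :: "'k op \<Rightarrow> 'k op"
    and \<alpha> :: real
  assumes "iterated_basic_construction \<tau> A B C e"
    and "gns_representation (\<Union>k. A k) \<tau> \<pi> \<Omega>"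
    and "M = commutant (commutant (\<pi> ` (\<Union>k. A k)))"
    and "P = commutant (commutant (\<pi> ` (\<Union>k. B 1 k)))"
    and "Q = commutant (commutant (\<pi> ` (\<Union>k. B 2 k)))"
    and "N = commutant (commutant (\<pi> ` (\<Union>k. C k)))"
    and "II1_factor N" and "II1_factor P" and "II1_factor Q" and "II1_factor M"
    and "trace_cond_exp \<tau> (A 0) (B 1 0) EB1"
    and "trace_cond_exp \<tau> (A 0) (B 2 0) EB2"
    and "trace_cond_exp \<tau> (A 0) (C 0) EC"
    and "\<forall>x. S0 x = EB2 (EB1 (EB2 x)) - EC x"
    and "\<exists>x\<in>A 0. S0 x \<noteq> 0"
    and "\<alpha> \<ge> 0" and "\<forall>x\<in>A 0. S0 (S0 x) = \<alpha> *\<^sub>R S0 x"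
  shows "\<not> commuting_square (vector_state \<Omega>) N P Q M \<and>
         Ang_alg \<Omega> P Q = {complex_of_real (arccos (sqrt \<alpha>))}"
proof -
  note ibc = assms(1)[unfolded iterated_basic_construction_def nondegenerate_commuting_cube_def
      commuting_cube_def] and g = assms(2) and S0 = assms(14) and S0sq = assms(17)
  obtain \<beta> where \<beta>: "\<beta> > 0"
    "\<forall>k\<ge>1. basic_construction \<tau> (A (k - 1)) (A k) (e (k + 1)) (A (k + 1))"
    "\<forall>k\<ge>1. markov_extension \<beta> \<tau> (A k) (e (k + 1)) (A (k + 1))"
    using ibc by blast
  have A: "star_subalgebra (A 0)" "star_subalgebra (A 1)" "A 0 \<subseteq> A 1" "finite_dim (A 1)"
    "tracial_state (A 1) \<tau>" "faithful_on (A 1) \<tau>"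
    using ibc by (auto intro: star_subalgebra_von_neumann_algebra simp: faithful_normal_tracial_state_def)
  have C01: "C 0 = B 1 0 \<inter> B 2 0" "C 1 = B 1 1 \<inter> B 2 1"
    using ibc by auto
  have B: "star_subalgebra (B j 0)" "star_subalgebra (B j 1)" "B j 0 \<subseteq> B j 1" "B j 0 \<subseteq> A 0" "B j 1 \<subseteq> A 1"
    "nondegenerate_commuting_square \<tau> (B j 0) (A 0) (B j 1) (A 1)"
    "\<forall>k\<ge>1. B j (k + 1) = star_subalgebra hull (insert (e (k + 1)) (B j k))"
    if "j \<in> {1, 2}" for j
    using ibc that by (blast intro: star_subalgebra_von_neumann_algebra)+
  have C: "star_subalgebra (C 0)" "star_subalgebra (C 1)" "C 0 \<subseteq> C 1" "C 0 \<subseteq> A 0" "C 1 \<subseteq> A 1"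
    "nondegenerate_commuting_square \<tau> (C 0) (A 0) (C 1) (A 1)"
    "\<forall>k\<ge>1. C (k + 1) = star_subalgebra hull (insert (e (k + 1)) (C k))"
  proof -
    show "star_subalgebra (C 0)" "star_subalgebra (C 1)"
      unfolding C01 using B(1,2)[of 1] B(1,2)[of 2] by (auto intro: star_subalgebra_Int)
    show "C 0 \<subseteq> C 1" "C 0 \<subseteq> A 0" "C 1 \<subseteq> A 1"
      unfolding C01 using B(3-5)[of 1] B(3-5)[of 2] by auto
    show "nondegenerate_commuting_square \<tau> (C 0) (A 0) (C 1) (A 1)"
      unfolding C01 using ibc by blast
    show "\<forall>k\<ge>1. C (k + 1) = star_subalgebra hull (insert (e (k + 1)) (C k))"
      using ibc by blast
  qed
  \<comment> \<open>\<open>C\<close> is defined as an intersection at levels \<open>0\<close> and \<open>1\<close>; higher up the generators are compared.\<close>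
  have CB: "C k \<subseteq> B j k" if j: "j \<in> {1, 2}" for j k
  proof (induction k rule: less_induct)
    case (less k)
    consider "k = 0" | "k = 1" | m where "m \<ge> 1" "k = m + 1"
      by (metis One_nat_def Suc_eq_plus1 less_one not_less old.nat.exhaust)
    then show ?case
    proof cases
      case 3
      then have "C m \<subseteq> B j m"
        using less.IH[of m] by simp
      then show ?thesis
        unfolding 3(2) B(7)[OF j, rule_format, OF 3(1)] C(7)[rule_format, OF 3(1)] by (intro hull_mono insert_mono)
    qed (use C01 j in auto)
  qed

  have one: "(1::nat) \<in> {1, 2}" and two: "(2::nat) \<in> {1, 2}"
    by auto
  note towerB1 = tower_of_commuting_squares[where D = "B 1", OF A \<beta> B(1-7)[OF one]]
    and towerB2 = tower_of_commuting_squares[where D = "B 2", OF A \<beta> B(1-7)[OF two]]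
    and towerC = tower_of_commuting_squares[where D = C, OF A \<beta> C]
  have UA: "star_subalgebra (\<Union>k. A k)"
    using towerC(1,4) by (rule star_subalgebra_UN_chain)
  have UB1: "star_subalgebra (\<Union>k. B 1 k)" "(\<Union>k. B 1 k) \<subseteq> (\<Union>k. A k)"
    using star_subalgebra_UN_chain[of "B 1", OF towerB1(2,5)] towerB1(3) by blast+
  have UB2: "star_subalgebra (\<Union>k. B 2 k)" "(\<Union>k. B 2 k) \<subseteq> (\<Union>k. A k)"
    using star_subalgebra_UN_chain[of "B 2", OF towerB2(2,5)] towerB2(3) by blast+
  have UC: "star_subalgebra (\<Union>k. C k)" "(\<Union>k. C k) \<subseteq> (\<Union>k. A k)"
    using star_subalgebra_UN_chain[of C, OF towerC(2,5)] towerC(3) by blast+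
  have UCB: "(\<Union>k. C k) \<subseteq> (\<Union>k. B 1 k)" "(\<Union>k. C k) \<subseteq> (\<Union>k. B 2 k)"
    using CB[OF one] CB[OF two] by blast+
  have A0: "A 0 \<subseteq> (\<Union>k. A k)"
    by blast
  note g' = gns_representationD[OF g]
  note im = star_subalgebra_gns_image[OF g]

  define p q n where "p = L2_proj \<Omega> (\<pi> ` (\<Union>k. B 1 k))" and "q = L2_proj \<Omega> (\<pi> ` (\<Union>k. B 2 k))"
    and "n = L2_proj \<Omega> (\<pi> ` (\<Union>k. C k))"
  note imB1 = im[OF UB1] and imB2 = im[OF UB2] and imC = im[OF UC]
  have pr: "is_projection p" "is_projection q" "is_projection n"
    unfolding p_def q_def n_def by (rule L2_proj(1)[OF imB1] L2_proj(1)[OF imB2] L2_proj(1)[OF imC])+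
  have LP: "L2_proj \<Omega> P = p" and LQ: "L2_proj \<Omega> Q = q"
    unfolding assms(4,5) p_def q_def
    by (rule L2_proj_commutant_commutant[OF imB1] L2_proj_commutant_commutant[OF imB2])+
  have npq: "p (n v) = n v" "q (n v) = n v" for v
    unfolding p_def q_def n_def
    by (rule L2_proj_absorb[OF imC imB1 image_mono[OF UCB(1)]]
        L2_proj_absorb[OF imC imB2 image_mono[OF UCB(2)]])+
  have comm: "p (\<pi> c v) = \<pi> c (p v)" "q (\<pi> c v) = \<pi> c (q v)" "n (\<pi> c v) = \<pi> c (n v)"
    if c: "c \<in> (\<Union>k. C k)" for c v
    unfolding p_def q_def n_def
    by (rule L2_proj_commutes[OF imB1 imageI[OF subsetD[OF UCB(1) c]]]
        L2_proj_commutes[OF imB2 imageI[OF subsetD[OF UCB(2) c]]] L2_proj_commutes[OF imC imageI[OF c]])+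
  have tr0: "tracial_state (A 0) \<tau>" "faithful_on (A 0) \<tau>"
    using A tracial_state_mono faithful_on_mono by blast+
  have Ep: "p (\<pi> a \<Omega>) = \<pi> (EB1 a) \<Omega>" and Eq: "q (\<pi> a \<Omega>) = \<pi> (EB2 a) \<Omega>"
    and En: "n (\<pi> a \<Omega>) = \<pi> (EC a) \<Omega>" if a: "a \<in> A 0" for a
  proof -
    have D0: "B 1 0 \<subseteq> (\<Union>k. B 1 k)" "B 2 0 \<subseteq> (\<Union>k. B 2 k)" "C 0 \<subseteq> (\<Union>k. C k)"
      by blast+
    show "p (\<pi> a \<Omega>) = \<pi> (EB1 a) \<Omega>"
      unfolding p_def
      by (rule L2_proj_gns_cond_exp[OF g UA UB1 B(1)[OF one] D0(1) A(1) A0 B(4)[OF one] _ assms(11) tr0(1) a])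
         (use towerB1(9) in blast)
    show "q (\<pi> a \<Omega>) = \<pi> (EB2 a) \<Omega>"
      unfolding q_def
      by (rule L2_proj_gns_cond_exp[OF g UA UB2 B(1)[OF two] D0(2) A(1) A0 B(4)[OF two] _ assms(12) tr0(1) a])
         (use towerB2(9) in blast)
    show "n (\<pi> a \<Omega>) = \<pi> (EC a) \<Omega>"
      unfolding n_def
      by (rule L2_proj_gns_cond_exp[OF g UA UC C(1) D0(3) A(1) A0 C(4) _ assms(13) tr0(1) a])
         (use towerC(9) in blast)
  qed
  have EA: "EB1 a \<in> A 0" "EB2 a \<in> A 0" "EC a \<in> A 0" if "a \<in> A 0" for a
    using trace_cond_expD(1)[OF assms(11) that] trace_cond_expD(1)[OF assms(12) that]
      trace_cond_expD(1)[OF assms(13) that] B(4)[OF one] B(4)[OF two] C(4) by blast+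
  have S0A: "S0 a \<in> A 0" if "a \<in> A 0" for a
    using that EA subspace_diff[OF star_subalgebra_subspace[OF A(1)]] S0 by simp

  define S where "S = (q o\<^sub>L p o\<^sub>L q) - n"
  have S: "S v = q (p (q v)) - n v" for v
    by (simp add: S_def blinfun.diff_left)
  have Sa: "S (\<pi> a \<Omega>) = \<pi> (S0 a) \<Omega>" if a: "a \<in> A 0" for a
  proof -
    have "EB2 (EB1 (EB2 a)) \<in> (\<Union>k. A k)" "EC a \<in> (\<Union>k. A k)"
      using EA a by blast+
    then show ?thesis
      using EA a S0 by (simp add: S Ep Eq En gns_diff[OF g UA] blinfun.diff_left)
  qed
  \<comment> \<open>\<open>S\<close> is a left \<open>C\<^sub>k\<close>-module map, so its square is determined on \<open>C\<^sub>k A\<^sub>0\<close> by \<open>S\<^sub>0\<close>.\<close>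
  have Sca: "S (\<pi> c v) = \<pi> c (S v)" if "c \<in> (\<Union>k. C k)" for c v
    using comm[OF that] by (simp add: S blinfun.diff_right)
  have "S o\<^sub>L S = \<alpha> *\<^sub>R S"
  proof (rule blinfun_eq_on_dense[OF g'(8)])
    fix v assume "v \<in> {\<pi> x \<Omega> | x. x \<in> (\<Union>k. A k)}"
    then obtain x k where x: "x \<in> A k" "v = \<pi> x \<Omega>"
      by blast
    have "x \<in> span {c o\<^sub>L a | c a. c \<in> C k \<and> a \<in> A 0}"
      using towerC(8)[of k] x by blast
    then have "x \<in> (\<Union>k. A k) \<and> S (S (\<pi> x \<Omega>)) = \<alpha> *\<^sub>R S (\<pi> x \<Omega>)"
    proof (induction rule: span_induct_alt)
      case base
      have "\<pi> 0 = 0"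
        using gns_diff[OF g UA star_subalgebraD(2)[OF UA] star_subalgebraD(2)[OF UA]] by simp
      then show ?case
        using subspace_0[OF star_subalgebra_subspace[OF UA]] by simp
    next
      case (step r y z)
      then obtain c a where ca: "y = c o\<^sub>L a" "c \<in> C k" "a \<in> A 0"
        by blast
      then have mem: "c \<in> (\<Union>k. C k)" "c \<in> (\<Union>k. A k)" "a \<in> (\<Union>k. A k)"
        using UC by blast+
      have yU: "y \<in> (\<Union>k. A k)" "r *\<^sub>R y \<in> (\<Union>k. A k)"
        unfolding ca using star_subalgebraD(5)[OF UA mem(2,3)]
          subspace_scale[OF star_subalgebra_subspace[OF UA]] by blast+
      have "\<pi> y \<Omega> = \<pi> c (\<pi> a \<Omega>)"
        using g'(5)[OF mem(2,3)] by (simp add: ca)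
      then have "S (S (\<pi> y \<Omega>)) = \<alpha> *\<^sub>R S (\<pi> y \<Omega>)"
        using S0sq ca(3) S0A g'(9)[of "S0 a" \<alpha>] A0
        by (simp add: Sca[OF mem(1)] Sa subset_iff blinfun.scaleR_left blinfun.scaleR_right)
      then show ?case
        using step g'(3)[OF yU(2)] g'(9)[OF yU(1)] star_subalgebraD(3)[OF UA yU(2)]
        by (simp add: blinfun.add_left blinfun.add_right blinfun.scaleR_left blinfun.scaleR_right
            scaleR_add_right mult.commute)
    qed
    then show "(S o\<^sub>L S) v = (\<alpha> *\<^sub>R S) v"
      using x by (simp add: blinfun.scaleR_left)
  qed
  then have Ssq: "S (S v) = \<alpha> *\<^sub>R S v" for v
    by (metis blinfun_apply_blinfun_compose blinfun.scaleR_left)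

  have inj: "x = 0" if "x \<in> A 0" "\<pi> x \<Omega> = 0" for x
    using gns_cinner[OF g UA, of x x] that A0 tr0(2) unfolding faithful_on_def by (auto simp: subset_iff)
  have inj2: "x = y" if "x \<in> A 0" "y \<in> A 0" "\<pi> x \<Omega> = \<pi> y \<Omega>" for x y
  proof -
    have "x - y \<in> A 0"
      using that subspace_diff[OF star_subalgebra_subspace[OF A(1)]] by simp
    moreover have "\<pi> (x - y) \<Omega> = 0"
      using gns_diff[OF g UA subsetD[OF A0 that(1)] subsetD[OF A0 that(2)]] that(3)
      by (simp add: blinfun.diff_left)
    ultimately show ?thesis
      using inj[of "x - y"] by simp
  qed
  obtain x0 where x0: "x0 \<in> A 0" "S0 x0 \<noteq> 0"
    using assms(15) by blast
  define y where "y = S0 x0"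
  have y: "y \<in> A 0" "\<pi> y \<Omega> \<noteq> 0"
    using x0 S0A inj by (auto simp: y_def)
  have \<eta>: "\<pi> y \<Omega> = S (\<pi> x0 \<Omega>)"
    using Sa[OF x0(1)] by (simp add: y_def)
  have \<alpha>: "0 < \<alpha>" "\<alpha> < 1"
  proof -
    \<comment> \<open>On \<open>A\<^sub>0\<close> the meet of \<open>p\<close> and \<open>q\<close> is \<open>n\<close>, since \<open>C\<^sub>0\<close> is the intersection of \<open>B\<^sup>1\<^sub>0\<close> and \<open>B\<^sup>2\<^sub>0\<close>.\<close>
    have meet: "n (\<pi> y \<Omega>) = \<pi> y \<Omega>" if "p (\<pi> y \<Omega>) = \<pi> y \<Omega>" "q (\<pi> y \<Omega>) = \<pi> y \<Omega>"
    proof -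
      have "EB1 y = y" "EB2 y = y"
        using that Ep Eq y EA by (auto intro: inj2)
      then have "y \<in> C 0"
        using trace_cond_expD(1)[OF assms(11) y(1)] trace_cond_expD(1)[OF assms(12) y(1)] C01 by auto
      then show ?thesis
        using En[OF y(1)] trace_cond_expD(2)[OF assms(13)] by simp
    qed
    show "0 < \<alpha>" "\<alpha> < 1"
      using compressed_projection_eigenvalue_bounds[OF pr npq \<eta>[unfolded S] y(2) _ meet assms(16)]
        Ssq[of "\<pi> x0 \<Omega>"] by (simp_all add: \<eta>[symmetric] S[symmetric])
  qed
  have Sne: "S (\<pi> x0 \<Omega>) \<noteq> 0"
    using \<eta> y(2) by simp
  note angle = Ang_singleton[OF pr(1,2,3) npq S Ssq Sne \<alpha>]

  have "\<not> commuting_square (vector_state \<Omega>) N P Q M"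
  proof
    assume "commuting_square (vector_state \<Omega>) N P Q M"
    then obtain E\<^sub>P E\<^sub>Q E\<^sub>N where E: "trace_cond_exp (vector_state \<Omega>) M P E\<^sub>P"
      "trace_cond_exp (vector_state \<Omega>) M Q E\<^sub>Q"
      and eq: "\<And>x. x \<in> M \<Longrightarrow> E\<^sub>P (E\<^sub>Q x) = E\<^sub>N x \<and> E\<^sub>Q (E\<^sub>P x) = E\<^sub>N x"
      unfolding commuting_square_def by blast
    have alg: "star_subalgebra P" "star_subalgebra Q" "star_subalgebra M"
      using assms(8-10) by (auto simp: II1_factor_def factor_def intro: star_subalgebra_von_neumann_algebra)
    have sub: "P \<subseteq> M" "Q \<subseteq> M"
      unfolding assms(3-5) using UB1(2) UB2(2) by (auto intro!: commutant_mono image_mono)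
    have "p o\<^sub>L q = q o\<^sub>L p"
    proof (rule blinfun_eq_on_dense[OF g'(8)])
      fix v assume "v \<in> {\<pi> x \<Omega> | x. x \<in> (\<Union>k. A k)}"
      then obtain x where x: "x \<in> M" "v = x \<Omega>"
        unfolding assms(3) using commutant_commutant_superset[of "\<pi> ` (\<Union>k. A k)"] g'(1) by blast
      have EM: "E\<^sub>P x \<in> M" "E\<^sub>Q x \<in> M"
        using trace_cond_expD(1)[OF E(1) x(1)] trace_cond_expD(1)[OF E(2) x(1)] sub by auto
      show "(p o\<^sub>L q) v = (q o\<^sub>L p) v"
        using L2_proj_cond_exp[OF E(1) alg(1,3) sub(1)] L2_proj_cond_exp[OF E(2) alg(2,3) sub(2)]
          eq[OF x(1)] EM x by (simp add: LP LQ)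
    qed
    then show False
      using angle(1) by blast
  qed
  moreover have "Ang_alg \<Omega> P Q = {complex_of_real (arccos (sqrt \<alpha>))}"
    using angle(2) by (simp add: Ang_alg_def LP LQ)
  ultimately show ?thesis
    by blast
qed

end
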